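(* Let $1\le t<\min(d,N-d)$ and $w=(t+1,\dots,d,N-t+1,\dots,N)$. Then the decomposition of the coordinate ring $\mathbb{C}[D_t(\mathbb{C})]$ of the affine variety $D_t(\mathbb{C})$ into irreducible $L_w$-modules is multiplicity free.
   Context: Everything is over $\mathbb{C}$; $d,N$ are positive integers with $d<N$. $G_{d,N}$ is the Grassmannian of $d$-dimensional subspaces of $\mathbb{C}^N$ with its left $GL_N$-action, embedded in $\mathbb{P}(\bigwedge^d\mathbb{C}^N)$ by the Plücker embedding. $B$ (resp. $B^-$) is the group of upper (resp. lower) triangular matrices in $GL_N$. For $w=(\ell_1<\dots<\ell_d)$ with $1\le\ell_1$, $\ell_d\le N$, the Schubert variety is $X(w)=\overline{B[e_{\ell_1}\wedge\cdots\wedge e_{\ell_d}]}$ with reduced structure. $Q_w\supseteq B$ is the stabilizer of $X(w)$ in $GL_N$ under left multiplication and $L_w$ is its Levi part (the block diagonal Levi subgroup containing the diagonal torus). Let $e_{id}=e_1\wedge\cdots\wedge e_d$. The opposite big cell $B^-[e_{id}]$ is identified with the space $M_{N-d,d}(\mathbb{C})$ of $(N-d)\times d$ matrices by sending a matrix $A$ to the column span of the $N\times d$ matrix with upper block the $d\times d$ identity and lower block $A$. The determinantal variety $D_t(\mathbb{C})\subseteq M_{N-d,d}(\mathbb{C})$ is the set of matrices of rank $\le t$; under this identification it equals $Y(w)=B^-[e_{id}]\cap X(w)$ for $w=(t+1,\dots,d,N-t+1,\dots,N)$, and it is stable under $L_w=GL_d\times GL_{N-d}$. Multiplicity free means each irreducible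 $L_w$-module occurs at most once up to isomorphism. *)

theory Defs
  imports
    Complex_Main
    "HOL-Library.Function_Algebras"
    "Jordan_Normal_Form.DL_Rank"
    "Jordan_Normal_Form.DL_Submatrix"
begin

section \<open>Polynomial functions\<close>

text \<open>The \<open>\<complex>\<close>-algebra of functions generated by a set \<open>X\<close> of functions; when \<open>X\<close> consists of
  coordinate functions, these are the polynomial functions in those coordinates.\<close>

inductive_set polynomial_functions :: "('x \<Rightarrow> complex) set \<Rightarrow> ('x \<Rightarrow> complex) set"
  for X :: "('x \<Rightarrow> complex) set" where
  const: "(\<lambda>_. c) \<in> polynomial_functions X"
| coord: "x \<in> X \<Longrightarrow> x \<in> polynomial_functions X"
| add: "f \<in> polynomial_functions X \<Longrightarrow> g \<in> polynomial_functions X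
    \<Longrightarrow> (\<lambda>p. f p + g p) \<in> polynomial_functions X"
| mult: "f \<in> polynomial_functions X \<Longrightarrow> g \<in> polynomial_functions X
    \<Longrightarrow> (\<lambda>p. f p * g p) \<in> polynomial_functions X"

section \<open>The Grassmannian and its Zariski topology\<close>

definition grassmannian :: "nat \<Rightarrow> nat \<Rightarrow> complex vec set set" where
  "grassmannian d N = {V. VectorSpace.subspace class_ring V (module_vec TYPE(complex) N) \<and>
     vectorspace.dim class_ring ((module_vec TYPE(complex) N)\<lparr>carrier := V\<rparr>) = d}"

text \<open>The Pluecker coordinates of the column span of an \<open>N \<times> d\<close> matrix of rank \<open>d\<close> are its maximal
  minors, indexed by the \<open>d\<close>-element sets of rows (numbered from 0). They depend on the matrix only
  up to a common nonzero factor.\<close>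

definition pluecker_indices :: "nat \<Rightarrow> nat \<Rightarrow> nat set set" where
  "pluecker_indices d N = {I. I \<subseteq> {..<N} \<and> card I = d}"

definition pluecker :: "complex mat \<Rightarrow> nat set \<Rightarrow> complex" where
  "pluecker A I = det (submatrix A I UNIV)"

definition homogeneous_polynomials :: "nat \<Rightarrow> nat \<Rightarrow> ((nat set \<Rightarrow> complex) \<Rightarrow> complex) set" where
  "homogeneous_polynomials d N =
     {F \<in> polynomial_functions ((\<lambda>I p. p I) ` pluecker_indices d N).
        \<exists>k. \<forall>c p. F (\<lambda>I. c * p I) = c ^ k * F p}"

definition vanishes_at :: "nat \<Rightarrow> nat \<Rightarrow> ((nat set \<Rightarrow> complex) \<Rightarrow> complex) \<Rightarrow> complex vec set \<Rightarrow> bool" where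
  "vanishes_at d N F V \<longleftrightarrow>
     (\<forall>A\<in>carrier_mat N d. vec_space.col_space N A = V \<longrightarrow> F (pluecker A) = 0)"

text \<open>The Grassmannian is closed in \<open>\<P>(\<And>\<^sup>d \<complex>\<^sup>N)\<close>, so the closure of one of its subsets may be taken
  inside it.\<close>

definition zariski_closure :: "nat \<Rightarrow> nat \<Rightarrow> complex vec set set \<Rightarrow> complex vec set set" where
  "zariski_closure d N S = {V \<in> grassmannian d N. \<forall>F\<in>homogeneous_polynomials d N.
     (\<forall>U\<in>S. vanishes_at d N F U) \<longrightarrow> vanishes_at d N F V}"

section \<open>Schubert varieties, their stabilizers and Levi subgroups\<close>

definition GL :: "nat \<Rightarrow> complex mat monoid" where
  "GL N = units_of (ring_mat TYPE(complex) N ())"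

definition borel :: "nat \<Rightarrow> complex mat set" where
  "borel N = {g \<in> carrier (GL N). upper_triangular g}"

definition translate :: "complex mat \<Rightarrow> complex vec set \<Rightarrow> complex vec set" where
  "translate g V = (\<lambda>v. g *\<^sub>v v) ` V"

text \<open>The span of \<open>e\<^sub>l\<close> for \<open>l\<close> in \<open>w\<close>, which is the point \<open>[e\<^bsub>l\<^sub>1\<^esub> \<and> \<dots> \<and> e\<^bsub>l\<^sub>d\<^esub>]\<close>. The entries of \<open>w\<close> are
  1-based, whereas \<^const>\<open>unit_vec\<close> is 0-based.\<close>

definition coordinate_subspace :: "nat \<Rightarrow> nat list \<Rightarrow> complex vec set" where
  "coordinate_subspace N w = vec_space.col_space N (mat_of_cols N (map (\<lambda>l. unit_vec N (l - 1)) w))"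

definition schubert_variety :: "nat \<Rightarrow> nat list \<Rightarrow> complex vec set set" where
  "schubert_variety N w =
     zariski_closure (length w) N ((\<lambda>b. translate b (coordinate_subspace N w)) ` borel N)"

definition schubert_stabilizer :: "nat \<Rightarrow> nat list \<Rightarrow> complex mat set" where
  "schubert_stabilizer N w =
     {g \<in> carrier (GL N). translate g ` schubert_variety N w = schubert_variety N w}"

text \<open>For a parabolic subgroup \<open>Q\<close> containing the upper triangular matrices, the opposite parabolic
  subgroup consists of the transposes of the elements of \<open>Q\<close>; the Levi subgroup of \<open>Q\<close> containing the
  diagonal torus is the intersection of the two.\<close>

definition levi :: "nat \<Rightarrow> nat list \<Rightarrow> complex mat set" where
  "levi N w = {g \<in> schubert_stabilizer N w. transpose_mat g \<in> schubert_stabilizer N w}"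

section \<open>The opposite big cell and the determinantal variety\<close>

definition cell_point :: "nat \<Rightarrow> nat \<Rightarrow> complex mat \<Rightarrow> complex vec set" where
  "cell_point d N A = vec_space.col_space N (1\<^sub>m d @\<^sub>r A)"

text \<open>Left multiplication on the opposite big cell, transported to \<open>(N - d) \<times> d\<close> matrices; only
  meaningful if \<open>g\<close> maps the point of the cell given by \<open>A\<close> into the cell.\<close>

definition cell_action :: "nat \<Rightarrow> nat \<Rightarrow> complex mat \<Rightarrow> complex mat \<Rightarrow> complex mat" where
  "cell_action d N g A = (THE A'. A' \<in> carrier_mat (N - d) d \<and>
     cell_point d N A' = translate g (cell_point d N A))"

definition determinantal_variety :: "nat \<Rightarrow> nat \<Rightarrow> nat \<Rightarrow> complex mat set" where
  "determinantal_variety d N t = {A \<in> carrier_mat (N - d) d. vec_space.rank (N - d) A \<le> t}"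

text \<open>Functions on a set \<open>D\<close> of matrices are represented by their extensions by zero.\<close>

definition coordinate_ring :: "nat \<Rightarrow> nat \<Rightarrow> complex mat set \<Rightarrow> (complex mat \<Rightarrow> complex) set" where
  "coordinate_ring m n D = (\<lambda>F A. if A \<in> D then F A else 0) `
     polynomial_functions {\<lambda>A. A $$ (i, j) |i j. i < m \<and> j < n}"

definition function_action ::
  "nat \<Rightarrow> nat \<Rightarrow> complex mat set \<Rightarrow> complex mat \<Rightarrow> (complex mat \<Rightarrow> complex) \<Rightarrow> complex mat \<Rightarrow> complex" where
  "function_action d N D g f =
     (\<lambda>A. if A \<in> D then f (cell_action d N (inv\<^bsub>GL N\<^esub> g) A) else 0)"

section \<open>Multiplicity free modules\<close>

text \<open>All modules are complex vector spaces of functions, on which the elements of the set \<open>G\<close> act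
  through \<open>act\<close>.\<close>

global_interpretation fun_space: vector_space "\<lambda>(c::complex) (f::'x \<Rightarrow> complex) x. c * f x"
  by unfold_locales (auto simp: fun_eq_iff algebra_simps)

definition submodule_of ::
  "'g set \<Rightarrow> ('g \<Rightarrow> ('x \<Rightarrow> complex) \<Rightarrow> 'x \<Rightarrow> complex) \<Rightarrow> ('x \<Rightarrow> complex) set \<Rightarrow> ('x \<Rightarrow> complex) set \<Rightarrow> bool" where
  "submodule_of G act V M \<longleftrightarrow>
     V \<subseteq> M \<and> fun_space.subspace V \<and> (\<forall>g\<in>G. \<forall>f\<in>V. act g f \<in> V)"

definition irreducible_module ::
  "'g set \<Rightarrow> ('g \<Rightarrow> ('x \<Rightarrow> complex) \<Rightarrow> 'x \<Rightarrow> complex) \<Rightarrow> ('x \<Rightarrow> complex) set \<Rightarrow> bool" where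
  "irreducible_module G act V \<longleftrightarrow> submodule_of G act V V \<and> V \<noteq> {0} \<and>
     (\<forall>W. submodule_of G act W V \<longrightarrow> W = {0} \<or> W = V)"

definition isomorphic_modules ::
  "'g set \<Rightarrow> ('g \<Rightarrow> ('x \<Rightarrow> complex) \<Rightarrow> 'x \<Rightarrow> complex) \<Rightarrow> ('x \<Rightarrow> complex) set \<Rightarrow> ('x \<Rightarrow> complex) set \<Rightarrow> bool" where
  "isomorphic_modules G act V W \<longleftrightarrow> (\<exists>\<phi>. bij_betw \<phi> V W \<and>
     (\<forall>f\<in>V. \<forall>h\<in>V. \<phi> (f + h) = \<phi> f + \<phi> h) \<and>
     (\<forall>c. \<forall>f\<in>V. \<phi> (\<lambda>x. c * f x) = (\<lambda>x. c * \<phi> f x)) \<and>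
     (\<forall>g\<in>G. \<forall>f\<in>V. \<phi> (act g f) = act g (\<phi> f)))"

text \<open>Internal direct sum decompositions. The summands form a set rather than an indexed family;
  this loses nothing, because nonzero summands of an internal direct sum are distinct subspaces even
  if they are isomorphic.\<close>

definition irreducible_decomposition ::
  "'g set \<Rightarrow> ('g \<Rightarrow> ('x \<Rightarrow> complex) \<Rightarrow> 'x \<Rightarrow> complex) \<Rightarrow> ('x \<Rightarrow> complex) set \<Rightarrow> ('x \<Rightarrow> complex) set set \<Rightarrow> bool" where
  "irreducible_decomposition G act M \<V> \<longleftrightarrow>
     (\<forall>V\<in>\<V>. irreducible_module G act V) \<and>
     fun_space.span (\<Union>\<V>) = M \<and>
     (\<forall>V\<in>\<V>. V \<inter> fun_space.span (\<Union>(\<V> - {V})) = {0})"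

definition multiplicity_free ::
  "'g set \<Rightarrow> ('g \<Rightarrow> ('x \<Rightarrow> complex) \<Rightarrow> 'x \<Rightarrow> complex) \<Rightarrow> ('x \<Rightarrow> complex) set \<Rightarrow> bool" where
  "multiplicity_free G act M \<longleftrightarrow>
     (\<exists>\<V>. irreducible_decomposition G act M \<V>) \<and>
     (\<forall>\<V>. irreducible_decomposition G act M \<V> \<longrightarrow>
        (\<forall>V\<in>\<V>. \<forall>W\<in>\<V>. isomorphic_modules G act V W \<longrightarrow> V = W))"

end

theory Submission
  imports Defs "Jordan_Normal_Form.Schur_Decomposition"
begin

text \<open>
The coordinate ring is multiplicity free because its equivariant endomorphisms commute with each
other. If two different summands \<open>V\<close> and \<open>W\<close> of a decomposition into irreducible modules were isomorphic
via \<open>\<phi>\<close>, then \<open>\<phi>\<close> composed with the projection to \<open>V\<close>, and its inverse composed with the projection to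
\<open>W\<close>, would be two equivariant endomorphisms that do not commute (\<open>isomorphic_summands_eq\<close>).
The proof has three parts.

\<^emph>\<open>The group.\<close> The Schubert variety of \<open>w = (t + 1, \<dots>, d, N - t + 1, \<dots>, N)\<close> consists of the column spaces of
the \<open>N \<times> d\<close> matrices of rank \<open>d\<close> whose lower \<open>(N - d) \<times> d\<close> block has rank at most \<open>t\<close>
(\<open>schubert_variety_eq\<close>). The minors with more than \<open>t\<close> lower rows vanish on the Borel orbit, hence on its
closure, and this bounds the rank of the lower block. Conversely a point satisfying the bound is
joined to the base point of the orbit by a polynomial path whose general point lies in the orbit.
The stabilizer of this variety is the group of block upper triangular matrices: an element outside
that group yields an element of the stabilizer of the form \<open>1 + y e\<^sub>0\<^sup>T\<close>, where the lower part of \<open>y\<close>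
is nonzero, and such an element raises the rank of a suitable lower block to \<open>t + 1\<close>
(\<open>stabilizer_block_upper\<close>). So the Levi subgroup consists of the block diagonal matrices, and it acts on
functions on the matrices of rank at most \<open>t\<close> by \<open>f \<mapsto> (A \<mapsto> f (E * A * F))\<close>, where \<open>E\<close> and \<open>F\<close>
range over the invertible matrices (\<open>levi_action_image\<close>).

\<^emph>\<open>Existence of a decomposition.\<close> A form of degree \<open>k\<close> on the variety is given by a coefficient vector,
which is not unique. The standard hermitian product of coefficient vectors turns the preimage of a
submodule into one with an orthogonal complement, and the image of that complement is again a
submodule, because the group is closed under conjugate transposes (\<open>perp_invariant\<close>). Hence the forms of
degree \<open>k\<close> are spanned by irreducible submodules, and Zorn's lemma selects a direct sum
(\<open>irreducible_decomposition_exists\<close>).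

\<^emph>\<open>Commutativity.\<close> This is the trick of Gelfand. Let \<open>K\<^sub>w(z) = (\<Sum> z\<^sub>i\<^sub>j w\<^sub>i\<^sub>j)\<^sup>k\<close> for \<open>w\<close> in the
variety; these forms span all forms of degree \<open>k\<close> (\<open>forms_subset_span_kernel\<close>). If \<open>\<Phi>\<close> is an equivariant
endomorphism, then \<open>Q(z, w) = (\<Phi> K\<^sub>w)(z)\<close> is a polynomial in both arguments with
\<open>Q(E z F, w) = Q(z, E\<^sup>T w F\<^sup>T)\<close>, first for invertible \<open>E\<close> and \<open>F\<close> and then, by density, for all of them. Every
such \<open>Q\<close> is symmetric (\<open>invariant_kernel_symmetric\<close>): writing matrices of rank at most \<open>t\<close> as \<open>X * Y\<close> with
inner dimension \<open>t\<close> and shifting factors from one argument to the other gives \<open>Q(z, w) = q(x\<^sup>T)\<close> and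
\<open>Q(w, z) = q(x)\<close> for a \<open>t \<times> t\<close> matrix \<open>x\<close> and a polynomial \<open>q\<close> with \<open>q(x y) = q(y x)\<close>; such a \<open>q\<close>
depends only on the eigenvalues of its argument, so that \<open>q(x\<^sup>T) = q(x)\<close>. Applying the symmetry to
\<open>\<Phi>\<close>, to \<open>\<Psi>\<close> and to \<open>\<Psi> \<circ> \<Phi>\<close> gives \<open>\<Phi> \<circ> \<Psi> = \<Psi> \<circ> \<Phi>\<close> (\<open>endos_commute_kernel\<close>).
\<close>

section \<open>Polynomial functions\<close>

lemma polynomial_functions_sum:
  assumes "\<And>i. i \<in> A \<Longrightarrow> f i \<in> polynomial_functions X"
  shows "(\<lambda>p. \<Sum>i\<in>A. f i p) \<in> polynomial_functions X"
  using assms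
  by (induction A rule: infinite_finite_induct) (auto intro: polynomial_functions.intros)

lemma polynomial_functions_prod:
  assumes "\<And>i. i \<in> A \<Longrightarrow> f i \<in> polynomial_functions X"
  shows "(\<lambda>p. \<Prod>i\<in>A. f i p) \<in> polynomial_functions X"
  using assms
  by (induction A rule: infinite_finite_induct) (auto intro: polynomial_functions.intros)

lemma polynomial_functions_diff:
  assumes "f \<in> polynomial_functions X" "g \<in> polynomial_functions X"
  shows "(\<lambda>p. f p - g p) \<in> polynomial_functions X"
  using polynomial_functions.add[OF assms(1) polynomial_functions.mult[OF polynomial_functions.const[of "-1"] assms(2)]]
  by simp

lemma polynomial_functions_compose:
  assumes "f \<in> polynomial_functions X" "\<And>x. x \<in> X \<Longrightarrow> (\<lambda>p. x (h p)) \<in> polynomial_functions Y"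
  shows "(\<lambda>p. f (h p)) \<in> polynomial_functions Y"
  using assms(1) by induction (auto intro: polynomial_functions.intros assms(2))

lemma polynomial_functions_det:
  assumes "\<And>p. A p \<in> carrier_mat k k"
    and "\<And>i j. i < k \<Longrightarrow> j < k \<Longrightarrow> (\<lambda>p. A p $$ (i, j)) \<in> polynomial_functions X"
  shows "(\<lambda>p. det (A p)) \<in> polynomial_functions X"
proof -
  have "(\<lambda>p. \<Sum>q\<in>{q. q permutes {0..<k}}. signof q * (\<Prod>i = 0..<k. A p $$ (i, q i))) \<in> polynomial_functions X"
    by (intro polynomial_functions_sum polynomial_functions.mult polynomial_functions.const
        polynomial_functions_prod assms(2)) (auto simp: permutes_in_image)
  then show ?thesis using det_def'[OF assms(1)] by simp
qed

lemma polynomial_functions_mult_mat: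
  assumes "\<And>p. A p \<in> carrier_mat k l" "\<And>p. B p \<in> carrier_mat l r"
    and "\<And>i j. i < k \<Longrightarrow> j < l \<Longrightarrow> (\<lambda>p. A p $$ (i, j)) \<in> polynomial_functions X"
    and "\<And>i j. i < l \<Longrightarrow> j < r \<Longrightarrow> (\<lambda>p. B p $$ (i, j)) \<in> polynomial_functions X"
    and "i < k" "j < r"
  shows "(\<lambda>p. (A p * B p) $$ (i, j)) \<in> polynomial_functions X"
proof -
  have "(A p * B p) $$ (i, j) = (\<Sum>h\<in>{0..<l}. A p $$ (i, h) * B p $$ (h, j))" for p
    using assms(1)[of p] assms(2)[of p] assms(5,6) by (auto simp: scalar_prod_def)
  then show ?thesis
    using assms(3-6) by (auto intro!: polynomial_functions_sum polynomial_functions.mult)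
qed

lemma polynomial_functions_one_variable:
  fixes f :: "complex \<Rightarrow> complex"
  assumes "f \<in> polynomial_functions {\<lambda>s. s}"
  obtains q where "\<And>s. f s = poly q s"
proof -
  from assms have "\<exists>q. \<forall>s. f s = poly q s"
  proof induction
    case (const c)
    then show ?case by (intro exI[of _ "[:c:]"]) simp
  next
    case (coord x)
    then show ?case by (intro exI[of _ "[:0, 1:]"]) simp
  next
    case (add f g)
    then show ?case by (metis poly_add)
  next
    case (mult f g)
    then show ?case by (metis poly_mult)
  qed
  with that show ?thesis by blast
qed

text \<open>The substitute for Zariski density used throughout: the product of the polynomials \<open>\<delta>\<close> and \<open>f\<close> vanishes
identically and \<open>\<delta> \<noteq> 0\<close>, so \<open>f = 0\<close>. An identity thus has to be checked only at the general point of
a line that joins a given point to one where \<open>\<delta>\<close> does not vanish.\<close>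

lemma polynomial_functions_line_eq_zero:
  fixes f \<delta> :: "complex \<Rightarrow> complex"
  assumes "f \<in> polynomial_functions {\<lambda>s. s}" "\<delta> \<in> polynomial_functions {\<lambda>s. s}"
    and "\<delta> s\<^sub>0 \<noteq> 0" and "\<And>s. \<delta> s \<noteq> 0 \<Longrightarrow> f s = 0"
  shows "f s = 0"
proof -
  obtain p q where p: "\<And>s. f s = poly p s" and q: "\<And>s. \<delta> s = poly q s"
    using polynomial_functions_one_variable[OF assms(1)] polynomial_functions_one_variable[OF assms(2)] by metis
  have "poly (p * q) s = poly 0 s" for s using assms(4)[of s] p q by auto
  then have "p * q = 0" by (metis poly_eq_poly_eq_iff ext)
  moreover have "q \<noteq> 0" using assms(3) q by auto
  ultimately show ?thesis using p by simp
qed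

section \<open>Rank factorizations\<close>

context vec_space
begin

text \<open>A maximal independent subset of \<open>W\<close> is finite, because its size is bounded by \<open>n\<close>, and it spans \<open>W\<close>;
its elements are the columns of the matrix.\<close>

lemma subspace_eq_col_space:
  assumes "VectorSpace.subspace class_ring W V"
  shows "\<exists>k. \<exists>A\<in>carrier_mat n k. col_space A = W \<and> rank A = k"
proof -
  have W: "W \<subseteq> carrier_vec n"
    using assms unfolding VectorSpace.subspace_def submodule_def by auto
  have bound: "card T \<le> n" "finite T" if "T \<subseteq> W \<and> lin_indpt T" for T
    using that W li_le_dim[of T] fin_dim dim_is_n by auto
  have "\<exists>S. finite S \<and> maximal S (\<lambda>T. T \<subseteq> W \<and> lin_indpt T)"
    by (rule maximal_exists[of _ n "{}"]) (use bound finite_lin_indpt2[of "{}"] in auto)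
  then obtain S where "finite S" and max: "maximal S (\<lambda>T. T \<subseteq> W \<and> lin_indpt T)" by blast
  then have S: "S \<subseteq> W" "lin_indpt S" by (auto simp: maximal_def)
  have "span S \<subseteq> W" using span_is_subset[OF S(1)] assms by (simp add: VectorSpace.subspace_def)
  moreover have "W \<subseteq> span S"
  proof
    fix s assume s: "s \<in> W"
    show "s \<in> span S"
    proof (rule ccontr)
      assume n: "s \<notin> span S"
      then have "lin_indpt (S \<union> {s})"
        using lin_dep_iff_in_span[of S s] S s W by (meson order_trans span_mem subsetD)
      moreover have "s \<notin> S" using n span_mem[of S] S W by auto
      ultimately show False using max S s unfolding maximal_def by blast
    qed
  qed
  ultimately have span: "span S = W" by auto
  obtain ws where ws: "set ws = S" "distinct ws" using \<open>finite S\<close> finite_distinct_list by blast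
  let ?A = "mat_of_cols n ws"
  have wsc: "set ws \<subseteq> carrier_vec n" using ws S W by auto
  have cols: "cols ?A = ws" by (rule cols_mat_of_cols[OF wsc])
  have A: "?A \<in> carrier_mat n (length ws)" by simp
  have "col_space ?A = W" unfolding col_space_def cols ws(1) by (rule span)
  moreover have "rank ?A = length ws"
    using A by (rule lin_indpt_full_rank) (use cols ws S in simp_all)
  ultimately show ?thesis using A by blast
qed

lemma col_space_carrier: "A \<in> carrier_mat n k \<Longrightarrow> col_space A \<subseteq> carrier_vec n"
  unfolding col_space_eq[of A k] by auto

lemma mem_col_space:
  assumes "A \<in> carrier_mat n k"
  shows "v \<in> col_space A \<longleftrightarrow> (\<exists>x\<in>carrier_vec k. v = A *\<^sub>v x)"
  unfolding col_space_eq[OF assms] using assms by auto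

lemma factor_through_col_space:
  assumes A: "A \<in> carrier_mat n c" and X: "X \<in> carrier_mat n k" and sub: "col_space A \<subseteq> col_space X"
  shows "\<exists>Y\<in>carrier_mat k c. A = X * Y"
proof -
  have "\<exists>y\<in>carrier_vec k. col A j = X *\<^sub>v y" if "j < c" for j
  proof -
    have "A *\<^sub>v unit_vec c j = col A j" using A that by (intro eq_vecI) auto
    then have "col A j \<in> col_space A" unfolding mem_col_space[OF A]
      by (intro bexI[of _ "unit_vec c j"]) auto
    then show ?thesis using sub mem_col_space[OF X] by blast
  qed
  then have "\<forall>j\<in>{..<c}. \<exists>y. y \<in> carrier_vec k \<and> col A j = X *\<^sub>v y" by blast
  then obtain y where "\<forall>j\<in>{..<c}. y j \<in> carrier_vec k \<and> col A j = X *\<^sub>v y j"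
    by (rule bchoice[THEN exE])
  then have y: "y j \<in> carrier_vec k \<and> col A j = X *\<^sub>v y j" if "j < c" for j using that by simp
  let ?Y = "mat k c (\<lambda>(i, j). y j $ i)"
  have "A = X * ?Y"
  proof (rule eq_matI)
    fix i j assume "i < dim_row (X * ?Y)" "j < dim_col (X * ?Y)"
    then have ij: "i < n" "j < c" using X by auto
    have "col ?Y j = y j" using y[OF ij(2)] ij by (intro eq_vecI) auto
    then have "(X * ?Y) $$ (i, j) = (X *\<^sub>v y j) $ i" using ij X by simp
    also have "\<dots> = col A j $ i" using y[OF ij(2)] by simp
    finally show "A $$ (i, j) = (X * ?Y) $$ (i, j)" using ij A by simp
  qed (use A X in auto)
  then show ?thesis by (intro bexI[of _ ?Y]) auto
qed

lemma col_space_mult_subset: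
  assumes X: "X \<in> carrier_mat n k" and Y: "Y \<in> carrier_mat k c"
  shows "col_space (X * Y) \<subseteq> col_space X"
proof
  fix v assume "v \<in> col_space (X * Y)"
  then obtain x where "x \<in> carrier_vec c" "v = X * Y *\<^sub>v x" using mem_col_space[of "X * Y" c] X Y by auto
  then have "v = X *\<^sub>v (Y *\<^sub>v x)" "Y *\<^sub>v x \<in> carrier_vec k" using X Y by auto
  then show "v \<in> col_space X" unfolding mem_col_space[OF X] by blast
qed

lemma col_space_mono_rank:
  assumes A: "A \<in> carrier_mat n c" and X: "X \<in> carrier_mat n k" and sub: "col_space A \<subseteq> col_space X"
  shows "rank A \<le> rank X"
proof -
  have s: "VectorSpace.subspace class_ring (col_space B) V" if "B \<in> carrier_mat n j" for B j
    unfolding col_space_def using that cols_dim[of B] by (intro span_is_subspace) auto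
  have "vectorspace.dim class_ring (vs (col_space A)) \<le> vectorspace.dim class_ring (vs (col_space X))"
    using vectorspace.subspace_dim[OF subspace_is_vs[OF s[OF X]] nested_subspaces[OF s[OF X] s[OF A] sub]]
      fin_dim_span_cols[OF A] fin_dim_span_cols[OF X] by (simp add: col_space_def)
  then show ?thesis by (simp add: rank_def col_space_def)
qed

theorem rank_le_iff_factor:
  assumes A: "A \<in> carrier_mat n c"
  shows "rank A \<le> r \<longleftrightarrow> (\<exists>X\<in>carrier_mat n r. \<exists>Y\<in>carrier_mat r c. A = X * Y)"
proof
  assume "\<exists>X\<in>carrier_mat n r. \<exists>Y\<in>carrier_mat r c. A = X * Y"
  then obtain X Y where XY: "X \<in> carrier_mat n r" "Y \<in> carrier_mat r c" "A = X * Y" by blast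
  then have "rank A \<le> rank X" using col_space_mono_rank[OF A XY(1)] col_space_mult_subset by simp
  also have "\<dots> \<le> r" using rank_le_nc[OF XY(1)] .
  finally show "rank A \<le> r" .
next
  assume r: "rank A \<le> r"
  have "VectorSpace.subspace class_ring (col_space A) V"
    unfolding col_space_def using A cols_dim[of A] by (intro span_is_subspace) auto
  then obtain k X where X: "X \<in> carrier_mat n k" "col_space X = col_space A" "rank X = k"
    using subspace_eq_col_space by blast
  have "k \<le> r" using r X by (simp add: rank_def col_space_def)
  obtain Y where Y: "Y \<in> carrier_mat k c" "A = X * Y"
    using factor_through_col_space[OF A X(1)] X(2) by blast
  \<comment> \<open>A basis of the column space has only \<open>k \<le> r\<close> elements; zeros fill up the inner dimension.\<close>
  let ?X = "mat n r (\<lambda>(i, j). if j < k then X $$ (i, j) else 0)"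
  let ?Y = "mat r c (\<lambda>(i, j). if i < k then Y $$ (i, j) else 0)"
  have "A = ?X * ?Y"
  proof (rule eq_matI)
    fix i j assume "i < dim_row (?X * ?Y)" "j < dim_col (?X * ?Y)"
    then have ij: "i < n" "j < c" by auto
    have "(?X * ?Y) $$ (i, j) = (\<Sum>h\<in>{0..<r}. if h < k then X $$ (i, h) * Y $$ (h, j) else 0)"
      using ij by (auto simp: scalar_prod_def intro!: sum.cong)
    also have "\<dots> = (\<Sum>h\<in>{0..<k}. X $$ (i, h) * Y $$ (h, j))"
      using \<open>k \<le> r\<close> by (intro sum.mono_neutral_cong_right) auto
    also have "\<dots> = A $$ (i, j)" using ij X Y by (auto simp: scalar_prod_def)
    finally show "A $$ (i, j) = (?X * ?Y) $$ (i, j)" by simp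
  qed (use A in auto)
  then show "\<exists>X\<in>carrier_mat n r. \<exists>Y\<in>carrier_mat r c. A = X * Y"
    by (intro bexI[of _ ?X] bexI[of _ ?Y]) auto
qed

end

section \<open>Decompositions into irreducible modules\<close>

definition linear_action :: "'g set \<Rightarrow> ('g \<Rightarrow> ('x \<Rightarrow> complex) \<Rightarrow> 'x \<Rightarrow> complex) \<Rightarrow> bool" where
  "linear_action G act \<longleftrightarrow> (\<forall>g\<in>G. (\<forall>f h. act g (f + h) = act g f + act g h) \<and>
     (\<forall>c f. act g (\<lambda>x. c * f x) = (\<lambda>x. c * act g f x)))"

lemma linear_action_add: "linear_action G act \<Longrightarrow> g \<in> G \<Longrightarrow> act g (f + h) = act g f + act g h"
  by (simp add: linear_action_def)

lemma linear_action_scale: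
  "linear_action G act \<Longrightarrow> g \<in> G \<Longrightarrow> act g (\<lambda>x. c * f x) = (\<lambda>x. c * act g f x)"
  by (simp add: linear_action_def)

lemma linear_action_zero: assumes "linear_action G act" "g \<in> G" shows "act g 0 = 0"
  using linear_action_scale[OF assms, of 0 0] by (simp add: zero_fun_def)

lemma span_Union_invariant:
  assumes lin: "linear_action G act" and inv: "\<forall>V\<in>\<V>. \<forall>g\<in>G. \<forall>f\<in>V. act g f \<in> V"
    and g: "g \<in> G" and f: "f \<in> fun_space.span (\<Union>\<V>)"
  shows "act g f \<in> fun_space.span (\<Union>\<V>)"
  using f
proof (induction rule: fun_space.span_induct_alt)
  case base
  show ?case unfolding linear_action_zero[OF lin g] by (rule fun_space.span_zero)
next
  case (step c x y)
  then have "act g x \<in> fun_space.span (\<Union>\<V>)"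
    using inv g by (auto intro!: fun_space.span_base)
  then show ?case
    unfolding linear_action_add[OF lin g] linear_action_scale[OF lin g]
    by (intro fun_space.span_add fun_space.span_scale step.IH)
qed

lemma submodule_of_Int:
  assumes "submodule_of G act V V" "fun_space.subspace W" "\<forall>g\<in>G. \<forall>f\<in>W. act g f \<in> W"
  shows "submodule_of G act (V \<inter> W) V"
  using assms by (auto simp: submodule_of_def intro: fun_space.subspace_inter)

lemma span_finite_witness:
  assumes "x \<in> fun_space.span S"
  obtains T where "finite T" "T \<subseteq> S" "x \<in> fun_space.span T"
proof -
  from assms obtain T r where "finite T" "T \<subseteq> S" "x = (\<Sum>a\<in>T. (\<lambda>y. r a * a y))"
    unfolding fun_space.span_explicit by blast
  then show ?thesis
    using that[of T] by (auto intro!: fun_space.span_sum fun_space.span_scale intro: fun_space.span_base)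
qed

text \<open>A maximal independent family of irreducible submodules exists by Zorn's lemma, since independence is
tested on finitely many summands at a time. An irreducible submodule meets the span of this family in
a submodule of itself; if it is not contained in the span, it meets it in zero and could be added.\<close>

lemma irreducible_decomposition_exists:
  assumes lin: "linear_action G act"
    and M: "M \<subseteq> fun_space.span (\<Union>{V. irreducible_module G act V \<and> V \<subseteq> M})"
    and sub: "fun_space.subspace M"
  shows "\<exists>\<V>. irreducible_decomposition G act M \<V>"
proof -
  define I where "I = {V. irreducible_module G act V \<and> V \<subseteq> M}"
  define indep where "indep \<V> \<longleftrightarrow> (\<forall>V\<in>\<V>. V \<inter> fun_space.span (\<Union>(\<V> - {V})) = {0})"
    for \<V> :: "('b \<Rightarrow> complex) set set"
  have subI: "fun_space.subspace V" and invI: "\<forall>g\<in>G. \<forall>f\<in>V. act g f \<in> V"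
    and irrI: "\<And>W. submodule_of G act W V \<Longrightarrow> W = {0} \<or> W = V" if "V \<in> I" for V
    using that by (auto simp: I_def irreducible_module_def submodule_of_def)
  let ?A = "{\<V>. \<V> \<subseteq> I \<and> indep \<V>}"
  have "\<exists>\<V>\<in>?A. \<forall>X\<in>?A. \<V> \<subseteq> X \<longrightarrow> X = \<V>"
  proof (rule subset_Zorn')
    fix C assume C: "subset.chain ?A C"
    then have CA: "C \<subseteq> ?A" by (auto simp: subset.chain_def)
    have "V \<inter> fun_space.span (\<Union>(\<Union>C - {V})) = {0}" if V: "V \<in> \<Union>C" for V
    proof -
      have VI: "V \<in> I" using V CA by auto
      have "x = 0" if x: "x \<in> V" "x \<in> fun_space.span (\<Union>(\<Union>C - {V}))" for x
      proof -
        obtain T where T: "finite T" "T \<subseteq> \<Union>(\<Union>C - {V})" "x \<in> fun_space.span T"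
          using span_finite_witness[OF x(2)] .
        then have "\<forall>y\<in>T. \<exists>U. U \<in> \<Union>C - {V} \<and> y \<in> U" by blast
        then obtain u where u: "\<And>y. y \<in> T \<Longrightarrow> u y \<in> \<Union>C - {V} \<and> y \<in> u y"
          using bchoice[of T] by metis
        have "finite (insert V (u ` T))" "insert V (u ` T) \<subseteq> \<Union>C" "C \<noteq> {}"
          using T u V by auto
        \<comment> \<open>Finitely many members of a union of a chain lie in one member of the chain.\<close>
        from finite_subset_Union_chain[OF this C]
        obtain \<U> where \<U>: "\<U> \<in> C" "insert V (u ` T) \<subseteq> \<U>" .
        have "T \<subseteq> \<Union>(\<U> - {V})" using u \<U>(2) by blast
        then have "x \<in> fun_space.span (\<Union>(\<U> - {V}))"
          using T(3) fun_space.span_mono by blast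
        then show ?thesis using \<U> CA x(1) by (auto simp: indep_def)
      qed
      moreover have "0 \<in> V" using subI[OF VI] by (rule fun_space.subspace_0)
      moreover have "0 \<in> fun_space.span (\<Union>(\<Union>C - {V}))" by (rule fun_space.span_zero)
      ultimately show ?thesis by (intro equalityI subsetI) simp_all
    qed
    then have "indep (\<Union>C)" unfolding indep_def by (rule ballI)
    moreover have "\<Union>C \<subseteq> I" using CA by blast
    ultimately show "\<Union>C \<in> ?A" by simp
  qed
  then obtain \<V> where \<V>A: "\<V> \<in> ?A" and mx: "\<forall>X\<in>?A. \<V> \<subseteq> X \<longrightarrow> X = \<V>"
    by (rule bexE)
  have \<V>: "\<V> \<subseteq> I" "indep \<V>" using \<V>A by simp_all
  have max: "X = \<V>" if "X \<subseteq> I" "indep X" "\<V> \<subseteq> X" for X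
    using mx that by simp
  let ?S = "fun_space.span (\<Union>\<V>)"
  have inv: "\<forall>g\<in>G. \<forall>f\<in>?S. act g f \<in> ?S"
    using span_Union_invariant[OF lin] \<V>(1) invI by blast
  have "V \<subseteq> ?S" if V: "V \<in> I" for V
  proof (rule ccontr)
    assume n: "\<not> V \<subseteq> ?S"
    have "submodule_of G act (V \<inter> ?S) V"
      using V inv by (intro submodule_of_Int) (auto simp: I_def irreducible_module_def)
    with n irrI[OF V] have 0: "V \<inter> ?S = {0}" by blast
    have VV: "V \<notin> \<V>" using n by (auto intro: fun_space.span_base)
    have "U \<inter> fun_space.span (\<Union>(insert V \<V> - {U})) = {0}" if U: "U \<in> insert V \<V>" for U
    proof (cases "U = V")
      case True
      then show ?thesis using 0 VV by simp
    next
      case False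
      then have UV: "U \<in> \<V>" and eq: "\<Union>(insert V \<V> - {U}) = V \<union> \<Union>(\<V> - {U})" using U by auto
      have "x = 0" if x: "x \<in> U" "x \<in> fun_space.span (\<Union>(insert V \<V> - {U}))" for x
      proof -
        from x(2) obtain v y where vy: "x = v + y" "v \<in> V" "y \<in> fun_space.span (\<Union>(\<V> - {U}))"
          unfolding eq fun_space.span_Un fun_space.span_eq_iff[THEN iffD2, OF subI[OF V]] by blast
        have "x \<in> ?S" "y \<in> ?S" using x(1) UV vy(3) fun_space.span_mono[of "\<Union>(\<V> - {U})" "\<Union>\<V>"]
          by (auto intro: fun_space.span_base)
        then have "x - y \<in> ?S" by (rule fun_space.span_diff)
        then have "v = 0" using 0 vy by auto
        then show ?thesis using vy x(1) \<V>(2) UV by (auto simp: indep_def)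
      qed
      moreover have "0 \<in> U" using UV \<V>(1) subI fun_space.subspace_0 by blast
      moreover have "0 \<in> fun_space.span (\<Union>(insert V \<V> - {U}))" by (rule fun_space.span_zero)
      ultimately show ?thesis by (intro equalityI subsetI) simp_all
    qed
    then have "indep (insert V \<V>)" by (simp add: indep_def)
    from max[OF _ this] V \<V>(1) VV show False by blast
  qed
  then have "fun_space.span (\<Union>I) \<subseteq> ?S" by (intro fun_space.span_minimal) auto
  then have "M \<subseteq> ?S" using M unfolding I_def[symmetric] by blast
  moreover have "?S \<subseteq> M" using \<V>(1) sub by (intro fun_space.span_minimal) (auto simp: I_def)
  ultimately show ?thesis using \<V> by (intro exI[of _ \<V>]) (auto simp: irreducible_decomposition_def indep_def I_def)
qed

lemma sum_fun_apply: "(\<Sum>i\<in>S. f i) x = (\<Sum>i\<in>S. f i x)"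
  by (induction S rule: infinite_finite_induct) simp_all

lemma irreducible_moduleD:
  assumes "irreducible_module G act V"
  shows "fun_space.subspace V" "V \<noteq> {0}" "g \<in> G \<Longrightarrow> f \<in> V \<Longrightarrow> act g f \<in> V"
  using assms unfolding irreducible_module_def submodule_of_def by auto

text \<open>Extend a basis of \<open>U\<close> by \<open>f\<close> and take the coordinate of \<open>f\<close>.\<close>

lemma fun_space_functional:
  assumes U: "fun_space.subspace U" and f: "f \<notin> U"
  shows "\<exists>L :: ('x \<Rightarrow> complex) \<Rightarrow> complex. (\<forall>g h. L (g + h) = L g + L h) \<and>
    (\<forall>c g. L (\<lambda>x. c * g x) = c * L g) \<and> (\<forall>u\<in>U. L u = 0) \<and> L f \<noteq> 0"
proof -
  interpret pair: vector_space_pair "\<lambda>(c::complex) (f::'x \<Rightarrow> complex) x. c * f x" "(*)"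
    by unfold_locales (auto simp: algebra_simps)
  obtain B where B: "B \<subseteq> U" "fun_space.independent B" "U \<subseteq> fun_space.span B"
    using fun_space.maximal_independent_subset[of U] by blast
  have span: "fun_space.span B = U" using B U by (simp add: fun_space.span_subspace)
  have "fun_space.independent (insert f B)" using B f span by (simp add: fun_space.independent_insertI)
  from pair.linear_independent_extend[OF this, of "\<lambda>g. if g = f then 1 else 0"]
  obtain L where lin: "Vector_Spaces.linear (\<lambda>c f x. c * f x) (*) L"
    and L: "\<forall>x\<in>insert f B. L x = (if x = f then 1 else 0)" by blast
  interpret L: Vector_Spaces.linear "\<lambda>(c::complex) (f::'x \<Rightarrow> complex) x. c * f x" "(*)" L by (rule lin)
  have "L u = 0" if "u \<in> U" for u
  proof -
    have "u \<in> fun_space.span B" using that span by simp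
    then show ?thesis
    proof (induction rule: fun_space.span_induct_alt)
      case base
      show ?case by (rule L.zero)
    next
      case (step c x y)
      have "x \<noteq> f" using step(1) B(1) f by auto
      then have "L x = 0" using L step(1) by simp
      then show ?case unfolding L.add L.scale using step by simp
    qed
  qed
  moreover have "L f \<noteq> 0" using L by simp
  ultimately show ?thesis by (intro exI[of _ L]) (simp add: L.add L.scale)
qed

text \<open>Only the values on \<open>M\<close> matter; the type forces \<open>\<Phi>\<close> to be defined on all functions.\<close>

definition equivariant_endo ::
  "'g set \<Rightarrow> ('g \<Rightarrow> ('x \<Rightarrow> complex) \<Rightarrow> 'x \<Rightarrow> complex) \<Rightarrow> ('x \<Rightarrow> complex) set
    \<Rightarrow> (('x \<Rightarrow> complex) \<Rightarrow> 'x \<Rightarrow> complex) \<Rightarrow> bool" where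
  "equivariant_endo G act M \<Phi> \<longleftrightarrow> (\<forall>f\<in>M. \<Phi> f \<in> M) \<and>
     (\<forall>f\<in>M. \<forall>h\<in>M. \<Phi> (f + h) = \<Phi> f + \<Phi> h) \<and>
     (\<forall>c. \<forall>f\<in>M. \<Phi> (\<lambda>x. c * f x) = (\<lambda>x. c * \<Phi> f x)) \<and>
     (\<forall>g\<in>G. \<forall>f\<in>M. \<Phi> (act g f) = act g (\<Phi> f))"

lemma decomposition_projection:
  assumes lin: "linear_action G act" and dec: "irreducible_decomposition G act M \<V>" and V: "V \<in> \<V>"
  shows "\<exists>P. equivariant_endo G act M P \<and> (\<forall>f\<in>M. P f \<in> V) \<and> (\<forall>v\<in>V. P v = v) \<and>
    (\<forall>u\<in>fun_space.span (\<Union>(\<V> - {V})). P u = 0)"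
proof -
  let ?R = "fun_space.span (\<Union>(\<V> - {V}))"
  have subV: "fun_space.subspace V" and invV: "\<And>g f. g \<in> G \<Longrightarrow> f \<in> V \<Longrightarrow> act g f \<in> V"
    using dec V by (auto simp: irreducible_decomposition_def irreducible_module_def submodule_of_def)
  have invR: "\<And>g f. g \<in> G \<Longrightarrow> f \<in> ?R \<Longrightarrow> act g f \<in> ?R"
    using span_Union_invariant[OF lin, of "\<V> - {V}"] dec
    by (auto simp: irreducible_decomposition_def irreducible_module_def submodule_of_def)
  have Un: "\<Union>\<V> = V \<union> \<Union>(\<V> - {V})" using V by auto
  have M: "M = {v + r |v r. v \<in> V \<and> r \<in> ?R}"
    using dec unfolding irreducible_decomposition_def Un fun_space.span_Un
      fun_space.span_eq_iff[THEN iffD2, OF subV] by blast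
  have int: "V \<inter> ?R = {0}" using dec V by (auto simp: irreducible_decomposition_def)
  define P where "P f = (THE v. v \<in> V \<and> f - v \<in> ?R)" for f
  have P: "P f = v" if "v \<in> V" "f - v \<in> ?R" for f v
    unfolding P_def
  proof (rule the_equality)
    fix u assume u: "u \<in> V \<and> f - u \<in> ?R"
    have "u - v \<in> V" using u that subV fun_space.subspace_diff by blast
    moreover have "(f - v) - (f - u) \<in> ?R" using u that fun_space.span_diff by blast
    ultimately have "u - v \<in> V \<inter> ?R" by simp
    then show "u = v" using int by auto
  qed (use that in auto)
  have PM: "P f \<in> V" "f - P f \<in> ?R" if f: "f \<in> M" for f
  proof -
    obtain v r where "f = v + r" "v \<in> V" "r \<in> ?R" using f M by auto
    then show "P f \<in> V" "f - P f \<in> ?R" using P[of v f] by auto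
  qed
  have V_M: "V \<subseteq> M"
  proof
    fix v assume "v \<in> V"
    moreover have "v = v + 0" by simp
    ultimately show "v \<in> M" unfolding M using fun_space.span_zero by blast
  qed
  have "equivariant_endo G act M P"
    unfolding equivariant_endo_def
  proof (intro conjI ballI allI)
    fix f assume f: "f \<in> M"
    show "P f \<in> M" using PM(1)[OF f] V_M by auto
    show "P (\<lambda>x. c * f x) = (\<lambda>x. c * P f x)" for c
      using fun_space.subspace_scale[OF subV PM(1)[OF f], of c] fun_space.span_scale[OF PM(2)[OF f], of c]
      by (intro P) (auto simp: algebra_simps fun_diff_def)
    show "P (act g f) = act g (P f)" if g: "g \<in> G" for g
    proof (rule P)
      show "act g (P f) \<in> V" using invV g PM f by auto
      have "act g f = act g (f - P f) + act g (P f)"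
        using linear_action_add[OF lin g, of "f - P f" "P f"] by simp
      then show "act g f - act g (P f) \<in> ?R" using invR[OF g PM(2)[OF f]] by simp
    qed
    show "P (f + h) = P f + P h" if h: "h \<in> M" for h
      using fun_space.subspace_add[OF subV PM(1)[OF f] PM(1)[OF h]] fun_space.span_add[OF PM(2)[OF f] PM(2)[OF h]]
      by (intro P) (auto simp: algebra_simps)
  qed
  moreover have "P v = v" if "v \<in> V" for v using that by (intro P) (auto intro: fun_space.span_zero)
  moreover have "P u = 0" if "u \<in> ?R" for u using that fun_space.subspace_0[OF subV] by (intro P) auto
  ultimately show ?thesis using PM(1) by (intro exI[of _ P]) simp
qed

text \<open>With the projections \<open>P\<close> and \<open>Q\<close> to \<open>V\<close> and \<open>W\<close>, the endomorphisms \<open>\<phi> \<circ> P\<close> and \<open>\<phi>\<^sup>-\<^sup>1 \<circ> Q\<close> compose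
to the identity of \<open>V\<close> in one order and to zero on \<open>V\<close> in the other.\<close>

lemma isomorphic_summands_eq:
  assumes lin: "linear_action G act"
    and comm: "\<And>\<Phi> \<Psi> f. equivariant_endo G act M \<Phi> \<Longrightarrow> equivariant_endo G act M \<Psi> \<Longrightarrow> f \<in> M \<Longrightarrow>
      \<Phi> (\<Psi> f) = \<Psi> (\<Phi> f)"
    and dec: "irreducible_decomposition G act M \<V>" and VW: "V \<in> \<V>" "W \<in> \<V>"
    and iso: "isomorphic_modules G act V W"
  shows "V = W"
proof (rule ccontr)
  assume ne: "V \<noteq> W"
  obtain P where P0: "equivariant_endo G act M P \<and> (\<forall>f\<in>M. P f \<in> V) \<and> (\<forall>v\<in>V. P v = v) \<and>
      (\<forall>u\<in>fun_space.span (\<Union>(\<V> - {V})). P u = 0)"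
    using decomposition_projection[OF lin dec VW(1)] by (rule exE)
  have P: "equivariant_endo G act M P" "\<And>f. f \<in> M \<Longrightarrow> P f \<in> V" "\<And>v. v \<in> V \<Longrightarrow> P v = v"
    "\<And>u. u \<in> fun_space.span (\<Union>(\<V> - {V})) \<Longrightarrow> P u = 0"
    using P0 by simp_all
  obtain Q where Q0: "equivariant_endo G act M Q \<and> (\<forall>f\<in>M. Q f \<in> W) \<and> (\<forall>v\<in>W. Q v = v) \<and>
      (\<forall>u\<in>fun_space.span (\<Union>(\<V> - {W})). Q u = 0)"
    using decomposition_projection[OF lin dec VW(2)] by (rule exE)
  have Q: "equivariant_endo G act M Q" "\<And>f. f \<in> M \<Longrightarrow> Q f \<in> W" "\<And>v. v \<in> W \<Longrightarrow> Q v = v"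
    "\<And>u. u \<in> fun_space.span (\<Union>(\<V> - {W})) \<Longrightarrow> Q u = 0"
    using Q0 by simp_all
  have QV: "Q v = 0" if "v \<in> V" for v
    using that VW ne by (intro Q(4) fun_space.span_base) auto
  obtain \<phi> where bij: "bij_betw \<phi> V W"
    and add: "\<And>f h. f \<in> V \<Longrightarrow> h \<in> V \<Longrightarrow> \<phi> (f + h) = \<phi> f + \<phi> h"
    and scale: "\<And>c f. f \<in> V \<Longrightarrow> \<phi> (\<lambda>x. c * f x) = (\<lambda>x. c * \<phi> f x)"
    and equi: "\<And>g f. g \<in> G \<Longrightarrow> f \<in> V \<Longrightarrow> \<phi> (act g f) = act g (\<phi> f)"
    using iso unfolding isomorphic_modules_def by blast
  define \<psi> where "\<psi> = the_inv_into V \<phi>"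
  have inj: "inj_on \<phi> V" and img: "\<phi> ` V = W" using bij by (auto simp: bij_betw_def)
  have \<psi>: "\<psi> w \<in> V" "\<phi> (\<psi> w) = w" if "w \<in> W" for w
    using that inj img unfolding \<psi>_def by (auto simp: f_the_inv_into_f the_inv_into_into)
  have \<psi>\<phi>: "\<psi> (\<phi> v) = v" if "v \<in> V" for v
    using that inj unfolding \<psi>_def by (simp add: the_inv_into_f_f)
  have irr: "submodule_of G act U U" "U \<noteq> {0}" if "U \<in> \<V>" for U
    using dec that by (simp_all add: irreducible_decomposition_def irreducible_module_def)
  have mods: "fun_space.subspace U" "\<And>g f. g \<in> G \<Longrightarrow> f \<in> U \<Longrightarrow> act g f \<in> U" if "U \<in> \<V>" for U
    using irr(1)[OF that] by (simp_all add: submodule_of_def)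
  have inM: "U \<subseteq> M" if "U \<in> \<V>" for U
  proof -
    have "\<Union>\<V> \<subseteq> M" using dec fun_space.span_superset[of "\<Union>\<V>"] by (simp add: irreducible_decomposition_def)
    then show ?thesis using that by blast
  qed
  have \<phi>W: "\<phi> v \<in> W" if "v \<in> V" for v using img that by auto
  have \<Phi>: "equivariant_endo G act M (\<phi> \<circ> P)"
    unfolding equivariant_endo_def o_def
  proof (intro conjI ballI allI)
    fix f assume f: "f \<in> M"
    note Pf = P(2)[OF f]
    show "\<phi> (P f) \<in> M" using \<phi>W[OF Pf] inM[OF VW(2)] by blast
    show "\<phi> (P (\<lambda>x. c * f x)) = (\<lambda>x. c * \<phi> (P f) x)" for c
      using P(1) f scale[OF Pf] by (simp add: equivariant_endo_def)
    show "\<phi> (P (act g f)) = act g (\<phi> (P f))" if "g \<in> G" for g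
      using P(1) f equi[OF that Pf] that by (simp add: equivariant_endo_def)
    show "\<phi> (P (f + h)) = \<phi> (P f) + \<phi> (P h)" if h: "h \<in> M" for h
      using P(1) f h add[OF Pf P(2)[OF h]] by (simp add: equivariant_endo_def)
  qed
  have \<psi>add: "\<psi> (f + h) = \<psi> f + \<psi> h" if "f \<in> W" "h \<in> W" for f h
    using \<psi>\<phi>[OF fun_space.subspace_add[OF mods(1)[OF VW(1)] \<psi>(1)[OF that(1)] \<psi>(1)[OF that(2)]]]
      add[OF \<psi>(1)[OF that(1)] \<psi>(1)[OF that(2)]] \<psi>(2)[OF that(1)] \<psi>(2)[OF that(2)]
    by (simp only:)
  have \<psi>scale: "\<psi> (\<lambda>x. c * f x) = (\<lambda>x. c * \<psi> f x)" if "f \<in> W" for f c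
    using \<psi>\<phi>[OF fun_space.subspace_scale[OF mods(1)[OF VW(1)] \<psi>(1)[OF that(1)]]]
      scale[OF \<psi>(1)[OF that(1)]] \<psi>(2)[OF that(1)]
    by (simp only:)
  have \<psi>equi: "\<psi> (act g f) = act g (\<psi> f)" if "f \<in> W" "g \<in> G" for f g
    using \<psi>\<phi>[OF mods(2)[OF VW(1) that(2) \<psi>(1)[OF that(1)]]] equi[OF that(2) \<psi>(1)[OF that(1)]]
      \<psi>(2)[OF that(1)]
    by (simp only:)
  have \<Psi>: "equivariant_endo G act M (\<psi> \<circ> Q)"
    unfolding equivariant_endo_def o_def
  proof (intro conjI ballI allI)
    fix f assume f: "f \<in> M"
    note Qf = Q(2)[OF f]
    show "\<psi> (Q f) \<in> M" using \<psi>(1)[OF Qf] inM[OF VW(1)] by blast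
    show "\<psi> (Q (\<lambda>x. c * f x)) = (\<lambda>x. c * \<psi> (Q f) x)" for c
      using Q(1) f \<psi>scale[OF Qf] by (simp add: equivariant_endo_def)
    show "\<psi> (Q (act g f)) = act g (\<psi> (Q f))" if "g \<in> G" for g
      using Q(1) f \<psi>equi[OF Qf that] that by (simp add: equivariant_endo_def)
    show "\<psi> (Q (f + h)) = \<psi> (Q f) + \<psi> (Q h)" if h: "h \<in> M" for h
      using Q(1) f h \<psi>add[OF Qf Q(2)[OF h]] by (simp add: equivariant_endo_def)
  qed
  have V0: "0 \<in> V" and W0: "0 \<in> W" using mods(1) VW fun_space.subspace_0 by blast+
  have zero: "\<psi> 0 = 0" "\<phi> 0 = 0"
    using add_cancel_left_left \<psi>add[OF W0 W0] add[OF V0 V0] by (metis add.right_neutral)+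
  have "v = 0" if v: "v \<in> V" for v
  proof -
    have "v = (\<psi> \<circ> Q) ((\<phi> \<circ> P) v)"
      unfolding o_def P(3)[OF v] Q(3)[OF \<phi>W[OF v]] \<psi>\<phi>[OF v] by (rule refl)
    also have "\<dots> = (\<phi> \<circ> P) ((\<psi> \<circ> Q) v)"
      by (rule comm[OF \<Phi> \<Psi> subsetD[OF inM[OF VW(1)] v], symmetric])
    also have "\<dots> = 0"
      unfolding o_def QV[OF v] zero P(3)[OF V0] by (rule refl)
    finally show ?thesis .
  qed
  then show False using irr(2)[OF VW(1)] V0 by blast
qed

section \<open>Rank varieties\<close>

definition rank_variety :: "nat \<Rightarrow> nat \<Rightarrow> nat \<Rightarrow> complex mat set" where
  "rank_variety m n t = {A \<in> carrier_mat m n. vec_space.rank m A \<le> t}"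

lemma rank_variety_iff_factor:
  "A \<in> rank_variety m n t \<longleftrightarrow> (\<exists>X\<in>carrier_mat m t. \<exists>Y\<in>carrier_mat t n. A = X * Y)"
proof (cases "A \<in> carrier_mat m n")
  case True
  then show ?thesis unfolding rank_variety_def using vec_space.rank_le_iff_factor[OF True] by simp
next
  case False
  then show ?thesis unfolding rank_variety_def by auto
qed

lemma rank_variety_carrier: "A \<in> rank_variety m n t \<Longrightarrow> A \<in> carrier_mat m n"
  by (simp add: rank_variety_def)

lemma rank_variety_mono: "s \<le> t \<Longrightarrow> rank_variety m n s \<subseteq> rank_variety m n t"
  by (auto simp: rank_variety_def)

lemma rank_variety_mult:
  assumes "A \<in> rank_variety m n t" "E \<in> carrier_mat k m" "F \<in> carrier_mat n l"
  shows "E * A * F \<in> rank_variety k l t"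
proof -
  obtain X Y where XY: "X \<in> carrier_mat m t" "Y \<in> carrier_mat t n" "A = X * Y"
    using assms(1) by (auto simp: rank_variety_iff_factor)
  have "E * A * F = E * X * Y * F" using XY assms by simp
  also have "\<dots> = (E * X) * (Y * F)"
    using XY assms by (intro assoc_mult_mat[of _ k t _ n _ l]) auto
  finally have "E * A * F = (E * X) * (Y * F)" .
  moreover have "E * X \<in> carrier_mat k t" "Y * F \<in> carrier_mat t l" using XY assms by auto
  ultimately show ?thesis unfolding rank_variety_iff_factor by blast
qed

lemma rank_variety_cnj:
  assumes "A \<in> rank_variety m n t"
  shows "map_mat cnj A \<in> rank_variety m n t"
proof -
  obtain X Y where XY: "X \<in> carrier_mat m t" "Y \<in> carrier_mat t n" "A = X * Y"
    using assms by (auto simp: rank_variety_iff_factor)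
  have "map_mat cnj A = map_mat cnj X * map_mat cnj Y"
    using XY by (intro eq_matI) (auto simp: scalar_prod_def)
  moreover have "map_mat cnj X \<in> carrier_mat m t" "map_mat cnj Y \<in> carrier_mat t n" using XY by auto
  ultimately show ?thesis unfolding rank_variety_iff_factor by blast
qed

section \<open>Polynomial paths\<close>

definition polynomial_path :: "nat \<Rightarrow> nat \<Rightarrow> (complex \<Rightarrow> complex mat) \<Rightarrow> bool" where
  "polynomial_path m n \<gamma> \<longleftrightarrow> (\<forall>s. \<gamma> s \<in> carrier_mat m n) \<and>
     (\<forall>i<m. \<forall>j<n. (\<lambda>s. \<gamma> s $$ (i, j)) \<in> polynomial_functions {\<lambda>s. s})"

text \<open>Restrictions of polynomials to \<open>D\<close> have this property, and it is all that the density arguments need;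
it avoids choosing a polynomial that extends \<open>q\<close>.\<close>

definition polynomial_along_paths :: "nat \<Rightarrow> nat \<Rightarrow> complex mat set \<Rightarrow> (complex mat \<Rightarrow> complex) \<Rightarrow> bool" where
  "polynomial_along_paths m n D q \<longleftrightarrow> (\<forall>\<gamma>. polynomial_path m n \<gamma> \<longrightarrow> (\<forall>s. \<gamma> s \<in> D) \<longrightarrow>
     (\<lambda>s. q (\<gamma> s)) \<in> polynomial_functions {\<lambda>s. s})"

lemma polynomial_pathD:
  assumes "polynomial_path m n \<gamma>"
  shows "\<gamma> s \<in> carrier_mat m n"
    and "i < m \<Longrightarrow> j < n \<Longrightarrow> (\<lambda>s. \<gamma> s $$ (i, j)) \<in> polynomial_functions {\<lambda>s. s}"
  using assms by (simp_all add: polynomial_path_def)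

lemma polynomial_along_pathsD:
  "polynomial_along_paths m n D q \<Longrightarrow> polynomial_path m n \<gamma> \<Longrightarrow> (\<And>s. \<gamma> s \<in> D) \<Longrightarrow>
    (\<lambda>s. q (\<gamma> s)) \<in> polynomial_functions {\<lambda>s. s}"
  by (simp add: polynomial_along_paths_def)

lemma polynomial_path_const: "A \<in> carrier_mat m n \<Longrightarrow> polynomial_path m n (\<lambda>_. A)"
  by (simp add: polynomial_path_def polynomial_functions.const)

lemma polynomial_path_mult:
  assumes "polynomial_path m k \<gamma>" "polynomial_path k n \<delta>"
  shows "polynomial_path m n (\<lambda>s. \<gamma> s * \<delta> s)"
  unfolding polynomial_path_def
proof (intro conjI allI impI)
  show "\<gamma> s * \<delta> s \<in> carrier_mat m n" for s
    using polynomial_pathD(1)[OF assms(1)] polynomial_pathD(1)[OF assms(2)] by (rule mult_carrier_mat)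
  show "(\<lambda>s. (\<gamma> s * \<delta> s) $$ (i, j)) \<in> polynomial_functions {\<lambda>s. s}" if "i < m" "j < n" for i j
    by (rule polynomial_functions_mult_mat[where l = k])
      (use that polynomial_pathD[OF assms(1)] polynomial_pathD[OF assms(2)] in simp_all)
qed

lemma polynomial_path_transpose:
  assumes "polynomial_path m n \<gamma>"
  shows "polynomial_path n m (\<lambda>s. transpose_mat (\<gamma> s))"
  unfolding polynomial_path_def
proof (intro conjI allI impI)
  note c = polynomial_pathD[OF assms]
  show "transpose_mat (\<gamma> s) \<in> carrier_mat n m" for s using c(1) by simp
  show "(\<lambda>s. transpose_mat (\<gamma> s) $$ (i, j)) \<in> polynomial_functions {\<lambda>s. s}" if "i < n" "j < m" for i j
  proof -
    have "transpose_mat (\<gamma> s) $$ (i, j) = \<gamma> s $$ (j, i)" for s using c(1)[of s] that by simp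
    then show ?thesis using c(2) that by simp
  qed
qed

lemma polynomial_path_line:
  assumes "A \<in> carrier_mat m n" "B \<in> carrier_mat m n"
  shows "polynomial_path m n (\<lambda>s. mat m n (\<lambda>ij. (1 - s) * A $$ ij + s * B $$ ij))"
  unfolding polynomial_path_def
  by (auto intro!: polynomial_functions.add polynomial_functions.mult polynomial_functions_diff
      intro: polynomial_functions.const polynomial_functions.coord)

lemma polynomial_path_det:
  "polynomial_path k k \<gamma> \<Longrightarrow> (\<lambda>s. det (\<gamma> s)) \<in> polynomial_functions {\<lambda>s. s}"
  by (rule polynomial_functions_det[of _ k]) (simp_all add: polynomial_path_def)

section \<open>Class functions\<close>

text \<open>Conjugation by the diagonal matrix with entries \<open>s\<^sup>i\<close> multiplies the entry \<open>(i, j)\<close> of \<open>B\<close> by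
\<open>s\<^sup>j\<^sup>-\<^sup>i\<close>. As \<open>B\<close> is upper triangular, only nonnegative powers occur, and the conjugates form a polynomial
path along which \<open>q\<close> is constant for \<open>s \<noteq> 0\<close>. At \<open>s = 0\<close> it reaches the diagonal part of \<open>B\<close>.\<close>

lemma class_function_upper_triangular:
  fixes q :: "complex mat \<Rightarrow> complex"
  assumes q: "\<And>x y. x \<in> carrier_mat t t \<Longrightarrow> y \<in> carrier_mat t t \<Longrightarrow> q (x * y) = q (y * x)"
    and poly: "polynomial_along_paths t t (carrier_mat t t) q"
    and B: "B \<in> carrier_mat t t" "upper_triangular B"
  shows "q B = q (mat_diag t (\<lambda>i. B $$ (i, i)))"
proof -
  define T where "T s = mat t t (\<lambda>(i, j). if i \<le> j then B $$ (i, j) * s ^ (j - i) else 0)" for s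
  have T: "T s \<in> carrier_mat t t" for s by (simp add: T_def)
  have pow: "(\<lambda>s. s ^ k) \<in> polynomial_functions {\<lambda>s. s}" for k
    by (induction k) (auto intro: polynomial_functions.intros)
  have "(\<lambda>s. T s $$ (i, j)) \<in> polynomial_functions {\<lambda>s. s}" if "i < t" "j < t" for i j
    using that by (cases "i \<le> j") (auto simp: T_def intro!: polynomial_functions.mult polynomial_functions.const pow)
  then have "polynomial_path t t T" by (simp add: polynomial_path_def T)
  then have p: "(\<lambda>s. q (T s)) \<in> polynomial_functions {\<lambda>s. s}"
    by (rule polynomial_along_pathsD[OF poly _ T])
  have conj: "q (T s) = q B" if "s \<noteq> 0" for s
  proof -
    define D D' where "D = mat_diag t (\<lambda>i. s ^ i)" and "D' = mat_diag t (\<lambda>i. inverse s ^ i)"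
    have D: "D \<in> carrier_mat t t" "D' \<in> carrier_mat t t" by (simp_all add: D_def D'_def)
    have DD: "D * D' = 1\<^sub>m t"
      unfolding D_def D'_def mat_diag_diag using that by (intro eq_matI) (auto simp: mat_diag_def power_mult_distrib[symmetric])
    have "T s = D' * (B * D)"
    proof (rule eq_matI)
      fix i j assume "i < dim_row (D' * (B * D))" "j < dim_col (D' * (B * D))"
      then have ij: "i < t" "j < t" using D B by auto
      have "(D' * (B * D)) $$ (i, j) = inverse s ^ i * (B $$ (i, j) * s ^ j)"
        unfolding D_def D'_def using ij B(1)
        by (simp add: mat_diag_mult_left[of _ t t] mat_diag_mult_right[of _ t t])
      also have "\<dots> = T s $$ (i, j)"
      proof (cases "i \<le> j")
        case True
        then have "s ^ j = s ^ i * s ^ (j - i)" by (simp add: power_add[symmetric])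
        then show ?thesis using ij True that by (simp add: T_def power_inverse)
      next
        case False
        then show ?thesis using ij B by (simp add: T_def upper_triangular_def)
      qed
      finally show "T s $$ (i, j) = (D' * (B * D)) $$ (i, j)" ..
    qed (use D B in \<open>auto simp: T_def\<close>)
    also have "q \<dots> = q ((B * D) * D')" using D B by (intro q) auto
    also have "(B * D) * D' = B" using D B DD by (simp add: assoc_mult_mat[of _ t t _ t _ t])
    finally show ?thesis .
  qed
  have "q (T s) - q B = 0" for s
    by (rule polynomial_functions_line_eq_zero[where \<delta> = "\<lambda>s. s" and s\<^sub>0 = 1])
      (auto intro: polynomial_functions_diff p polynomial_functions.intros conj)
  from this[of 0] have "q B = q (T 0)" by simp
  also have "T 0 = mat_diag t (\<lambda>i. B $$ (i, i))"
    by (intro eq_matI) (auto simp: T_def mat_diag_def)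
  finally show ?thesis .
qed

text \<open>A Schur triangularization shows that a class function sees only a diagonal matrix of eigenvalues of
\<open>x\<close>. The function \<open>y \<mapsto> q (y\<^sup>T)\<close> is a class function as well, and it agrees with \<open>q\<close> on diagonal
matrices.\<close>

theorem class_function_transpose:
  fixes q :: "complex mat \<Rightarrow> complex"
  assumes q: "\<And>x y. x \<in> carrier_mat t t \<Longrightarrow> y \<in> carrier_mat t t \<Longrightarrow> q (x * y) = q (y * x)"
    and poly: "polynomial_along_paths t t (carrier_mat t t) q"
    and x: "x \<in> carrier_mat t t"
  shows "q (transpose_mat x) = q x"
proof -
  obtain es where "char_poly x = (\<Prod>a\<leftarrow>es. [:- a, 1:])" using char_poly_factorized[OF x] by blast
  from schur_decomposition_exists[OF x this]
  obtain B where B: "B \<in> carrier_mat t t" "upper_triangular B" "similar_mat x B" by blast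
  then obtain P R where PR: "similar_mat_wit x B P R" unfolding similar_mat_def by blast
  note w = similar_mat_witD2[OF x PR]
  define q' where "q' y = q (transpose_mat y)" for y
  have q': "q' (x * y) = q' (y * x)" if "x \<in> carrier_mat t t" "y \<in> carrier_mat t t" for x y
    using that q[of "transpose_mat x" "transpose_mat y"] by (simp add: q'_def transpose_mult)
  have tri: "p x = p (mat_diag t (\<lambda>i. B $$ (i, i)))"
    if p: "\<And>x y. x \<in> carrier_mat t t \<Longrightarrow> y \<in> carrier_mat t t \<Longrightarrow> p (x * y) = p (y * x)"
      and pp: "polynomial_along_paths t t (carrier_mat t t) p" for p :: "complex mat \<Rightarrow> complex"
  proof -
    have "p x = p ((P * B) * R)" unfolding w(3)[symmetric] by (rule refl)
    also have "\<dots> = p (R * (P * B))" by (rule p[OF mult_carrier_mat[OF w(6,5)] w(7)])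
    also have "R * (P * B) = B"
      unfolding assoc_mult_mat[OF w(7,6,5), symmetric] w(2) using w(5) by (rule left_mult_one_mat)
    also have "p B = p (mat_diag t (\<lambda>i. B $$ (i, i)))"
      by (rule class_function_upper_triangular[OF p pp B(1,2)])
    finally show ?thesis .
  qed
  have "q (transpose_mat x) = q' x" by (simp add: q'_def)
  also have "\<dots> = q' (mat_diag t (\<lambda>i. B $$ (i, i)))"
  proof (intro tri q')
    show "polynomial_along_paths t t (carrier_mat t t) q'"
      unfolding polynomial_along_paths_def q'_def
      by (auto intro!: polynomial_along_pathsD[OF poly polynomial_path_transpose])
  qed
  also have "\<dots> = q (mat_diag t (\<lambda>i. B $$ (i, i)))"
    unfolding q'_def by (intro arg_cong[of _ _ q] eq_matI) (auto simp: mat_diag_def)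
  also have "\<dots> = q x" by (rule tri[OF q poly, symmetric])
  finally show ?thesis .
qed

section \<open>Symmetry of invariant kernels\<close>

lemma mult_mat_regroup4:
  assumes "A \<in> carrier_mat p q" "B \<in> carrier_mat q r" "C \<in> carrier_mat r s" "D \<in> carrier_mat s u"
  shows "(A * B) * (C * D) = A * (B * C) * (D :: 'a :: semiring_1 mat)"
proof -
  have "(A * B) * (C * D) = A * (B * (C * D))" using assms by (intro assoc_mult_mat) auto
  also have "B * (C * D) = (B * C) * D" using assms by (intro assoc_mult_mat[symmetric]) auto
  also have "A * \<dots> = A * (B * C) * D" using assms by (intro assoc_mult_mat[symmetric]) auto
  finally show ?thesis .
qed

lemma mult_mat_regroup5:
  assumes "A \<in> carrier_mat p q" "B \<in> carrier_mat q r" "C \<in> carrier_mat r s" "D \<in> carrier_mat s u"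
    "E \<in> carrier_mat u v"
  shows "(A * B) * C * (D * E) = A * (B * C * D) * (E :: 'a :: semiring_1 mat)"
proof -
  have "(A * B) * C * (D * E) = A * (B * C) * (D * E)"
    using assms by (simp add: assoc_mult_mat[of A p q B r C s])
  also have "\<dots> = A * ((B * C) * D) * E" using assms by (intro mult_mat_regroup4) auto
  finally show ?thesis .
qed

text \<open>Let \<open>a\<close> and \<open>b\<close> be the \<open>m \<times> t\<close> and \<open>t \<times> n\<close> matrices with ones on the diagonal. Every point of the
variety is \<open>X * Y = E * (a * b) * F\<close> with \<open>E = X * a\<^sup>T\<close> and \<open>F = b\<^sup>T * Y\<close>, so one of the two arguments of \<open>Q\<close>
can be moved to \<open>a * b\<close>. This is where invariance under singular \<open>E\<close> and \<open>F\<close> is needed. The other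
argument then becomes \<open>\<iota> x\<close> for the \<open>t \<times> t\<close> matrix \<open>x = X\<^sup>T * w * Y\<^sup>T\<close>.\<close>

theorem invariant_kernel_symmetric:
  fixes Q :: "complex mat \<Rightarrow> complex mat \<Rightarrow> complex"
  assumes t: "t \<le> m" "t \<le> n"
    and inv: "\<And>E F z w. E \<in> carrier_mat m m \<Longrightarrow> F \<in> carrier_mat n n \<Longrightarrow> z \<in> rank_variety m n t \<Longrightarrow>
      w \<in> rank_variety m n t \<Longrightarrow> Q (E * z * F) w = Q z (transpose_mat E * w * transpose_mat F)"
    and poly: "\<And>w. w \<in> rank_variety m n t \<Longrightarrow>
      polynomial_along_paths m n (rank_variety m n t) (\<lambda>z. Q z w)"
    and z: "z \<in> rank_variety m n t" and w: "w \<in> rank_variety m n t"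
  shows "Q z w = Q w z"
proof -
  define a where "a = mat m t (\<lambda>(i, j). if i = j then 1 else 0 :: complex)"
  define b where "b = mat t n (\<lambda>(i, j). if i = j then 1 else 0 :: complex)"
  have ab: "a \<in> carrier_mat m t" "b \<in> carrier_mat t n" by (simp_all add: a_def b_def)
  then have abT: "transpose_mat a \<in> carrier_mat t m" "transpose_mat b \<in> carrier_mat n t" by simp_all
  have aa: "transpose_mat a * a = 1\<^sub>m t"
  proof (rule eq_matI)
    fix i j assume "i < dim_row (1\<^sub>m t :: complex mat)" "j < dim_col (1\<^sub>m t :: complex mat)"
    then have ij: "i < t" "j < t" by auto
    then have "(transpose_mat a * a) $$ (i, j) = (\<Sum>h\<in>{0..<m}. a $$ (h, i) * a $$ (h, j))"
      using ab by (simp add: scalar_prod_def)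
    also have "\<dots> = (\<Sum>h\<in>{0..<m}. if h = i then if i = j then 1 else 0 else 0)"
      using ij by (intro sum.cong) (auto simp: a_def)
    also have "\<dots> = 1\<^sub>m t $$ (i, j)" using ij t by simp
    finally show "(transpose_mat a * a) $$ (i, j) = 1\<^sub>m t $$ (i, j)" .
  qed (use ab in auto)
  have bb: "b * transpose_mat b = 1\<^sub>m t"
  proof (rule eq_matI)
    fix i j assume "i < dim_row (1\<^sub>m t :: complex mat)" "j < dim_col (1\<^sub>m t :: complex mat)"
    then have ij: "i < t" "j < t" by auto
    then have "(b * transpose_mat b) $$ (i, j) = (\<Sum>h\<in>{0..<n}. b $$ (i, h) * b $$ (j, h))"
      using ab by (simp add: scalar_prod_def)
    also have "\<dots> = (\<Sum>h\<in>{0..<n}. if h = i then if i = j then 1 else 0 else 0)"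
      using ij by (intro sum.cong) (auto simp: b_def)
    also have "\<dots> = 1\<^sub>m t $$ (i, j)" using ij t by simp
    finally show "(b * transpose_mat b) $$ (i, j) = 1\<^sub>m t $$ (i, j)" .
  qed (use ab in auto)
  have J: "a * b \<in> rank_variety m n t" using ab by (auto simp: rank_variety_iff_factor)
  define \<iota> where "\<iota> x = a * x * b" for x
  have \<iota>: "\<iota> x \<in> rank_variety m n t" if "x \<in> carrier_mat t t" for x
    using ab that unfolding \<iota>_def rank_variety_iff_factor
    by (intro bexI[of _ "a * x"] bexI[of _ b]) auto
  have dec: "(X * transpose_mat a) * (a * b) * (transpose_mat b * Y) = X * Y"
    if X: "X \<in> carrier_mat m t" and Y: "Y \<in> carrier_mat t n" for X Y
  proof -
    have "(X * transpose_mat a) * (a * b) = X * b"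
      using mult_mat_regroup4[OF X abT(1) ab] aa X by simp
    then show ?thesis using mult_mat_regroup4[OF X ab(2) abT(2) Y] bb X by simp
  qed
  have red: "transpose_mat (X * transpose_mat a) * w * transpose_mat (transpose_mat b * Y)
      = \<iota> (transpose_mat X * w * transpose_mat Y)"
    if X: "X \<in> carrier_mat m t" and Y: "Y \<in> carrier_mat t n" and w: "w \<in> carrier_mat m n" for X Y w
    using mult_mat_regroup5[of a m t "transpose_mat X" m w n "transpose_mat Y" t b n] X Y w ab
    by (simp add: \<iota>_def transpose_mult[OF X abT(1)] transpose_mult[OF abT(2) Y])
  have left: "Q (X * Y) w = Q (a * b) (\<iota> (transpose_mat X * w * transpose_mat Y))"
    if X: "X \<in> carrier_mat m t" and Y: "Y \<in> carrier_mat t n" and w: "w \<in> rank_variety m n t" for X Y w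
    using inv[of "X * transpose_mat a" "transpose_mat b * Y" "a * b" w] J w X Y ab
    by (simp add: dec red rank_variety_carrier)
  have right: "Q w (X * Y) = Q (\<iota> (transpose_mat X * w * transpose_mat Y)) (a * b)"
    if X: "X \<in> carrier_mat m t" and Y: "Y \<in> carrier_mat t n" and w: "w \<in> rank_variety m n t" for X Y w
    using inv[of "transpose_mat (X * transpose_mat a)" "transpose_mat (transpose_mat b * Y)" w "a * b"] J w X Y ab
    by (simp add: dec red rank_variety_carrier)
  define q where "q x = Q (\<iota> x) (a * b)" for x
  have swap: "Q (a * b) (\<iota> x) = q (transpose_mat x)" if x: "x \<in> carrier_mat t t" for x
  proof -
    have xT: "transpose_mat x \<in> carrier_mat t t" using x by simp
    have "transpose_mat (a * x) * (a * b) = transpose_mat x * b"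
      unfolding transpose_mult[OF ab(1) x] using mult_mat_regroup4[OF xT abT(1) ab] aa xT by simp
    then have "transpose_mat (a * x) * (a * b) * transpose_mat b = transpose_mat x"
      using assoc_mult_mat[OF xT ab(2) abT(2)] bb xT by simp
    then show ?thesis using right[OF mult_carrier_mat[OF ab(1) x] ab(2) J] by (simp add: \<iota>_def q_def)
  qed
  have "q (x * y) = q (y * x)" if x: "x \<in> carrier_mat t t" and y: "y \<in> carrier_mat t t" for x y
  proof -
    have xT: "transpose_mat x \<in> carrier_mat t t" "transpose_mat y \<in> carrier_mat t t" using x y by simp_all
    have "transpose_mat (a * x) * (a * b) = transpose_mat x * b"
      unfolding transpose_mult[OF ab(1) x] using mult_mat_regroup4[OF xT(1) abT(1) ab] aa xT by simp
    then have e: "transpose_mat (a * x) * (a * b) * transpose_mat (y * b) = transpose_mat (y * x)"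
      unfolding transpose_mult[OF y ab(2)] transpose_mult[OF y x]
      using mult_mat_regroup4[OF xT(1) ab(2) abT(2) xT(2)] bb xT by simp
    have "\<iota> (x * y) = (a * x) * (y * b)"
      using mult_mat_regroup4[OF ab(1) x y ab(2)] by (simp add: \<iota>_def)
    then have "q (x * y) = Q (a * b) (\<iota> (transpose_mat (y * x)))"
      using left[of "a * x" "y * b" "a * b"] x y ab J e by (simp add: q_def)
    then show ?thesis using swap[of "transpose_mat (y * x)"] x y by simp
  qed
  moreover have "polynomial_along_paths t t (carrier_mat t t) q"
    unfolding polynomial_along_paths_def
  proof (intro allI impI)
    fix \<gamma> :: "complex \<Rightarrow> complex mat" assume \<gamma>: "polynomial_path t t \<gamma>" "\<forall>s. \<gamma> s \<in> carrier_mat t t"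
    have "polynomial_path m n (\<lambda>s. \<iota> (\<gamma> s))"
      unfolding \<iota>_def by (rule polynomial_path_mult[OF polynomial_path_mult[OF polynomial_path_const[OF ab(1)] \<gamma>(1)]
          polynomial_path_const[OF ab(2)]])
    then show "(\<lambda>s. q (\<gamma> s)) \<in> polynomial_functions {\<lambda>s. s}"
      unfolding q_def by (rule polynomial_along_pathsD[OF poly[OF J]]) (use \<iota> \<gamma>(2) in simp)
  qed
  ultimately have qT: "q (transpose_mat x) = q x" if "x \<in> carrier_mat t t" for x
    using that by (rule class_function_transpose)
  obtain X Y where XY: "X \<in> carrier_mat m t" "Y \<in> carrier_mat t n" "z = X * Y"
    using z by (auto simp: rank_variety_iff_factor)
  have c: "transpose_mat X * w * transpose_mat Y \<in> carrier_mat t t"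
    using XY rank_variety_carrier[OF w] by auto
  show ?thesis
    using left[OF XY(1,2) w] right[OF XY(1,2) w] swap[OF c] qT[OF c] XY(3) by (simp add: q_def)
qed

section \<open>Forms on a rank variety\<close>

definition two_sided :: "complex mat set \<Rightarrow> complex mat \<Rightarrow> complex mat \<Rightarrow> (complex mat \<Rightarrow> complex) \<Rightarrow> complex mat \<Rightarrow> complex" where
  "two_sided D E F f = (\<lambda>A. if A \<in> D then f (E * A * F) else 0)"

definition positions :: "nat \<Rightarrow> nat \<Rightarrow> (nat \<times> nat) set" where
  "positions m n = {..<m} \<times> {..<n}"

text \<open>Monomials of degree \<open>k\<close> are indexed by the words of length \<open>k\<close> in the positions of the matrix, so a
monomial has several indices. In exchange the substitution \<open>A \<mapsto> E * A * F\<close> acts on coefficient vectors as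
a tensor power, whose adjoint is the tensor power of the adjoint.\<close>

definition words :: "nat \<Rightarrow> nat \<Rightarrow> nat \<Rightarrow> (nat \<times> nat) list set" where
  "words m n k = {I. set I \<subseteq> positions m n \<and> length I = k}"

definition monomial :: "(nat \<times> nat) list \<Rightarrow> complex mat \<Rightarrow> complex" where
  "monomial I A = prod_list (map (\<lambda>p. A $$ p) I)"

lemma finite_positions: "finite (positions m n)" by (simp add: positions_def)

lemma finite_words: "finite (words m n k)"
  unfolding words_def by (rule finite_lists_length_eq) (rule finite_positions)

lemma words_0: "words m n 0 = {[]}" by (auto simp: words_def)

lemma sum_words_Suc:
  "(\<Sum>J\<in>words m n (Suc k). f J) = (\<Sum>p\<in>positions m n. \<Sum>J\<in>words m n k. f (p # J))"
proof -
  have "words m n (Suc k) = (\<lambda>(p, J). p # J) ` (positions m n \<times> words m n k)"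
    by (auto simp: words_def length_Suc_conv image_iff)
  moreover have "inj_on (\<lambda>(p, J). p # J) (positions m n \<times> words m n k)" by (auto simp: inj_on_def)
  ultimately have "(\<Sum>J\<in>words m n (Suc k). f J) = (\<Sum>(p, J)\<in>positions m n \<times> words m n k. f (p # J))"
    by (simp add: sum.reindex case_prod_beta')
  then show ?thesis by (simp add: sum.cartesian_product)
qed

lemma prod_list_sum_distrib:
  fixes h :: "nat \<times> nat \<Rightarrow> nat \<times> nat \<Rightarrow> complex"
  shows "prod_list (map (\<lambda>p. \<Sum>q\<in>positions m n. h p q) I)
    = (\<Sum>J\<in>words m n (length I). prod_list (map2 h I J))"
proof (induction I)
  case Nil
  then show ?case by (simp add: words_0)
next
  case (Cons p I)
  then show ?case by (simp add: sum_words_Suc sum_product)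
qed

text \<open>The matrix coefficients of that tensor power.\<close>

definition subst_coeff :: "complex mat \<Rightarrow> complex mat \<Rightarrow> (nat \<times> nat) list \<Rightarrow> (nat \<times> nat) list \<Rightarrow> complex" where
  "subst_coeff E F I J = prod_list (map2 (\<lambda>p q. E $$ (fst p, fst q) * F $$ (snd q, snd p)) I J)"

lemma mult_mult_entry:
  fixes E :: "complex mat"
  assumes "E \<in> carrier_mat m m" "A \<in> carrier_mat m n" "F \<in> carrier_mat n n" "p \<in> positions m n"
  shows "(E * A * F) $$ p = (\<Sum>q\<in>positions m n. E $$ (fst p, fst q) * F $$ (snd q, snd p) * A $$ q)"
proof -
  obtain i j where p: "p = (i, j)" "i < m" "j < n" using assms(4) by (auto simp: positions_def)
  have "(E * A * F) $$ (i, j) = (\<Sum>a\<in>{0..<m}. E $$ (i, a) * (\<Sum>b\<in>{0..<n}. A $$ (a, b) * F $$ (b, j)))"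
    using assms p by (simp add: scalar_prod_def)
  also have "\<dots> = (\<Sum>a\<in>{..<m}. \<Sum>b\<in>{..<n}. E $$ (i, a) * F $$ (b, j) * A $$ (a, b))"
    by (simp add: sum_distrib_left atLeast0LessThan mult_ac)
  finally show ?thesis by (simp add: p(1) positions_def sum.cartesian_product case_prod_beta')
qed

lemma monomial_subst:
  assumes "E \<in> carrier_mat m m" "A \<in> carrier_mat m n" "F \<in> carrier_mat n n" "I \<in> words m n k"
  shows "monomial I (E * A * F) = (\<Sum>J\<in>words m n k. subst_coeff E F I J * monomial J A)"
proof -
  let ?h = "\<lambda>p q. E $$ (fst p, fst q) * F $$ (snd q, snd p) * A $$ q"
  have "monomial I (E * A * F) = prod_list (map (\<lambda>p. \<Sum>q\<in>positions m n. ?h p q) I)"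
    unfolding monomial_def
    by (intro arg_cong[of _ _ prod_list] map_cong) (use assms mult_mult_entry[OF assms(1-3)] in \<open>auto simp: words_def\<close>)
  also have "\<dots> = (\<Sum>J\<in>words m n k. prod_list (map2 ?h I J))"
    using assms(4) prod_list_sum_distrib by (simp add: words_def)
  also have "\<dots> = (\<Sum>J\<in>words m n k. subst_coeff E F I J * monomial J A)"
  proof (rule sum.cong[OF refl])
    fix J assume "J \<in> words m n k"
    then have "length I = length J" using assms(4) by (simp add: words_def)
    then show "prod_list (map2 ?h I J) = subst_coeff E F I J * monomial J A"
      unfolding subst_coeff_def monomial_def by (induction I J rule: list_induct2) simp_all
  qed
  finally show ?thesis .
qed

lemma subst_coeff_transpose:
  assumes "E \<in> carrier_mat m m" "F \<in> carrier_mat n n" "I \<in> words m n k" "J \<in> words m n k"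
  shows "subst_coeff (transpose_mat E) (transpose_mat F) J I = subst_coeff E F I J"
proof -
  have "length I = length J" "set I \<subseteq> positions m n" "set J \<subseteq> positions m n"
    using assms by (auto simp: words_def)
  then show ?thesis
    unfolding subst_coeff_def using assms(1,2)
    by (induction I J rule: list_induct2) (auto simp: positions_def)
qed

lemma subst_coeff_cnj:
  assumes "E \<in> carrier_mat m m" "F \<in> carrier_mat n n" "I \<in> words m n k" "J \<in> words m n k"
  shows "subst_coeff (map_mat cnj E) (map_mat cnj F) I J = cnj (subst_coeff E F I J)"
proof -
  have "length I = length J" "set I \<subseteq> positions m n" "set J \<subseteq> positions m n"
    using assms by (auto simp: words_def)
  then show ?thesis
    unfolding subst_coeff_def using assms(1,2)
    by (induction I J rule: list_induct2) (auto simp: positions_def)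
qed

lemma monomial_cnj:
  assumes "A \<in> carrier_mat m n" "I \<in> words m n k"
  shows "monomial I (map_mat cnj A) = cnj (monomial I A)"
proof -
  have "set I \<subseteq> positions m n" using assms(2) by (simp add: words_def)
  then show ?thesis unfolding monomial_def using assms(1) by (induction I) (auto simp: positions_def)
qed

locale rank_ring =
  fixes m n t :: nat
begin

abbreviation (input) "D \<equiv> rank_variety m n t"

definition form :: "nat \<Rightarrow> ((nat \<times> nat) list \<Rightarrow> complex) \<Rightarrow> complex mat \<Rightarrow> complex" where
  "form k c = (\<lambda>A. if A \<in> D then \<Sum>I\<in>words m n k. c I * monomial I A else 0)"

definition forms :: "nat \<Rightarrow> (complex mat \<Rightarrow> complex) set" where
  "forms k = range (form k)"

definition basic_form :: "nat \<Rightarrow> (nat \<times> nat) list \<Rightarrow> complex mat \<Rightarrow> complex" where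
  "basic_form k I = form k (\<lambda>J. if J = I then 1 else 0)"

definition form_ring :: "(complex mat \<Rightarrow> complex) set" where
  "form_ring = fun_space.span (\<Union>k. forms k)"

lemma form_add: "form k c + form k c' = form k (\<lambda>I. c I + c' I)"
  by (rule ext) (simp add: form_def sum.distrib algebra_simps)

lemma form_scale: "(\<lambda>A. a * form k c A) = form k (\<lambda>I. a * c I)"
  by (rule ext) (simp add: form_def sum_distrib_left algebra_simps)

lemma form_zero: "form k (\<lambda>_. 0) = 0"
  by (rule ext) (simp add: form_def)

lemma form_cong: "(\<And>I. I \<in> words m n k \<Longrightarrow> c I = c' I) \<Longrightarrow> form k c = form k c'"
  by (rule ext) (simp add: form_def)

lemma form_mem: "form k c \<in> forms k" by (simp add: forms_def)

lemma subspace_forms: "fun_space.subspace (forms k)"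
  unfolding fun_space.subspace_def forms_def
proof (intro conjI ballI allI)
  show "0 \<in> range (form k)" using form_zero[of k] by (metis rangeI)
  show "x + y \<in> range (form k)" if "x \<in> range (form k)" "y \<in> range (form k)" for x y
    using that form_add by auto
  show "(\<lambda>A. a * x A) \<in> range (form k)" if "x \<in> range (form k)" for a x
    using that form_scale by auto
qed

lemma forms_subset_form_ring: "forms k \<subseteq> form_ring"
  unfolding form_ring_def using fun_space.span_superset by blast

lemma subspace_form_ring: "fun_space.subspace form_ring"
  by (simp add: form_ring_def)

lemma basic_form_apply:
  assumes "I \<in> words m n k" "A \<in> D"
  shows "basic_form k I A = monomial I A"
proof -
  have "basic_form k I A = (\<Sum>J\<in>words m n k. (if J = I then 1 else 0) * monomial J A)"
    using assms by (simp only: basic_form_def form_def if_True)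
  also have "\<dots> = (\<Sum>J\<in>words m n k. if J = I then monomial J A else 0)"
    by (intro sum.cong) auto
  also have "\<dots> = monomial I A" using assms finite_words[of m n k] by simp
  finally show ?thesis .
qed

lemma functional_form:
  fixes L :: "(complex mat \<Rightarrow> complex) \<Rightarrow> complex"
  assumes add: "\<And>f g. f \<in> forms k \<Longrightarrow> g \<in> forms k \<Longrightarrow> L (f + g) = L f + L g"
    and scale: "\<And>a f. f \<in> forms k \<Longrightarrow> L (\<lambda>A. a * f A) = a * L f"
  shows "L (form k c) = (\<Sum>I\<in>words m n k. c I * L (basic_form k I))"
proof -
  have "L (form k (\<lambda>I. if I \<in> T then c I else 0)) = (\<Sum>I\<in>T. c I * L (basic_form k I))"
    if "finite T" "T \<subseteq> words m n k" for T
    using that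
  proof (induction T)
    case empty
    have L0: "L 0 = 0" using add[of 0 0] form_zero form_mem[of k "\<lambda>_. 0"] by simp
    have e: "form k (\<lambda>I. if I \<in> {} then c I else 0) = 0" by (rule ext) (simp add: form_def)
    show ?case unfolding e sum.empty by (rule L0)
  next
    case (insert I T)
    have "form k (\<lambda>J. if J \<in> insert I T then c J else 0)
        = form k (\<lambda>J. c I * (if J = I then 1 else 0)) + form k (\<lambda>J. if J \<in> T then c J else 0)"
      unfolding form_add using insert by (intro form_cong) auto
    then have "L (form k (\<lambda>J. if J \<in> insert I T then c J else 0))
        = L (form k (\<lambda>J. c I * (if J = I then 1 else 0))) + (\<Sum>I\<in>T. c I * L (basic_form k I))"
      using insert by (simp add: add form_mem)
    then show ?case
      using insert scale[OF form_mem, of "c I" "\<lambda>J. if J = I then 1 else 0"]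
      by (simp add: form_scale basic_form_def)
  qed
  from this[OF finite_words order_refl] have "L (form k (\<lambda>I. if I \<in> words m n k then c I else 0))
      = (\<Sum>I\<in>words m n k. c I * L (basic_form k I))" .
  moreover have "form k (\<lambda>I. if I \<in> words m n k then c I else 0) = form k c" by (rule form_cong) simp
  ultimately show ?thesis by simp
qed

lemma two_sided_form:
  assumes "E \<in> carrier_mat m m" "F \<in> carrier_mat n n"
  shows "two_sided D E F (form k c) = form k (\<lambda>J. \<Sum>I\<in>words m n k. c I * subst_coeff E F I J)"
proof (rule ext)
  fix A
  show "two_sided D E F (form k c) A = form k (\<lambda>J. \<Sum>I\<in>words m n k. c I * subst_coeff E F I J) A"
  proof (cases "A \<in> D")
    case True
    then have "two_sided D E F (form k c) A = (\<Sum>I\<in>words m n k. c I * monomial I (E * A * F))"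
      using rank_variety_mult[OF True assms] by (simp add: two_sided_def form_def)
    also have "\<dots> = (\<Sum>I\<in>words m n k. \<Sum>J\<in>words m n k. c I * subst_coeff E F I J * monomial J A)"
      using monomial_subst[OF assms(1) rank_variety_carrier[OF True] assms(2)]
      by (simp add: sum_distrib_left mult.assoc)
    also have "\<dots> = (\<Sum>J\<in>words m n k. \<Sum>I\<in>words m n k. c I * subst_coeff E F I J * monomial J A)"
      by (rule sum.swap)
    finally show ?thesis using True by (simp add: form_def sum_distrib_right)
  qed (simp add: two_sided_def form_def)
qed

section \<open>Complete reducibility\<close>

text \<open>The image in the space of forms of the orthogonal complement of the preimage of \<open>S\<close> under \<open>form k\<close>. The
vectors \<open>\<Lambda>\<close> annihilate the preimage, so their complex conjugates are orthogonal to it.\<close>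

definition perp :: "nat \<Rightarrow> (complex mat \<Rightarrow> complex) set \<Rightarrow> (complex mat \<Rightarrow> complex) set" where
  "perp k S = {form k (\<lambda>I. cnj (\<Lambda> I)) |\<Lambda>. \<forall>c. form k c \<in> S \<longrightarrow> (\<Sum>I\<in>words m n k. c I * \<Lambda> I) = 0}"

lemma sum_cnj_mult_eq_0:
  assumes "finite T" "(\<Sum>I\<in>T. cnj (\<Lambda> I) * \<Lambda> I) = 0" "I \<in> T"
  shows "\<Lambda> I = 0"
proof -
  have "cnj (\<Lambda> I) * \<Lambda> I = of_real ((cmod (\<Lambda> I))\<^sup>2)" for I
    by (subst complex_norm_square) (rule mult.commute)
  then have "of_real (\<Sum>I\<in>T. (cmod (\<Lambda> I))\<^sup>2) = (0 :: complex)"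
    using assms(2) by (simp only: of_real_sum)
  then have "(\<Sum>I\<in>T. (cmod (\<Lambda> I))\<^sup>2) = 0" by (simp only: of_real_eq_0_iff)
  then show ?thesis using assms(1,3) by (simp add: sum_nonneg_eq_0_iff)
qed

text \<open>A form in the intersection has a coefficient vector that is orthogonal to itself.\<close>

lemma perp_Int: "S \<inter> perp k S \<subseteq> {0}"
proof
  fix f assume "f \<in> S \<inter> perp k S"
  then obtain \<Lambda> where f: "f = form k (\<lambda>I. cnj (\<Lambda> I))" "f \<in> S"
    and \<Lambda>: "\<And>c. form k c \<in> S \<Longrightarrow> (\<Sum>I\<in>words m n k. c I * \<Lambda> I) = 0" by (auto simp: perp_def)
  have "(\<Sum>I\<in>words m n k. cnj (\<Lambda> I) * \<Lambda> I) = 0" using \<Lambda>[of "\<lambda>I. cnj (\<Lambda> I)"] f by simp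
  note sum_cnj_mult_eq_0[OF finite_words this]
  then have "form k (\<lambda>I. cnj (\<Lambda> I)) = form k (\<lambda>_. 0)"
    by (intro form_cong) simp
  then show "f \<in> {0}" using f form_zero by simp
qed

lemma perp_subset_forms: "perp k S \<subseteq> forms k"
  by (auto simp: perp_def forms_def)

lemma subspace_perp: "fun_space.subspace (perp k S)"
  unfolding fun_space.subspace_def
proof (intro conjI ballI allI)
  show "0 \<in> perp k S" unfolding perp_def using form_zero[of k] by (auto intro!: exI[of _ "\<lambda>_. 0"])
  show "f + g \<in> perp k S" if f: "f \<in> perp k S" and g: "g \<in> perp k S" for f g
  proof -
    obtain \<Lambda> where \<Lambda>: "f = form k (\<lambda>I. cnj (\<Lambda> I))" "\<forall>c. form k c \<in> S \<longrightarrow> (\<Sum>I\<in>words m n k. c I * \<Lambda> I) = 0"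
      using f by (auto simp: perp_def)
    obtain \<Lambda>' where \<Lambda>': "g = form k (\<lambda>I. cnj (\<Lambda>' I))" "\<forall>c. form k c \<in> S \<longrightarrow> (\<Sum>I\<in>words m n k. c I * \<Lambda>' I) = 0"
      using g by (auto simp: perp_def)
    show ?thesis unfolding perp_def
      by (rule CollectI, rule exI[of _ "\<lambda>I. \<Lambda> I + \<Lambda>' I"]) (use \<Lambda> \<Lambda>' in \<open>simp add: form_add ring_distribs sum.distrib\<close>)
  qed
  show "(\<lambda>A. a * f A) \<in> perp k S" if f: "f \<in> perp k S" for a f
  proof -
    obtain \<Lambda> where \<Lambda>: "f = form k (\<lambda>I. cnj (\<Lambda> I))" "\<forall>c. form k c \<in> S \<longrightarrow> (\<Sum>I\<in>words m n k. c I * \<Lambda> I) = 0"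
      using f by (auto simp: perp_def)
    show ?thesis unfolding perp_def
      by (rule CollectI, rule exI[of _ "\<lambda>I. cnj a * \<Lambda> I"])
        (use \<Lambda> in \<open>simp add: form_scale mult.left_commute[of _ "cnj a"] flip: sum_distrib_left\<close>)
  qed
qed

text \<open>Otherwise there is a functional \<open>L\<close> that vanishes on \<open>S\<close> and on its complement, but not on all forms.
Its values \<open>\<Lambda>\<close> on the monomials annihilate the preimage of \<open>S\<close>, so the form with coefficients \<open>cnj \<Lambda>\<close> lies
in the complement, and \<open>L\<close> maps it to the squared norm of \<open>\<Lambda>\<close>; hence \<open>\<Lambda> = 0\<close>.\<close>

lemma forms_subset_span_perp:
  assumes S: "S \<subseteq> forms k"
  shows "forms k \<subseteq> fun_space.span (S \<union> perp k S)"
proof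
  fix f assume f: "f \<in> forms k"
  show "f \<in> fun_space.span (S \<union> perp k S)"
  proof (rule ccontr)
    assume "f \<notin> fun_space.span (S \<union> perp k S)"
    from fun_space_functional[OF fun_space.subspace_span this]
    obtain L :: "(complex mat \<Rightarrow> complex) \<Rightarrow> complex" where
      L': "(\<forall>g h. L (g + h) = L g + L h) \<and> (\<forall>c g. L (\<lambda>x. c * g x) = c * L g) \<and>
        (\<forall>u\<in>fun_space.span (S \<union> perp k S). L u = 0) \<and> L f \<noteq> 0" by (rule exE)
    have L: "L (g + h) = L g + L h" "L (\<lambda>x. c * g x) = c * L g"
      "u \<in> fun_space.span (S \<union> perp k S) \<Longrightarrow> L u = 0" "L f \<noteq> 0" for g h c u
      using L' by simp_all
    have L0: "L u = 0" if "u \<in> S \<union> perp k S" for u using L(3)[OF fun_space.span_base[OF that]] .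
    define \<Lambda> where "\<Lambda> I = L (basic_form k I)" for I
    have Lf: "L (form k c) = (\<Sum>I\<in>words m n k. c I * \<Lambda> I)" for c
      unfolding \<Lambda>_def by (rule functional_form, rule L(1), rule L(2))
    have "form k (\<lambda>I. cnj (\<Lambda> I)) \<in> perp k S"
      unfolding perp_def
    proof (intro CollectI exI[of _ \<Lambda>] conjI refl allI impI)
      fix c assume "form k c \<in> S"
      then show "(\<Sum>I\<in>words m n k. c I * \<Lambda> I) = 0" unfolding Lf[symmetric] by (intro L0 UnI1)
    qed
    then have "L (form k (\<lambda>I. cnj (\<Lambda> I))) = 0" by (intro L0 UnI2)
    then have "(\<Sum>I\<in>words m n k. cnj (\<Lambda> I) * \<Lambda> I) = 0" by (simp only: Lf)
    note sum_cnj_mult_eq_0[OF finite_words this]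
    moreover obtain c where "f = form k c" using f by (auto simp: forms_def)
    ultimately show False using Lf[of c] L(4) by simp
  qed
qed

definition GL_pairs :: "(complex mat \<times> complex mat) set" where
  "GL_pairs = {(E, F). E \<in> carrier_mat m m \<and> F \<in> carrier_mat n n \<and> det E \<noteq> 0 \<and> det F \<noteq> 0}"

abbreviation pair_action :: "complex mat \<times> complex mat \<Rightarrow> (complex mat \<Rightarrow> complex) \<Rightarrow> complex mat \<Rightarrow> complex" where
  "pair_action \<equiv> \<lambda>(E, F). two_sided D E F"

lemma linear_pair_action: "linear_action GL_pairs pair_action"
  by (auto simp: linear_action_def two_sided_def fun_eq_iff)

text \<open>The adjoint of the substitution given by \<open>(E, F)\<close> is the one given by the conjugate transposes, which
maps the preimage of \<open>S\<close> into itself.\<close>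

lemma perp_invariant:
  assumes inv: "\<And>g f. g \<in> GL_pairs \<Longrightarrow> f \<in> S \<Longrightarrow> pair_action g f \<in> S"
    and g: "g \<in> GL_pairs" and f: "f \<in> perp k S"
  shows "pair_action g f \<in> perp k S"
proof -
  obtain E F where EF: "g = (E, F)" "E \<in> carrier_mat m m" "F \<in> carrier_mat n n" "det E \<noteq> 0" "det F \<noteq> 0"
    using g by (auto simp: GL_pairs_def)
  let ?E = "transpose_mat (map_mat cnj E)" and ?F = "transpose_mat (map_mat cnj F)"
  have detc: "det (map_mat cnj B) = cnj (det B)" if "B \<in> carrier_mat r r" for B r
  proof -
    interpret comm_ring_hom cnj by unfold_locales auto
    show ?thesis by (rule hom_det)
  qed
  have EF': "?E \<in> carrier_mat m m" "?F \<in> carrier_mat n n" using EF by auto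
  have star: "(?E, ?F) \<in> GL_pairs"
    using EF by (auto simp: GL_pairs_def det_transpose[of _ m] det_transpose[of _ n] detc)
  obtain \<Lambda> where \<Lambda>: "f = form k (\<lambda>I. cnj (\<Lambda> I))"
    "\<And>c. form k c \<in> S \<Longrightarrow> (\<Sum>I\<in>words m n k. c I * \<Lambda> I) = 0" using f by (auto simp: perp_def)
  define M where "M J = (\<Sum>I\<in>words m n k. cnj (subst_coeff E F I J) * \<Lambda> I)" for J
  have adj: "subst_coeff ?E ?F J I = cnj (subst_coeff E F I J)" if "I \<in> words m n k" "J \<in> words m n k" for I J
    using subst_coeff_transpose[of "map_mat cnj E" m "map_mat cnj F" n I k J] subst_coeff_cnj[OF EF(2,3) that] that EF
    by simp
  have "pair_action g f = form k (\<lambda>J. cnj (M J))"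
    unfolding EF(1) prod.case \<Lambda>(1) two_sided_form[OF EF(2,3)] M_def
    by (intro form_cong) (simp add: mult.commute)
  moreover have "(\<Sum>J\<in>words m n k. c J * M J) = 0" if c: "form k c \<in> S" for c
  proof -
    have "form k (\<lambda>I. \<Sum>J\<in>words m n k. c J * subst_coeff ?E ?F J I) \<in> S"
      using inv[OF star c] two_sided_form[OF EF', of k c] by simp
    then have "0 = (\<Sum>I\<in>words m n k. (\<Sum>J\<in>words m n k. c J * subst_coeff ?E ?F J I) * \<Lambda> I)"
      using \<Lambda>(2) by simp
    also have "\<dots> = (\<Sum>I\<in>words m n k. \<Sum>J\<in>words m n k. c J * (cnj (subst_coeff E F I J) * \<Lambda> I))"
      by (simp add: sum_distrib_right adj mult.assoc)
    also have "\<dots> = (\<Sum>J\<in>words m n k. \<Sum>I\<in>words m n k. c J * (cnj (subst_coeff E F I J) * \<Lambda> I))"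
      by (rule sum.swap)
    also have "\<dots> = (\<Sum>J\<in>words m n k. c J * M J)" by (simp add: M_def sum_distrib_left)
    finally show ?thesis by simp
  qed
  ultimately show ?thesis unfolding perp_def by blast
qed

text \<open>Take a nonzero submodule of least dimension; the forms of a fixed degree are a finite-dimensional
space.\<close>

lemma irreducible_submodule_exists:
  assumes S: "submodule_of GL_pairs pair_action S (forms k)" and "S \<noteq> {0}"
  shows "\<exists>V\<subseteq>S. irreducible_module GL_pairs pair_action V"
proof -
  define P where "P W \<longleftrightarrow> submodule_of GL_pairs pair_action W (forms k) \<and> W \<noteq> {0} \<and> W \<subseteq> S" for W
  have "P S" using assms by (simp add: P_def)
  then obtain V where V: "P V" and min: "\<And>W. P W \<Longrightarrow> fun_space.dim V \<le> fun_space.dim W"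
    using ex_has_least_nat[of P S fun_space.dim] by blast
  have span: "forms k \<subseteq> fun_space.span (basic_form k ` words m n k)"
  proof
    fix f assume "f \<in> forms k"
    then obtain c where c: "f = form k c" by (auto simp: forms_def)
    have "f = (\<Sum>I\<in>words m n k. (\<lambda>A. c I * basic_form k I A))"
    proof
      fix A
      show "f A = (\<Sum>I\<in>words m n k. (\<lambda>A. c I * basic_form k I A)) A"
      proof (cases "A \<in> D")
        case True
        then show ?thesis by (simp add: c form_def basic_form_apply sum_fun_apply)
      next
        case False
        then show ?thesis by (simp add: c form_def basic_form_def sum_fun_apply)
      qed
    qed
    then show "f \<in> fun_space.span (basic_form k ` words m n k)"
      by (auto intro!: fun_space.span_sum fun_space.span_scale intro: fun_space.span_base)
  qed
  have fin: "finite B \<and> card B \<le> fun_space.dim U"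
    if B: "B \<subseteq> U" "fun_space.independent B" and U: "U \<subseteq> forms k" for B U
  proof -
    obtain C where C: "C \<subseteq> U" "fun_space.independent C" "U \<subseteq> fun_space.span C" "card C = fun_space.dim U"
      by (rule fun_space.basis_exists[of U])
    have "finite C"
      using fun_space.independent_span_bound[OF finite_imageI[OF finite_words] C(2)] C(1) U span by blast
    from fun_space.independent_span_bound[OF this B(2) order_trans[OF B(1) C(3)]]
    show ?thesis unfolding C(4) .
  qed
  have "irreducible_module GL_pairs pair_action V"
    unfolding irreducible_module_def
  proof (intro conjI allI impI)
    show "submodule_of GL_pairs pair_action V V" "V \<noteq> {0}" using V by (auto simp: P_def submodule_of_def)
    fix W assume W: "submodule_of GL_pairs pair_action W V"
    show "W = {0} \<or> W = V"
    proof (rule ccontr)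
      assume n: "\<not> (W = {0} \<or> W = V)"
      have WV: "W \<subseteq> V" and subW: "fun_space.subspace W" using W by (auto simp: submodule_of_def)
      have Vk: "V \<subseteq> forms k" using V by (auto simp: P_def submodule_of_def)
      have "P W" using W V n by (auto simp: P_def submodule_of_def)
      then have le: "fun_space.dim V \<le> fun_space.dim W" by (rule min)
      obtain x where x: "x \<in> V" "x \<notin> W" using n WV by blast
      obtain B where B: "B \<subseteq> W" "fun_space.independent B" "W \<subseteq> fun_space.span B" "card B = fun_space.dim W"
        by (rule fun_space.basis_exists[of W])
      have "fun_space.span B = W" using B subW by (simp add: fun_space.span_subspace)
      then have ind: "fun_space.independent (insert x B)"
        using B x by (simp add: fun_space.independent_insertI)
      have "card (insert x B) \<le> fun_space.dim V" "finite B"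
        using fin[OF _ ind Vk] fin[OF _ B(2) Vk] B(1) WV x(1) by auto
      moreover have "x \<notin> B" using B(1) x by auto
      ultimately show False using le B(4) by simp
    qed
  qed
  then show ?thesis using V by (auto simp: P_def)
qed

lemma form_ring_decomposition_exists:
  "\<exists>\<V>. irreducible_decomposition GL_pairs pair_action form_ring \<V>"
proof (rule irreducible_decomposition_exists[OF linear_pair_action _ subspace_form_ring])
  let ?I = "{V. irreducible_module GL_pairs pair_action V \<and> V \<subseteq> form_ring}"
  have "forms k \<subseteq> fun_space.span (\<Union>?I)" for k
  proof -
    let ?I\<^sub>k = "{V. irreducible_module GL_pairs pair_action V \<and> V \<subseteq> forms k}"
    let ?R = "fun_space.span (\<Union>?I\<^sub>k)"
    have R: "?R \<subseteq> forms k" by (rule fun_space.span_minimal[OF _ subspace_forms]) auto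
    have "\<forall>V\<in>?I\<^sub>k. \<forall>g\<in>GL_pairs. \<forall>f\<in>V. pair_action g f \<in> V"
    proof (intro ballI)
      fix V g f assume "V \<in> ?I\<^sub>k" and gf: "g \<in> GL_pairs" "f \<in> V"
      then have "irreducible_module GL_pairs pair_action V" by (elim CollectE conjE)
      from irreducible_moduleD(3)[OF this gf] show "pair_action g f \<in> V" .
    qed
    note inv = span_Union_invariant[OF linear_pair_action this]
    have sub: "submodule_of GL_pairs pair_action (perp k ?R) (forms k)"
      unfolding submodule_of_def
      by (intro conjI perp_subset_forms subspace_perp ballI perp_invariant inv)
    have "perp k ?R = {0}"
    proof (rule ccontr)
      assume "perp k ?R \<noteq> {0}"
      from irreducible_submodule_exists[OF sub this]
      obtain V where V: "V \<subseteq> perp k ?R" "irreducible_module GL_pairs pair_action V" by (elim exE conjE)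
      have "V \<in> ?I\<^sub>k" by (intro CollectI conjI V(2) order_trans[OF V(1) perp_subset_forms])
      then have "V \<subseteq> ?R" by (rule order_trans[OF Union_upper fun_space.span_superset])
      from order_trans[OF Int_greatest[OF this V(1)] perp_Int] have "V \<subseteq> {0}" .
      moreover have V': "fun_space.subspace V" "V \<noteq> {0}"
        using irreducible_moduleD(1,2)[OF V(2)] .
      moreover have "0 \<in> V" by (rule fun_space.subspace_0[OF V'(1)])
      ultimately show False by blast
    qed
    then have "?R \<union> perp k ?R \<subseteq> ?R" using fun_space.span_zero by simp
    then have "forms k \<subseteq> ?R"
      by (rule order_trans[OF forms_subset_span_perp[OF R] fun_space.span_minimal[OF _ fun_space.subspace_span]])
    also have "\<dots> \<subseteq> fun_space.span (\<Union>?I)"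
      using forms_subset_form_ring by (intro fun_space.span_mono) blast
    finally show ?thesis .
  qed
  then show "form_ring \<subseteq> fun_space.span (\<Union>?I)"
    unfolding form_ring_def by (intro fun_space.span_minimal) auto
qed

end

section \<open>Commuting endomorphisms\<close>

context rank_ring
begin

text \<open>On the variety this is the form \<open>A \<mapsto> (\<Sum> A\<^sub>i\<^sub>j w\<^sub>i\<^sub>j)\<^sup>k\<close>, expanded into words.\<close>

definition kernel :: "nat \<Rightarrow> complex mat \<Rightarrow> complex mat \<Rightarrow> complex" where
  "kernel k w = form k (\<lambda>I. monomial I w)"

lemma kernel_mem_forms: "kernel k w \<in> forms k"
  by (simp add: kernel_def form_mem)

lemma two_sided_kernel:
  assumes "E \<in> carrier_mat m m" "F \<in> carrier_mat n n" "w \<in> carrier_mat m n"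
  shows "two_sided D E F (kernel k w) = kernel k (transpose_mat E * w * transpose_mat F)"
  unfolding kernel_def two_sided_form[OF assms(1,2)]
proof (rule form_cong)
  fix J assume J: "J \<in> words m n k"
  have "monomial J (transpose_mat E * w * transpose_mat F)
      = (\<Sum>I\<in>words m n k. subst_coeff (transpose_mat E) (transpose_mat F) J I * monomial I w)"
    using assms J by (intro monomial_subst) auto
  also have "\<dots> = (\<Sum>I\<in>words m n k. monomial I w * subst_coeff E F I J)"
    using subst_coeff_transpose[OF assms(1,2) _ J] by (intro sum.cong) simp_all
  finally show "(\<Sum>I\<in>words m n k. monomial I w * subst_coeff E F I J)
      = monomial J (transpose_mat E * w * transpose_mat F)" ..
qed

text \<open>The complement of the span is zero: a vector \<open>\<Lambda>\<close> that annihilates the coefficient vectors of all kernels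
is the coefficient vector of a polynomial that vanishes on the variety, and so is its complex conjugate, because the variety is
closed under complex conjugation.\<close>

lemma forms_subset_span_kernel: "forms k \<subseteq> fun_space.span (kernel k ` D)"
proof -
  let ?S = "fun_space.span (kernel k ` D)"
  have S: "?S \<subseteq> forms k"
    by (rule fun_space.span_minimal[OF _ subspace_forms]) (auto intro: kernel_mem_forms)
  have "f = 0" if f: "f \<in> perp k ?S" for f
  proof -
    obtain \<Lambda> where \<Lambda>: "f = form k (\<lambda>I. cnj (\<Lambda> I))"
      "\<And>c. form k c \<in> ?S \<Longrightarrow> (\<Sum>I\<in>words m n k. c I * \<Lambda> I) = 0" using f by (auto simp: perp_def)
    have z: "(\<Sum>I\<in>words m n k. monomial I w * \<Lambda> I) = 0" if "w \<in> D" for w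
      using that by (intro \<Lambda>(2)) (auto simp: kernel_def[symmetric] intro: fun_space.span_base)
    show "f = 0"
    proof
      fix A
      show "f A = 0 A"
      proof (cases "A \<in> D")
        case True
        have "f A = (\<Sum>I\<in>words m n k. cnj (\<Lambda> I) * monomial I A)" using True by (simp add: \<Lambda>(1) form_def)
        also have "\<dots> = cnj (\<Sum>I\<in>words m n k. monomial I (map_mat cnj A) * \<Lambda> I)"
          using monomial_cnj[OF rank_variety_carrier[OF True]] by (simp add: mult.commute)
        also have "\<dots> = 0" using z[OF rank_variety_cnj[OF True]] by simp
        finally show ?thesis by simp
      next
        case False
        then show ?thesis by (simp add: \<Lambda>(1) form_def)
      qed
    qed
  qed
  then have "?S \<union> perp k ?S \<subseteq> ?S" using fun_space.span_zero by blast
  then show ?thesis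
    by (rule order_trans[OF forms_subset_span_perp[OF S] fun_space.span_minimal[OF _ fun_space.subspace_span]])
qed

lemma polynomial_functions_monomial:
  assumes "polynomial_path m n \<gamma>" "set I \<subseteq> positions m n"
  shows "(\<lambda>s. monomial I (\<gamma> s)) \<in> polynomial_functions {\<lambda>s. s}"
  using assms(2)
proof (induction I)
  case Nil
  then show ?case by (simp add: monomial_def polynomial_functions.const)
next
  case (Cons p I)
  have "(\<lambda>s. \<gamma> s $$ p * monomial I (\<gamma> s)) \<in> polynomial_functions {\<lambda>s. s}"
    using Cons polynomial_pathD(2)[OF assms(1)]
    by (intro polynomial_functions.mult) (auto simp: positions_def)
  then show ?case by (simp add: monomial_def)
qed

lemma form_ring_induct [consumes 1, case_names zero add]:
  assumes "f \<in> form_ring" "P 0" "\<And>k c f. f \<in> form_ring \<Longrightarrow> P f \<Longrightarrow> P (form k c + f)"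
  shows "P f"
proof -
  have "f \<in> form_ring \<and> P f"
    using assms(1) unfolding form_ring_def
  proof (induction rule: fun_space.span_induct_alt)
    case base
    show ?case using assms(2) fun_space.span_zero by blast
  next
    case (step a x y)
    then obtain k c where "x = form k c" by (auto simp: forms_def)
    then have x: "(\<lambda>A. a * x A) = form k (\<lambda>I. a * c I)" by (simp add: form_scale)
    have "form k (\<lambda>I. a * c I) \<in> fun_space.span (\<Union>k. forms k)"
      by (intro fun_space.span_base UnionI[of "forms k"] form_mem rangeI)
    moreover have y: "y \<in> fun_space.span (\<Union>k. forms k)" "P y" using step(2) by simp_all
    ultimately show ?case unfolding x
      by (intro conjI fun_space.span_add assms(3)[unfolded form_ring_def])
  qed
  then show ?thesis ..
qed

lemma form_ring_outside: "f \<in> form_ring \<Longrightarrow> A \<notin> D \<Longrightarrow> f A = 0"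
  by (induction rule: form_ring_induct) (simp_all add: form_def)

lemma form_ring_polynomial:
  assumes "f \<in> form_ring"
  shows "polynomial_along_paths m n D f"
  unfolding polynomial_along_paths_def
proof (intro allI impI)
  fix \<gamma> assume \<gamma>: "polynomial_path m n \<gamma>" "\<forall>s. \<gamma> s \<in> D"
  show "(\<lambda>s. f (\<gamma> s)) \<in> polynomial_functions {\<lambda>s. s}"
    using assms
  proof (induction rule: form_ring_induct)
    case zero
    show ?case by (simp add: polynomial_functions.const)
  next
    case (add k c f)
    have "(\<lambda>s. \<Sum>I\<in>words m n k. c I * monomial I (\<gamma> s)) \<in> polynomial_functions {\<lambda>s. s}"
      using polynomial_functions_monomial[OF \<gamma>(1)]
      by (intro polynomial_functions_sum polynomial_functions.mult polynomial_functions.const) (auto simp: words_def)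
    then show ?case using polynomial_functions.add[OF _ add(2)] \<gamma>(2) by (simp add: form_def)
  qed
qed

abbreviation "is_endo \<equiv> equivariant_endo GL_pairs pair_action form_ring"

lemma form_mem_ring: "form k c \<in> form_ring"
  using form_mem forms_subset_form_ring by blast

lemma endo_form:
  assumes "is_endo \<Phi>"
  shows "\<Phi> (form k c) z = (\<Sum>I\<in>words m n k. c I * \<Phi> (basic_form k I) z)"
proof (rule functional_form[where L = "\<lambda>f. \<Phi> f z"])
  have M: "f \<in> forms k \<Longrightarrow> f \<in> form_ring" for f using forms_subset_form_ring by blast
  show "\<Phi> (f + g) z = \<Phi> f z + \<Phi> g z" if "f \<in> forms k" "g \<in> forms k" for f g
    using assms M[OF that(1)] M[OF that(2)] unfolding equivariant_endo_def by simp
  show "\<Phi> (\<lambda>A. a * f A) z = a * \<Phi> f z" if "f \<in> forms k" for f a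
    using assms M[OF that(1)] unfolding equivariant_endo_def by simp
qed

lemma endo_mem: "is_endo \<Phi> \<Longrightarrow> f \<in> form_ring \<Longrightarrow> \<Phi> f \<in> form_ring"
  by (simp add: equivariant_endo_def)

lemma endo_kernel_invariant_GL:
  assumes \<Phi>: "is_endo \<Phi>" and EF: "(E, F) \<in> GL_pairs" and z: "z \<in> D" and w: "w \<in> D"
  shows "\<Phi> (kernel k w) (E * z * F) = \<Phi> (kernel k (transpose_mat E * w * transpose_mat F)) z"
proof -
  have EF': "E \<in> carrier_mat m m" "F \<in> carrier_mat n n" using EF by (auto simp: GL_pairs_def)
  have "\<Phi> (two_sided D E F (kernel k w)) = two_sided D E F (\<Phi> (kernel k w))"
    using \<Phi> EF form_mem_ring[of k "\<lambda>I. monomial I w"] unfolding equivariant_endo_def kernel_def by force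
  then show ?thesis
    using z two_sided_kernel[OF EF' rank_variety_carrier[OF w], of k] by (simp add: two_sided_def)
qed

text \<open>Both sides are polynomial along the lines from the identity matrices to \<open>E\<close> and \<open>F\<close>, on which all but
finitely many points are pairs of invertible matrices.\<close>

lemma endo_kernel_invariant:
  assumes \<Phi>: "is_endo \<Phi>" and EF: "E \<in> carrier_mat m m" "F \<in> carrier_mat n n" and z: "z \<in> D" and w: "w \<in> D"
  shows "\<Phi> (kernel k w) (E * z * F) = \<Phi> (kernel k (transpose_mat E * w * transpose_mat F)) z"
proof -
  define E' where "E' s = mat m m (\<lambda>ij. (1 - s) * (1\<^sub>m m) $$ ij + s * E $$ ij)" for s
  define F' where "F' s = mat n n (\<lambda>ij. (1 - s) * (1\<^sub>m n) $$ ij + s * F $$ ij)" for s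
  have p: "polynomial_path m m E'" "polynomial_path n n F'"
    unfolding E'_def[abs_def] F'_def[abs_def] using EF by (auto intro!: polynomial_path_line)
  note c = polynomial_pathD(1)[OF p(1)] polynomial_pathD(1)[OF p(2)]
  have ends: "E' 0 = 1\<^sub>m m" "F' 0 = 1\<^sub>m n" "E' 1 = E" "F' 1 = F"
    using EF by (auto simp: E'_def F'_def)
  define h where "h s = \<Phi> (kernel k w) (E' s * z * F' s)
      - \<Phi> (kernel k (transpose_mat (E' s) * w * transpose_mat (F' s))) z" for s
  have zc: "z \<in> carrier_mat m n" and wc: "w \<in> carrier_mat m n" using z w rank_variety_carrier by auto
  have 1: "(\<lambda>s. \<Phi> (kernel k w) (E' s * z * F' s)) \<in> polynomial_functions {\<lambda>s. s}"
  proof (rule polynomial_along_pathsD[OF form_ring_polynomial])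
    show "\<Phi> (kernel k w) \<in> form_ring" using endo_mem[OF \<Phi> form_mem_ring] by (simp add: kernel_def)
    show "polynomial_path m n (\<lambda>s. E' s * z * F' s)"
      by (rule polynomial_path_mult[OF polynomial_path_mult[OF p(1) polynomial_path_const[OF zc]] p(2)])
    show "E' s * z * F' s \<in> D" for s using rank_variety_mult[OF z c(1) c(2)] .
  qed
  have 2: "(\<lambda>s. \<Phi> (kernel k (transpose_mat (E' s) * w * transpose_mat (F' s))) z) \<in> polynomial_functions {\<lambda>s. s}"
    unfolding kernel_def endo_form[OF \<Phi>]
  proof (intro polynomial_functions_sum polynomial_functions.mult polynomial_functions.const polynomial_functions_monomial)
    show "polynomial_path m n (\<lambda>s. transpose_mat (E' s) * w * transpose_mat (F' s))"
      by (rule polynomial_path_mult[OF polynomial_path_mult[OF polynomial_path_transpose[OF p(1)] polynomial_path_const[OF wc]]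
            polynomial_path_transpose[OF p(2)]])
  qed (simp add: words_def)
  have "h 1 = 0"
  proof (rule polynomial_functions_line_eq_zero[where f = h and \<delta> = "\<lambda>s. det (E' s) * det (F' s)" and s\<^sub>0 = 0])
    show "h \<in> polynomial_functions {\<lambda>s. s}"
      unfolding h_def[abs_def] by (rule polynomial_functions_diff[OF 1 2])
    show "(\<lambda>s. det (E' s) * det (F' s)) \<in> polynomial_functions {\<lambda>s. s}"
      by (intro polynomial_functions.mult polynomial_path_det[OF p(1)] polynomial_path_det[OF p(2)])
    show "det (E' 0) * det (F' 0) \<noteq> 0" by (simp add: ends)
    show "h s = 0" if "det (E' s) * det (F' s) \<noteq> 0" for s
      using endo_kernel_invariant_GL[OF \<Phi> _ z w, of "E' s" "F' s" k] that c
      by (simp add: h_def GL_pairs_def)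
  qed
  then show ?thesis by (simp add: h_def ends)
qed

lemma endo_kernel_symmetric:
  assumes t: "t \<le> m" "t \<le> n" and \<Phi>: "is_endo \<Phi>" and z: "z \<in> D" and w: "w \<in> D"
  shows "\<Phi> (kernel k w) z = \<Phi> (kernel k z) w"
proof (rule invariant_kernel_symmetric[OF t, where Q = "\<lambda>z w. \<Phi> (kernel k w) z"])
  show "\<Phi> (kernel k w) (E * z * F) = \<Phi> (kernel k (transpose_mat E * w * transpose_mat F)) z"
    if "E \<in> carrier_mat m m" "F \<in> carrier_mat n n" "z \<in> D" "w \<in> D" for E F z w
    using endo_kernel_invariant[OF \<Phi> that] .
  show "polynomial_along_paths m n D (\<Phi> (kernel k w))" for w
    using form_ring_polynomial[OF endo_mem[OF \<Phi> form_mem_ring]] by (simp add: kernel_def)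
qed (rule z w)+

text \<open>By symmetry the value at \<open>A\<close> is \<open>\<Phi> (kernel k A) w\<close>, and \<open>kernel k A\<close> is the sum of the basic forms with the
monomials of \<open>A\<close> as coefficients. In particular \<open>\<Phi>\<close> preserves the degree.\<close>

lemma endo_kernel_eq_form:
  assumes t: "t \<le> m" "t \<le> n" and \<Phi>: "is_endo \<Phi>" and w: "w \<in> D"
  shows "\<Phi> (kernel k w) = form k (\<lambda>I. \<Phi> (basic_form k I) w)"
proof
  fix A
  show "\<Phi> (kernel k w) A = form k (\<lambda>I. \<Phi> (basic_form k I) w) A"
  proof (cases "A \<in> D")
    case True
    have "\<Phi> (kernel k w) A = \<Phi> (kernel k A) w" by (rule endo_kernel_symmetric[OF t \<Phi> True w])
    also have "\<dots> = (\<Sum>I\<in>words m n k. monomial I A * \<Phi> (basic_form k I) w)"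
      unfolding kernel_def by (rule endo_form[OF \<Phi>])
    finally show ?thesis using True by (simp add: form_def mult.commute)
  next
    case False
    then show ?thesis using form_ring_outside[OF endo_mem[OF \<Phi> form_mem_ring]] by (simp add: form_def kernel_def)
  qed
qed

lemma is_endo_comp:
  assumes "is_endo \<Phi>" "is_endo \<Psi>"
  shows "is_endo (\<lambda>f. \<Phi> (\<Psi> f))"
  using assms unfolding equivariant_endo_def by simp

text \<open>The sum in the auxiliary fact \<open>comp\<close> does not change if \<open>\<Phi>\<close> is exchanged with \<open>\<Psi>\<close> and \<open>z\<close> with \<open>w\<close>. The
symmetry of the composite endomorphism then exchanges \<open>z\<close> and \<open>w\<close> back.\<close>

lemma endos_commute_kernel:
  assumes t: "t \<le> m" "t \<le> n" and \<Phi>: "is_endo \<Phi>" and \<Psi>: "is_endo \<Psi>" and w: "w \<in> D"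
  shows "\<Phi> (\<Psi> (kernel k w)) = \<Psi> (\<Phi> (kernel k w))"
proof
  have comp: "\<Phi> (\<Psi> (kernel k w)) z = (\<Sum>I\<in>words m n k. \<Psi> (basic_form k I) w * \<Phi> (basic_form k I) z)"
    if "is_endo \<Phi>" "is_endo \<Psi>" "w \<in> D" for \<Phi> \<Psi> z w
    unfolding endo_kernel_eq_form[OF t that(2,3)] endo_form[OF that(1)] ..
  fix z
  show "\<Phi> (\<Psi> (kernel k w)) z = \<Psi> (\<Phi> (kernel k w)) z"
  proof (cases "z \<in> D")
    case True
    have "\<Phi> (\<Psi> (kernel k w)) z = \<Psi> (\<Phi> (kernel k z)) w"
      unfolding comp[OF \<Phi> \<Psi> w] comp[OF \<Psi> \<Phi> True] by (simp add: mult.commute)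
    also have "\<dots> = \<Psi> (\<Phi> (kernel k w)) z"
      by (rule endo_kernel_symmetric[OF t is_endo_comp[OF \<Psi> \<Phi>] w True])
    finally show ?thesis .
  next
    case False
    have "kernel k w \<in> form_ring" by (simp add: kernel_def form_mem_ring)
    then show ?thesis
      using form_ring_outside[OF endo_mem[OF \<Phi> endo_mem[OF \<Psi>]] False]
        form_ring_outside[OF endo_mem[OF \<Psi> endo_mem[OF \<Phi>]] False] by simp
  qed
qed

lemma endos_commute:
  assumes t: "t \<le> m" "t \<le> n" and \<Phi>: "is_endo \<Phi>" and \<Psi>: "is_endo \<Psi>" and f: "f \<in> form_ring"
  shows "\<Phi> (\<Psi> f) = \<Psi> (\<Phi> f)"
proof -
  let ?C = "{f \<in> form_ring. \<Phi> (\<Psi> f) = \<Psi> (\<Phi> f)}"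
  have add: "\<Theta> (f + g) = \<Theta> f + \<Theta> g" if "is_endo \<Theta>" "f \<in> form_ring" "g \<in> form_ring" for \<Theta> f g
    using that unfolding equivariant_endo_def by simp
  have scale: "\<Theta> (\<lambda>x. c * f x) = (\<lambda>x. c * \<Theta> f x)" if "is_endo \<Theta>" "f \<in> form_ring" for \<Theta> c f
    using that unfolding equivariant_endo_def by simp
  have zero: "\<Theta> 0 = 0" if "is_endo \<Theta>" for \<Theta>
    using add[OF that, of 0 0] fun_space.subspace_0[OF subspace_form_ring] by simp
  have C: "fun_space.subspace ?C"
    unfolding fun_space.subspace_def
  proof (intro conjI ballI allI)
    show "0 \<in> ?C" using fun_space.subspace_0[OF subspace_form_ring] by (simp only: mem_Collect_eq zero[OF \<Phi>] zero[OF \<Psi>])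
    show "f + g \<in> ?C" if "f \<in> ?C" "g \<in> ?C" for f g
    proof -
      have fg: "f \<in> form_ring" "g \<in> form_ring" "\<Phi> (\<Psi> f) = \<Psi> (\<Phi> f)" "\<Phi> (\<Psi> g) = \<Psi> (\<Phi> g)" using that by simp_all
      show ?thesis
        unfolding mem_Collect_eq add[OF \<Phi> fg(1,2)] add[OF \<Psi> fg(1,2)]
          add[OF \<Phi> endo_mem[OF \<Psi> fg(1)] endo_mem[OF \<Psi> fg(2)]]
          add[OF \<Psi> endo_mem[OF \<Phi> fg(1)] endo_mem[OF \<Phi> fg(2)]] fg(3,4)
        by (intro conjI refl fun_space.subspace_add[OF subspace_form_ring] fg(1,2))
    qed
    show "(\<lambda>x. c * f x) \<in> ?C" if "f \<in> ?C" for c f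
    proof -
      have f: "f \<in> form_ring" "\<Phi> (\<Psi> f) = \<Psi> (\<Phi> f)" using that by simp_all
      show ?thesis
        unfolding mem_Collect_eq scale[OF \<Phi> f(1)] scale[OF \<Psi> f(1)]
          scale[OF \<Phi> endo_mem[OF \<Psi> f(1)]] scale[OF \<Psi> endo_mem[OF \<Phi> f(1)]] f(2)
        by (intro conjI refl fun_space.subspace_scale[OF subspace_form_ring] f(1))
    qed
  qed
  have "kernel k ` D \<subseteq> ?C" for k
    using endos_commute_kernel[OF t \<Phi> \<Psi>] form_mem_ring by (auto simp: kernel_def)
  then have "forms k \<subseteq> ?C" for k
    using forms_subset_span_kernel[of k] fun_space.span_minimal[OF _ C] by (meson order_trans)
  then have "fun_space.span (\<Union>k. forms k) \<subseteq> ?C" by (intro fun_space.span_minimal[OF _ C]) blast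
  moreover have "f \<in> fun_space.span (\<Union>k. forms k)" using f by (simp only: form_ring_def)
  ultimately have "f \<in> ?C" by (rule subsetD)
  then show ?thesis by simp
qed

theorem form_ring_multiplicity_free:
  assumes "t \<le> m" "t \<le> n"
  shows "multiplicity_free GL_pairs pair_action form_ring"
  unfolding multiplicity_free_def
proof (intro conjI allI impI ballI)
  show "\<exists>\<V>. irreducible_decomposition GL_pairs pair_action form_ring \<V>"
    by (rule form_ring_decomposition_exists)
  fix \<V> V W
  assume dec: "irreducible_decomposition GL_pairs pair_action form_ring \<V>" and VW: "V \<in> \<V>" "W \<in> \<V>"
    and iso: "isomorphic_modules GL_pairs pair_action V W"
  show "V = W"
  proof (rule isomorphic_summands_eq[OF linear_pair_action _ dec VW iso])
    fix \<Phi> \<Psi> f assume "is_endo \<Phi>" "is_endo \<Psi>" "f \<in> form_ring"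
    then show "\<Phi> (\<Psi> f) = \<Psi> (\<Phi> f)" by (rule endos_commute[OF assms])
  qed
qed

section \<open>The coordinate ring\<close>

lemma form_ring_mult:
  assumes f: "f \<in> form_ring" and g: "g \<in> form_ring"
  shows "(\<lambda>A. f A * g A) \<in> form_ring"
proof -
  have prod: "(\<lambda>A. form k c A * form l e A) \<in> form_ring" for k c l e
  proof -
    have "(\<lambda>A. form k c A * form l e A)
        = (\<Sum>I\<in>words m n k. \<Sum>J\<in>words m n l. (\<lambda>A. (c I * e J) * basic_form (k + l) (I @ J) A))"
    proof
      fix A
      show "form k c A * form l e A
        = (\<Sum>I\<in>words m n k. \<Sum>J\<in>words m n l. (\<lambda>A. (c I * e J) * basic_form (k + l) (I @ J) A)) A"
      proof (cases "A \<in> D")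
        case True
        have "basic_form (k + l) (I @ J) A = monomial I A * monomial J A"
          if "I \<in> words m n k" "J \<in> words m n l" for I J
          using basic_form_apply[of "I @ J" "k + l" A] that True by (simp add: words_def monomial_def)
        note basic = this
        have "form k c A * form l e A
            = (\<Sum>I\<in>words m n k. \<Sum>J\<in>words m n l. (c I * monomial I A) * (e J * monomial J A))"
          using True by (simp only: form_def if_True sum_product)
        also have "\<dots> = (\<Sum>I\<in>words m n k. \<Sum>J\<in>words m n l. (c I * e J) * basic_form (k + l) (I @ J) A)"
          by (intro sum.cong refl) (simp add: basic)
        finally show ?thesis by (simp only: sum_fun_apply)
      next
        case False
        then show ?thesis by (simp add: form_def basic_form_def sum_fun_apply)
      qed
    qed
    also have "\<dots> \<in> form_ring"
      unfolding basic_form_def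
      by (intro fun_space.subspace_sum[OF subspace_form_ring] fun_space.subspace_scale[OF subspace_form_ring] form_mem_ring)
    finally show ?thesis .
  qed
  have left: "(\<lambda>A. form k c A * g A) \<in> form_ring" for k c
    using g
  proof (induction rule: form_ring_induct)
    case zero
    show ?case using fun_space.subspace_0[OF subspace_form_ring] by (simp add: zero_fun_def)
  next
    case (add l e g)
    have "(\<lambda>A. form k c A * (form l e + g) A) = (\<lambda>A. form k c A * form l e A) + (\<lambda>A. form k c A * g A)"
      by (rule ext) (simp add: algebra_simps)
    then show ?case using fun_space.subspace_add[OF subspace_form_ring prod add(2)] by (simp only:)
  qed
  show ?thesis
    using f
  proof (induction rule: form_ring_induct)
    case zero
    show ?case using fun_space.subspace_0[OF subspace_form_ring] by (simp add: zero_fun_def)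
  next
    case (add k c f)
    have "(\<lambda>A. (form k c + f) A * g A) = (\<lambda>A. form k c A * g A) + (\<lambda>A. f A * g A)"
      by (rule ext) (simp add: algebra_simps)
    then show ?case using fun_space.subspace_add[OF subspace_form_ring left add(2)] by (simp only:)
  qed
qed

theorem coordinate_ring_eq: "coordinate_ring m n D = form_ring"
proof
  let ?X = "{\<lambda>A. A $$ (i, j) |i j. i < m \<and> j < n} :: (complex mat \<Rightarrow> complex) set"
  show "coordinate_ring m n D \<subseteq> form_ring"
  proof
    fix f assume "f \<in> coordinate_ring m n D"
    then obtain F where F: "F \<in> polynomial_functions ?X" "f = (\<lambda>A. if A \<in> D then F A else 0)"
      by (auto simp: coordinate_ring_def)
    from F(1) have "(\<lambda>A. if A \<in> D then F A else 0) \<in> form_ring"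
    proof induction
      case (const c)
      have "(\<lambda>A. if A \<in> D then c else 0) = form 0 (\<lambda>_. c)"
        by (rule ext) (simp add: form_def words_0 monomial_def)
      then show ?case using form_mem_ring by (simp only:)
    next
      case (coord x)
      then obtain i j where x: "x = (\<lambda>A. A $$ (i, j))" "i < m" "j < n" by auto
      then have I: "[(i, j)] \<in> words m n 1" by (simp add: words_def positions_def)
      have "(\<lambda>A. if A \<in> D then x A else 0) = basic_form 1 [(i, j)]"
      proof
        fix A
        show "(if A \<in> D then x A else 0) = basic_form 1 [(i, j)] A"
          using basic_form_apply[OF I, of A] by (cases "A \<in> D") (simp_all add: x(1) monomial_def basic_form_def form_def)
      qed
      then show ?case unfolding basic_form_def using form_mem_ring by (simp only:)
    next
      case (add f g)
      have "(\<lambda>A. if A \<in> D then f A + g A else 0)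
          = (\<lambda>A. if A \<in> D then f A else 0) + (\<lambda>A. if A \<in> D then g A else 0)" by (rule ext) simp
      then show ?case using fun_space.subspace_add[OF subspace_form_ring add(3,4)] by (simp only:)
    next
      case (mult f g)
      have "(\<lambda>A. if A \<in> D then f A * g A else 0)
          = (\<lambda>A. (if A \<in> D then f A else 0) * (if A \<in> D then g A else 0))" by (rule ext) simp
      then show ?case using form_ring_mult[OF mult(3,4)] by (simp only:)
    qed
    then show "f \<in> form_ring" using F(2) by (simp only:)
  qed
  have mem: "(\<lambda>A. if A \<in> D then F A else 0) \<in> coordinate_ring m n D" if "F \<in> polynomial_functions ?X" for F
    unfolding coordinate_ring_def using that by (rule imageI)
  have "fun_space.subspace (coordinate_ring m n D)"
    unfolding fun_space.subspace_def
  proof (intro conjI ballI allI)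
    have "0 = (\<lambda>A. if A \<in> D then (0 :: complex) else 0)" by (rule ext) simp
    then show "0 \<in> coordinate_ring m n D" using mem[OF polynomial_functions.const[of 0]] by (simp only:)
    show "f + g \<in> coordinate_ring m n D"
      if f: "f \<in> coordinate_ring m n D" and g: "g \<in> coordinate_ring m n D" for f g
    proof -
      obtain F H where FH: "F \<in> polynomial_functions ?X" "f = (\<lambda>A. if A \<in> D then F A else 0)"
        "H \<in> polynomial_functions ?X" "g = (\<lambda>A. if A \<in> D then H A else 0)"
        using f g by (auto simp: coordinate_ring_def)
      have "f + g = (\<lambda>A. if A \<in> D then F A + H A else 0)" unfolding FH(2,4) by (rule ext) simp
      then show ?thesis using mem[OF polynomial_functions.add[OF FH(1,3)]] by (simp only:)
    qed
    show "(\<lambda>A. a * f A) \<in> coordinate_ring m n D" if f: "f \<in> coordinate_ring m n D" for a f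
    proof -
      obtain F where F: "F \<in> polynomial_functions ?X" "f = (\<lambda>A. if A \<in> D then F A else 0)"
        using f by (auto simp: coordinate_ring_def)
      have "(\<lambda>A. a * f A) = (\<lambda>A. if A \<in> D then a * F A else 0)" unfolding F(2) by (rule ext) simp
      then show ?thesis using mem[OF polynomial_functions.mult[OF polynomial_functions.const F(1)]] by (simp only:)
    qed
  qed
  moreover have "forms k \<subseteq> coordinate_ring m n D" for k
  proof
    fix f assume "f \<in> forms k"
    then obtain c where c: "f = form k c" by (auto simp: forms_def)
    have mono: "monomial I \<in> polynomial_functions ?X" if "set I \<subseteq> positions m n" for I
      using that
    proof (induction I)
      case Nil
      then show ?case by (simp add: monomial_def[abs_def] polynomial_functions.const)
    next
      case (Cons p I)
      obtain i j where p: "p = (i, j)" "i < m" "j < n" using Cons.prems by (auto simp: positions_def)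
      have "(\<lambda>A. A $$ p * monomial I A) \<in> polynomial_functions ?X"
        by (rule polynomial_functions.mult[OF polynomial_functions.coord Cons.IH]) (use p Cons.prems in auto)
      then show ?case by (simp add: monomial_def[abs_def])
    qed
    have "(\<lambda>A. \<Sum>I\<in>words m n k. c I * monomial I A) \<in> polynomial_functions ?X"
      by (intro polynomial_functions_sum polynomial_functions.mult polynomial_functions.const mono) (simp add: words_def)
    from mem[OF this] show "f \<in> coordinate_ring m n D" unfolding c form_def .
  qed
  ultimately show "form_ring \<subseteq> coordinate_ring m n D"
    unfolding form_ring_def by (intro fun_space.span_minimal) auto
qed

end

section \<open>Independent rows and minors\<close>

definition rows_independent :: "complex mat \<Rightarrow> nat set \<Rightarrow> bool" where
  "rows_independent A I \<longleftrightarrow>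
     (\<forall>c. (\<forall>j<dim_col A. (\<Sum>i\<in>I. c i * A $$ (i, j)) = 0) \<longrightarrow> (\<forall>i\<in>I. c i = 0))"

lemma rows_independentD:
  assumes "rows_independent A I" "A \<in> carrier_mat m n"
    "\<And>j. j < n \<Longrightarrow> (\<Sum>i\<in>I. c i * A $$ (i, j)) = 0" "i \<in> I"
  shows "c i = 0"
  using assms unfolding rows_independent_def by auto

lemma rows_independent_subset:
  assumes "rows_independent A I" "J \<subseteq> I" "finite I"
  shows "rows_independent A J"
  unfolding rows_independent_def
proof (intro allI impI ballI)
  fix c i assume c: "\<forall>j<dim_col A. (\<Sum>i\<in>J. c i * A $$ (i, j)) = 0" and i: "i \<in> J"
  have "(\<Sum>i\<in>I. (if i \<in> J then c i else 0) * A $$ (i, j)) = (\<Sum>i\<in>J. c i * A $$ (i, j))" for j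
    using assms(2,3) by (intro sum.mono_neutral_cong_right) auto
  then have sums: "(\<Sum>i\<in>I. (if i \<in> J then c i else 0) * A $$ (i, j)) = 0" if "j < dim_col A" for j
    using c that by simp
  have "(if i \<in> J then c i else 0) = 0"
    by (rule rows_independentD[OF assms(1) carrier_matI[OF refl refl] sums subsetD[OF assms(2) i]])
  then show "c i = 0" using i by simp
qed

text \<open>A vanishing determinant means that the transpose of the square matrix of the chosen rows has a nonzero
kernel vector, whose entries are the coefficients of a linear relation between these rows.\<close>

lemma rows_independent_iff_det:
  assumes A: "A \<in> carrier_mat m r" and f: "bij_betw f {..<r} I"
  shows "rows_independent A I \<longleftrightarrow> det (mat r r (\<lambda>(i, j). A $$ (f i, j))) \<noteq> 0"
proof -
  let ?S = "mat r r (\<lambda>(i, j). A $$ (f i, j))"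
  have S: "transpose_mat ?S \<in> carrier_mat r r" by simp
  have row: "(transpose_mat ?S *\<^sub>v v) $ j = (\<Sum>i\<in>I. v $ (inv_into {..<r} f i) * A $$ (i, j))"
    if "v \<in> carrier_vec r" "j < r" for v j
  proof -
    have "(transpose_mat ?S *\<^sub>v v) $ j = (\<Sum>a\<in>{..<r}. v $ a * A $$ (f a, j))"
      using that by (simp add: scalar_prod_def atLeast0LessThan mult.commute)
    also have "\<dots> = (\<Sum>a\<in>{..<r}. v $ (inv_into {..<r} f (f a)) * A $$ (f a, j))"
      using f by (intro sum.cong) (auto simp: bij_betw_def)
    also have "\<dots> = (\<Sum>i\<in>I. v $ (inv_into {..<r} f i) * A $$ (i, j))"
      by (rule sum.reindex_bij_betw[OF f])
    finally show ?thesis .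
  qed
  have "det ?S = 0 \<longleftrightarrow> (\<exists>v. v \<in> carrier_vec r \<and> v \<noteq> 0\<^sub>v r \<and> transpose_mat ?S *\<^sub>v v = 0\<^sub>v r)"
    using det_0_iff_vec_prod_zero[OF S] det_transpose[of ?S r] by simp
  also have "\<dots> \<longleftrightarrow> \<not> rows_independent A I"
  proof
    assume "\<exists>v. v \<in> carrier_vec r \<and> v \<noteq> 0\<^sub>v r \<and> transpose_mat ?S *\<^sub>v v = 0\<^sub>v r"
    then obtain v where v: "v \<in> carrier_vec r" "v \<noteq> 0\<^sub>v r" "transpose_mat ?S *\<^sub>v v = 0\<^sub>v r" by blast
    show "\<not> rows_independent A I"
    proof
      assume ind: "rows_independent A I"
      have "v $ (inv_into {..<r} f i) = 0" if "i \<in> I" for i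
      proof (rule rows_independentD[OF ind A _ that, where c = "\<lambda>i. v $ (inv_into {..<r} f i)"])
        fix j assume "j < r"
        then show "(\<Sum>i\<in>I. v $ inv_into {..<r} f i * A $$ (i, j)) = 0"
          using row[OF v(1), of j] v(3) by simp
      qed
      then have "v $ a = 0" if "a < r" for a
        using f that bij_betw_inv_into_left[OF f, of a] bij_betw_apply[OF f, of a] by force
      then have "v = 0\<^sub>v r" using v(1) by (intro eq_vecI) auto
      with v(2) show False by simp
    qed
  next
    assume "\<not> rows_independent A I"
    then obtain c i where c: "\<And>j. j < r \<Longrightarrow> (\<Sum>i\<in>I. c i * A $$ (i, j)) = 0" and i: "i \<in> I" "c i \<noteq> 0"
      using A unfolding rows_independent_def by auto
    let ?v = "vec r (\<lambda>a. c (f a))"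
    obtain a where a: "a < r" "f a = i" using i(1) f by (auto simp: bij_betw_def)
    have "?v \<noteq> 0\<^sub>v r"
    proof
      assume "?v = 0\<^sub>v r"
      then have "?v $ a = 0\<^sub>v r $ a" by (rule arg_cong)
      with a i show False by simp
    qed
    moreover have "transpose_mat ?S *\<^sub>v ?v = 0\<^sub>v r"
    proof (rule eq_vecI)
      fix j assume "j < dim_vec (0\<^sub>v r :: complex vec)"
      then have j: "j < r" by simp
      have "(\<Sum>i\<in>I. ?v $ inv_into {..<r} f i * A $$ (i, j)) = (\<Sum>i\<in>I. c i * A $$ (i, j))"
        using bij_betw_inv_into_right[OF f] bij_betw_apply[OF bij_betw_inv_into[OF f]]
        by (intro sum.cong) auto
      then show "(transpose_mat ?S *\<^sub>v ?v) $ j = 0\<^sub>v r $ j" using row[of ?v j] j c[OF j] by simp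
    qed simp
    ultimately show "\<exists>v. v \<in> carrier_vec r \<and> v \<noteq> 0\<^sub>v r \<and> transpose_mat ?S *\<^sub>v v = 0\<^sub>v r"
      by (intro exI[of _ ?v]) simp
  qed
  finally show ?thesis by blast
qed

lemma bij_betw_pick:
  assumes "finite I"
  shows "bij_betw (pick I) {..<card I} I"
proof -
  have sub: "I \<subseteq> pick I ` {..<card I}"
  proof
    fix i assume i: "i \<in> I"
    then have "card {a \<in> I. a < i} < card I" using assms by (intro psubset_card_mono) auto
    then show "i \<in> pick I ` {..<card I}" using pick_card_in_set[OF i] by force
  qed
  have "card (pick I ` {..<card I}) \<le> card I" using card_image_le[of "{..<card I}" "pick I"] by simp
  then have eq: "I = pick I ` {..<card I}" using sub by (intro card_seteq) auto
  then have "inj_on (pick I) {..<card I}" by (intro eq_card_imp_inj_on) (simp_all flip: eq)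
  then show ?thesis using eq by (simp add: bij_betw_def)
qed

lemma submatrix_pluecker_index:
  assumes A: "A \<in> carrier_mat N d" and I: "I \<in> pluecker_indices d N"
  shows "submatrix A I UNIV = mat d d (\<lambda>(i, j). A $$ (pick I i, j))"
proof -
  have I': "I \<subseteq> {..<N}" "card I = d" using I by (auto simp: pluecker_indices_def)
  have "{i. i < dim_row A \<and> i \<in> I} = I" using I' A by auto
  then show ?thesis unfolding submatrix_def using A I' by (simp add: pick_UNIV)
qed

lemma rows_independent_iff_pluecker:
  assumes A: "A \<in> carrier_mat N d" and I: "I \<in> pluecker_indices d N"
  shows "rows_independent A I \<longleftrightarrow> pluecker A I \<noteq> 0"
proof -
  have "card I = d" "finite I"
    using I by (auto simp: pluecker_indices_def intro: finite_subset)
  then show ?thesis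
    using rows_independent_iff_det[OF A, of "pick I" I] bij_betw_pick[of I]
    by (simp add: pluecker_def submatrix_pluecker_index[OF A I])
qed

lemma det_zero_column:
  assumes "S \<in> carrier_mat r r" "b < r" "\<And>i. i < r \<Longrightarrow> S $$ (i, b) = (0 :: complex)"
  shows "det S = 0"
proof -
  have "S *\<^sub>v unit_vec r b = 0\<^sub>v r" using assms by (intro eq_vecI) auto
  then show ?thesis unfolding det_0_iff_vec_prod_zero[OF assms(1)]
    using assms(2) by (intro exI[of _ "unit_vec r b"]) auto
qed

text \<open>Otherwise take \<open>t + 1\<close> independent rows of \<open>X * Y\<close>. The corresponding rows of \<open>X\<close>, which has only \<open>t\<close>
columns, are then independent, also after a zero column is appended; but this gives a square matrix
with a zero column.\<close>

lemma rank_variety_card_rows: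
  assumes A: "A \<in> rank_variety m n t" and I: "I \<subseteq> {..<m}" and ind: "rows_independent A I"
  shows "card I \<le> t"
proof (rule ccontr)
  assume "\<not> card I \<le> t"
  then have "Suc t \<le> card I" by simp
  then obtain J where J: "J \<subseteq> I" "card J = Suc t" by (rule obtain_subset_with_card_n) auto
  have finI: "finite I" using I finite_subset by blast
  have indJ: "rows_independent A J" by (rule rows_independent_subset[OF ind J(1) finI])
  obtain X Y where XY: "X \<in> carrier_mat m t" "Y \<in> carrier_mat t n" "A = X * Y"
    using A by (auto simp: rank_variety_iff_factor)
  define X' where "X' = mat m (Suc t) (\<lambda>(i, h). if h < t then X $$ (i, h) else 0)"
  have X': "X' \<in> carrier_mat m (Suc t)" by (simp add: X'_def)
  have "rows_independent X' J"
    unfolding rows_independent_def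
  proof (intro allI impI ballI)
    fix c i assume c: "\<forall>j<dim_col X'. (\<Sum>i\<in>J. c i * X' $$ (i, j)) = 0" and i: "i \<in> J"
    have z: "(\<Sum>i\<in>J. c i * X $$ (i, h)) = 0" if "h < t" for h
    proof -
      have "(\<Sum>i\<in>J. c i * X $$ (i, h)) = (\<Sum>i\<in>J. c i * X' $$ (i, h))"
        using that J I by (intro sum.cong) (auto simp: X'_def)
      then show ?thesis using c that X' by simp
    qed
    have "(\<Sum>i\<in>J. c i * A $$ (i, j)) = 0" if j: "j < n" for j
    proof -
      have "(\<Sum>i\<in>J. c i * A $$ (i, j)) = (\<Sum>i\<in>J. \<Sum>h\<in>{0..<t}. (c i * X $$ (i, h)) * Y $$ (h, j))"
      proof (rule sum.cong[OF refl])
        fix i assume "i \<in> J"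
        then have "i < m" using J I by auto
        then have "A $$ (i, j) = (\<Sum>h\<in>{0..<t}. X $$ (i, h) * Y $$ (h, j))"
          using XY j by (simp add: scalar_prod_def)
        then show "c i * A $$ (i, j) = (\<Sum>h\<in>{0..<t}. (c i * X $$ (i, h)) * Y $$ (h, j))"
          by (simp add: sum_distrib_left mult.assoc)
      qed
      also have "\<dots> = (\<Sum>h\<in>{0..<t}. (\<Sum>i\<in>J. c i * X $$ (i, h)) * Y $$ (h, j))"
        by (subst sum.swap) (simp add: sum_distrib_right)
      finally show ?thesis using z by simp
    qed
    then show "c i = 0" using rows_independentD[OF indJ _ _ i] XY by (metis mult_carrier_mat)
  qed
  moreover obtain f where f: "bij_betw f {..<Suc t} J"
    using J(2) finite_subset[OF J(1) finI] by (metis bij_betw_pick)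
  moreover have "det (mat (Suc t) (Suc t) (\<lambda>(i, j). X' $$ (f i, j))) = 0"
  proof (rule det_zero_column[of _ "Suc t" t])
    fix i assume i: "i < Suc t"
    then have "f i < m" using bij_betw_apply[OF f, of i] J I by auto
    then show "mat (Suc t) (Suc t) (\<lambda>(i, j). X' $$ (f i, j)) $$ (i, t) = 0"
      using i by (simp add: X'_def)
  qed simp_all
  ultimately show False using rows_independent_iff_det[OF X' f] by simp
qed

text \<open>In a maximal independent set of rows containing \<open>I\<close>, every other row depends on the chosen ones; the
coefficients are the matrix \<open>X\<close> of a factorization whose second factor consists of the chosen rows.\<close>

lemma rows_independent_extend:
  assumes A: "A \<in> carrier_mat m n" and I: "I \<subseteq> {..<m}" and ind: "rows_independent A I"
  obtains J where "I \<subseteq> J" "J \<subseteq> {..<m}" "rows_independent A J" "A \<in> rank_variety m n (card J)"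
proof -
  let ?P = "\<lambda>J. I \<subseteq> J \<and> J \<subseteq> {..<m} \<and> rows_independent A J"
  have fin: "finite J" if "?P J" for J using that finite_subset by blast
  have "\<exists>J. ?P J \<and> (\<forall>K. ?P K \<longrightarrow> card K \<le> card J)"
    by (rule ex_has_greatest_nat[where k = I and b = "Suc m"]) (use I ind card_mono[of "{..<m}"] in \<open>auto simp: less_Suc_eq_le\<close>)
  then obtain J where PJ: "?P J \<and> (\<forall>K. ?P K \<longrightarrow> card K \<le> card J)" by (rule exE)
  then have J: "I \<subseteq> J" "J \<subseteq> {..<m}" "rows_independent A J" by simp_all
  have max: "card K \<le> card J" if "?P K" for K using PJ that by simp
  have finJ: "finite J" using J(2) finite_subset by blast
  have "\<exists>x. \<forall>j<n. A $$ (r, j) = (\<Sum>i\<in>J. x i * A $$ (i, j))" if r: "r < m" for r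
  proof (cases "r \<in> J")
    case True
    have "(\<Sum>i\<in>J. (if i = r then 1 else 0) * A $$ (i, j)) = A $$ (r, j)" for j
    proof -
      have "(\<Sum>i\<in>J. (if i = r then 1 else 0) * A $$ (i, j)) = (\<Sum>i\<in>J. if i = r then A $$ (i, j) else 0)"
        by (intro sum.cong) auto
      then show ?thesis using True finJ by simp
    qed
    then show ?thesis by (intro exI[of _ "\<lambda>i. if i = r then 1 else 0"]) simp
  next
    case False
    have "\<not> rows_independent A (insert r J)"
    proof
      assume "rows_independent A (insert r J)"
      then have "card (insert r J) \<le> card J" using J r by (intro max) auto
      then show False using False finJ by simp
    qed
    then obtain c i where c: "\<And>j. j < n \<Longrightarrow> (\<Sum>i\<in>insert r J. c i * A $$ (i, j)) = 0"
      and i: "i \<in> insert r J" "c i \<noteq> 0" using A unfolding rows_independent_def by auto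
    have c': "c r * A $$ (r, j) + (\<Sum>i\<in>J. c i * A $$ (i, j)) = 0" if "j < n" for j
      using c[OF that] False finJ by simp
    have cr: "c r \<noteq> 0"
    proof
      assume 0: "c r = 0"
      then have "c i = 0" if "i \<in> J" for i
        using rows_independentD[OF J(3) A _ that, of c] c' by simp
      with 0 i show False by auto
    qed
    have "A $$ (r, j) = (\<Sum>i\<in>J. (- c i / c r) * A $$ (i, j))" if "j < n" for j
    proof -
      have "(\<Sum>i\<in>J. (- c i / c r) * A $$ (i, j)) = - (\<Sum>i\<in>J. c i * A $$ (i, j)) / c r"
        by (simp add: sum_divide_distrib sum_negf)
      also have "- (\<Sum>i\<in>J. c i * A $$ (i, j)) = c r * A $$ (r, j)" using c'[OF that] by (simp add: add_eq_0_iff2 minus_equation_iff)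
      finally show ?thesis using cr by simp
    qed
    then show ?thesis by (intro exI[of _ "\<lambda>i. - c i / c r"]) simp
  qed
  then have "\<forall>r\<in>{..<m}. \<exists>x. \<forall>j<n. A $$ (r, j) = (\<Sum>i\<in>J. x i * A $$ (i, j))" by simp
  then obtain x where x: "\<forall>r\<in>{..<m}. \<forall>j<n. A $$ (r, j) = (\<Sum>i\<in>J. x r i * A $$ (i, j))"
    by (rule bchoice[THEN exE])
  let ?X = "mat m (card J) (\<lambda>(r, h). x r (pick J h))" and ?Y = "mat (card J) n (\<lambda>(h, j). A $$ (pick J h, j))"
  have "A = ?X * ?Y"
  proof (rule eq_matI)
    fix r j assume "r < dim_row (?X * ?Y)" "j < dim_col (?X * ?Y)"
    then have rj: "r < m" "j < n" by auto
    then have "(?X * ?Y) $$ (r, j) = (\<Sum>h\<in>{..<card J}. x r (pick J h) * A $$ (pick J h, j))"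
      by (simp add: scalar_prod_def atLeast0LessThan)
    also have "\<dots> = (\<Sum>i\<in>J. x r i * A $$ (i, j))"
      by (rule sum.reindex_bij_betw[OF bij_betw_pick[OF finJ]])
    finally show "A $$ (r, j) = (?X * ?Y) $$ (r, j)" using x rj by simp
  qed (use A in auto)
  moreover have "?X \<in> carrier_mat m (card J)" "?Y \<in> carrier_mat (card J) n" by simp_all
  ultimately have "A \<in> rank_variety m n (card J)" unfolding rank_variety_iff_factor by blast
  then show thesis by (rule that[OF J])
qed

section \<open>Points of the Grassmannian\<close>

lemma (in vec_space) dim_col_space:
  "vectorspace.dim class_ring (V\<lparr>carrier := col_space A\<rparr>) = rank A"
  by (simp add: rank_def col_space_def)

lemma (in vec_space) subspace_col_space:
  "A \<in> carrier_mat n k \<Longrightarrow> VectorSpace.subspace class_ring (col_space A) V"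
  unfolding col_space_def using cols_dim[of A] by (intro span_is_subspace) auto

lemma grassmannian_iff:
  "W \<in> grassmannian d N \<longleftrightarrow>
     (\<exists>A\<in>carrier_mat N d. vec_space.col_space N A = W \<and> vec_space.rank N A = d)"
proof
  assume W: "W \<in> grassmannian d N"
  then have "VectorSpace.subspace class_ring W (module_vec TYPE(complex) N)" by (simp add: grassmannian_def)
  from vec_space.subspace_eq_col_space[OF this]
  obtain k A where A: "A \<in> carrier_mat N k" "vec_space.col_space N A = W" "vec_space.rank N A = k" by blast
  have "vec_space.rank N A = d"
    using W vec_space.dim_col_space[of N A] A(2) by (simp add: grassmannian_def)
  then show "\<exists>A\<in>carrier_mat N d. vec_space.col_space N A = W \<and> vec_space.rank N A = d"
    using A by blast
next
  assume "\<exists>A\<in>carrier_mat N d. vec_space.col_space N A = W \<and> vec_space.rank N A = d"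
  then obtain A where A: "A \<in> carrier_mat N d" "vec_space.col_space N A = W" "vec_space.rank N A = d" by blast
  then show "W \<in> grassmannian d N"
    using vec_space.subspace_col_space[OF A(1)] vec_space.dim_col_space[of N A] by (simp add: grassmannian_def)
qed

lemma translate_col_space:
  assumes g: "g \<in> carrier_mat N N" and A: "A \<in> carrier_mat N k"
  shows "translate g (vec_space.col_space N A) = vec_space.col_space N (g * A)"
proof -
  have gA: "g * A \<in> carrier_mat N k" using g A by simp
  have e: "g * A *\<^sub>v x = g *\<^sub>v (A *\<^sub>v x)" if "x \<in> carrier_vec k" for x
    using g A that by simp
  show ?thesis
    unfolding translate_def
  proof (intro equalityI subsetI)
    fix v assume "v \<in> (*\<^sub>v) g ` vec_space.col_space N A"
    then obtain x where "x \<in> carrier_vec k" "v = g *\<^sub>v (A *\<^sub>v x)"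
      using vec_space.mem_col_space[OF A] by auto
    then show "v \<in> vec_space.col_space N (g * A)" unfolding vec_space.mem_col_space[OF gA] using e by auto
  next
    fix v assume "v \<in> vec_space.col_space N (g * A)"
    then obtain x where x: "x \<in> carrier_vec k" "v = g * A *\<^sub>v x" using vec_space.mem_col_space[OF gA] by auto
    then have "A *\<^sub>v x \<in> vec_space.col_space N A" unfolding vec_space.mem_col_space[OF A] by auto
    then show "v \<in> (*\<^sub>v) g ` vec_space.col_space N A" using x e by auto
  qed
qed

lemma col_space_mult_invertible:
  assumes A: "A \<in> carrier_mat N d" and C: "C \<in> carrier_mat d d" "C' \<in> carrier_mat d d" "C * C' = (1\<^sub>m d :: complex mat)"
  shows "vec_space.col_space N (A * C) = vec_space.col_space N A"
proof
  show "vec_space.col_space N (A * C) \<subseteq> vec_space.col_space N A"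
    by (rule vec_space.col_space_mult_subset[OF A C(1)])
  have "A = A * C * C'" using assoc_mult_mat[OF A C(1,2)] C(3) A by simp
  then show "vec_space.col_space N A \<subseteq> vec_space.col_space N (A * C)"
    using vec_space.col_space_mult_subset[OF mult_carrier_mat[OF A C(1)] C(2)] by simp
qed

lemma rank_mult_left_le:
  assumes g: "g \<in> carrier_mat N N" and A: "A \<in> carrier_mat N k"
  shows "vec_space.rank N (g * A) \<le> vec_space.rank N (A :: complex mat)"
proof -
  let ?r = "vec_space.rank N A"
  obtain X Y where XY: "X \<in> carrier_mat N ?r" "Y \<in> carrier_mat ?r k" "A = X * Y"
    using vec_space.rank_le_iff_factor[OF A, of ?r] by auto
  have "g * A = (g * X) * Y" using assoc_mult_mat[OF g XY(1,2)] XY(3) by simp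
  moreover have "g * X \<in> carrier_mat N ?r" using g XY by simp
  ultimately show ?thesis
    unfolding vec_space.rank_le_iff_factor[OF mult_carrier_mat[OF g A]] using XY(2) by blast
qed

lemma rank_mult_invertible:
  assumes g: "g \<in> carrier_mat N N" "h \<in> carrier_mat N N" "h * g = 1\<^sub>m N" and A: "A \<in> carrier_mat N k"
  shows "vec_space.rank N (g * A) = vec_space.rank N (A :: complex mat)"
proof (rule antisym[OF rank_mult_left_le[OF g(1) A]])
  have "h * (g * A) = A" using assoc_mult_mat[OF g(2,1) A] g(3) A by simp
  then show "vec_space.rank N A \<le> vec_space.rank N (g * A)"
    using rank_mult_left_le[OF g(2) mult_carrier_mat[OF g(1) A]] by simp
qed

lemma GL_iff: "g \<in> carrier (GL N) \<longleftrightarrow> g \<in> carrier_mat N N \<and> det g \<noteq> 0"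
proof
  assume "g \<in> carrier (GL N)"
  then have u: "g \<in> Units (ring_mat TYPE(complex) N ())" by (simp add: GL_def units_of_def)
  then have "g \<in> carrier_mat N N" by (simp add: Units_def ring_mat_def)
  then show "g \<in> carrier_mat N N \<and> det g \<noteq> 0" using unit_imp_det_non_zero[OF u] by simp
next
  assume "g \<in> carrier_mat N N \<and> det g \<noteq> 0"
  then show "g \<in> carrier (GL N)"
    using det_non_zero_imp_unit[of g N "()"] by (simp add: GL_def units_of_def)
qed

lemma det_nonzero_inverse:
  assumes "g \<in> carrier_mat N N" "det g \<noteq> (0 :: complex)"
  obtains h where "h \<in> carrier_mat N N" "g * h = 1\<^sub>m N" "h * g = 1\<^sub>m N" "det h \<noteq> 0"
proof -
  have "g \<in> Units (ring_mat TYPE(complex) N ())" by (rule det_non_zero_imp_unit[OF assms])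
  then have "\<exists>h\<in>carrier_mat N N. h * g = 1\<^sub>m N \<and> g * h = 1\<^sub>m N" by (simp add: Units_def ring_mat_def)
  then obtain h where h: "h \<in> carrier_mat N N" "g * h = 1\<^sub>m N" "h * g = 1\<^sub>m N" by (elim bexE conjE)
  then have "det g * det h = 1" using det_mult[OF assms(1) h(1)] by simp
  then have "det h \<noteq> 0" by auto
  then show thesis by (rule that[OF h])
qed

lemma GL_inv_eq:
  assumes "g \<in> carrier (GL N)" "h \<in> carrier_mat N N" "h * g = 1\<^sub>m N"
  shows "inv\<^bsub>GL N\<^esub> g = h"
proof -
  interpret R: ring "ring_mat TYPE(complex) N ()" by (rule ring_mat)
  interpret G: group "GL N" unfolding GL_def by (rule R.units_group)
  have g: "g \<in> carrier_mat N N" using assms(1) GL_iff by blast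
  have "det h * det g = 1" using det_mult[OF assms(2) g] assms(3) by simp
  then have "h \<in> carrier (GL N)" using assms(2) by (auto simp: GL_iff)
  moreover have "h \<otimes>\<^bsub>GL N\<^esub> g = \<one>\<^bsub>GL N\<^esub>"
    using assms(3) by (simp add: GL_def units_of_def ring_mat_def)
  ultimately show ?thesis by (intro G.inv_equality assms(1))
qed

section \<open>Block triangular matrices\<close>

definition lower_block :: "nat \<Rightarrow> complex mat \<Rightarrow> complex mat" where
  "lower_block d A = mat (dim_row A - d) (dim_col A) (\<lambda>(i, j). A $$ (i + d, j))"

definition block_upper :: "nat \<Rightarrow> complex mat \<Rightarrow> bool" where
  "block_upper d g \<longleftrightarrow> (\<forall>i<dim_row g. \<forall>j<d. d \<le> i \<longrightarrow> g $$ (i, j) = 0)"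

lemma lower_block_carrier: "A \<in> carrier_mat N k \<Longrightarrow> lower_block d A \<in> carrier_mat (N - d) k"
  by (simp add: lower_block_def)

lemma lower_block_mult_right:
  assumes "A \<in> carrier_mat N k" "C \<in> carrier_mat k l"
  shows "lower_block d (A * C) = lower_block d A * C"
  using assms by (intro eq_matI) (auto simp: lower_block_def scalar_prod_def intro!: sum.cong)

lemma lower_block_mult_left:
  assumes g: "g \<in> carrier_mat N N" "block_upper d g" and A: "A \<in> carrier_mat N k" and d: "d \<le> N"
  shows "lower_block d (g * A) = mat (N - d) (N - d) (\<lambda>(i, j). g $$ (i + d, j + d)) * lower_block d A"
proof (rule eq_matI)
  let ?R = "mat (N - d) (N - d) (\<lambda>(i, j). g $$ (i + d, j + d)) * lower_block d A"
  fix i j assume "i < dim_row ?R" "j < dim_col ?R"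
  then have ij: "i + d < N" "j < k" using A by (auto simp: lower_block_def)
  have "lower_block d (g * A) $$ (i, j) = (\<Sum>h\<in>{0..<N}. g $$ (i + d, h) * A $$ (h, j))"
    using ij g A by (simp add: lower_block_def scalar_prod_def)
  also have "\<dots> = (\<Sum>h\<in>{0..<d}. g $$ (i + d, h) * A $$ (h, j)) + (\<Sum>h\<in>{d..<N}. g $$ (i + d, h) * A $$ (h, j))"
    using d by (simp add: sum.atLeastLessThan_concat)
  also have "(\<Sum>h\<in>{0..<d}. g $$ (i + d, h) * A $$ (h, j)) = 0"
    using g ij by (intro sum.neutral) (auto simp: block_upper_def)
  also have "(\<Sum>h\<in>{d..<N}. g $$ (i + d, h) * A $$ (h, j)) = (\<Sum>h\<in>{0..<N - d}. g $$ (i + d, h + d) * A $$ (h + d, j))"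
    using sum.shift_bounds_nat_ivl[of "\<lambda>h. g $$ (i + d, h) * A $$ (h, j)" 0 d "N - d"] d by simp
  also have "\<dots> = ?R $$ (i, j)"
    using ij g A by (simp add: lower_block_def scalar_prod_def)
  finally show "lower_block d (g * A) $$ (i, j) = ?R $$ (i, j)" by simp
qed (use g A in \<open>auto simp: lower_block_def\<close>)

lemma lower_block_mult_rank_variety:
  assumes "g \<in> carrier_mat N N" "block_upper d g" "A \<in> carrier_mat N k" "C \<in> carrier_mat k l" "d \<le> N"
    and "lower_block d A \<in> rank_variety (N - d) k t"
  shows "lower_block d (g * A * C) \<in> rank_variety (N - d) l t"
proof -
  have "lower_block d (g * A * C) = mat (N - d) (N - d) (\<lambda>(i, j). g $$ (i + d, j + d)) * lower_block d A * C"
    using lower_block_mult_right[OF mult_carrier_mat[OF assms(1,3)] assms(4)] lower_block_mult_left[OF assms(1,2,3,5)]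
    by simp
  then show ?thesis using rank_variety_mult[OF assms(6) _ assms(4)] by simp
qed

lemma rank_variety_zero_columns:
  assumes L: "L \<in> carrier_mat m k" and z: "\<And>i j. i < m \<Longrightarrow> j < k - t \<Longrightarrow> L $$ (i, j) = 0" and "t \<le> k"
  shows "L \<in> rank_variety m k t"
proof -
  let ?X = "mat m t (\<lambda>(i, h). L $$ (i, h + (k - t)))"
  let ?Y = "mat t k (\<lambda>(h, j). if j = h + (k - t) then 1 else 0)"
  have "L = ?X * ?Y"
  proof (rule eq_matI)
    fix i j assume "i < dim_row (?X * ?Y)" "j < dim_col (?X * ?Y)"
    then have ij: "i < m" "j < k" by auto
    have "(?X * ?Y) $$ (i, j) = (\<Sum>h\<in>{0..<t}. if h = j - (k - t) \<and> k - t \<le> j then L $$ (i, j) else 0)"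
      using ij by (auto simp: scalar_prod_def intro!: sum.cong)
    also have "\<dots> = L $$ (i, j)"
    proof (cases "k - t \<le> j")
      case True
      then show ?thesis using ij assms(3) by (simp add: less_diff_conv2)
    next
      case False
      then show ?thesis using z ij by simp
    qed
    finally show "L $$ (i, j) = (?X * ?Y) $$ (i, j)" ..
  qed (use L in auto)
  then show ?thesis unfolding rank_variety_iff_factor by (intro bexI[of _ ?X] bexI[of _ ?Y]) auto
qed

text \<open>The lower right block of \<open>g\<close> times the lower block \<open>(H\<^sub>1 H)\<close> of \<open>h\<close> is \<open>(0 1)\<close>. So \<open>H\<close> inverts the former,
and \<open>H\<^sub>1 = 0\<close>.\<close>

lemma block_upper_inverse:
  assumes g: "g \<in> carrier_mat N N" "block_upper d g" and h: "h \<in> carrier_mat N N" "g * h = 1\<^sub>m N" and d: "d \<le> N"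
  shows "block_upper d h"
proof -
  let ?m = "N - d"
  define G where "G = mat ?m ?m (\<lambda>(i, j). g $$ (i + d, j + d))"
  have G: "G \<in> carrier_mat ?m ?m" by (simp add: G_def)
  have eq: "G * lower_block d h = lower_block d (1\<^sub>m N)"
    using lower_block_mult_left[OF g h(1) d] h(2) by (simp add: G_def)
  define H where "H = mat ?m ?m (\<lambda>(i, j). lower_block d h $$ (i, j + d))"
  have H: "H \<in> carrier_mat ?m ?m" by (simp add: H_def)
  have L: "lower_block d h \<in> carrier_mat ?m N" by (rule lower_block_carrier[OF h(1)])
  have "G * H = 1\<^sub>m ?m"
  proof (rule eq_matI)
    fix i j assume "i < dim_row (1\<^sub>m ?m :: complex mat)" "j < dim_col (1\<^sub>m ?m :: complex mat)"
    then have ij: "i < ?m" "j < ?m" by auto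
    have "(G * H) $$ (i, j) = (G * lower_block d h) $$ (i, j + d)"
      using ij G H L by (auto simp: scalar_prod_def H_def intro!: sum.cong)
    then show "(G * H) $$ (i, j) = 1\<^sub>m ?m $$ (i, j)" using ij unfolding eq by (simp add: lower_block_def)
  qed (use G H in auto)
  then have HG: "H * G = 1\<^sub>m ?m" by (rule mat_mult_left_right_inverse[OF G H])
  have "lower_block d h = H * lower_block d (1\<^sub>m N)"
    using assoc_mult_mat[OF H G L] HG L eq by simp
  moreover have "(H * lower_block d (1\<^sub>m N)) $$ (i, j) = 0" if "i < ?m" "j < d" for i j
    using that H d by (auto simp: scalar_prod_def lower_block_def intro!: sum.neutral)
  ultimately have z: "lower_block d h $$ (i, j) = 0" if "i < ?m" "j < d" for i j using that by simp
  show ?thesis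
    unfolding block_upper_def
  proof (intro allI impI)
    fix i j assume "i < dim_row h" "j < d" "d \<le> i"
    then show "h $$ (i, j) = 0" using z[of "i - d" j] h(1) by (simp add: lower_block_def)
  qed
qed

section \<open>The Schubert variety\<close>

lemma rows_independent_lower_block:
  assumes A: "A \<in> carrier_mat N k" and I: "I \<subseteq> {..<N - d}"
  shows "rows_independent (lower_block d A) I \<longleftrightarrow> rows_independent A ((\<lambda>i. i + d) ` I)"
proof -
  have sum: "(\<Sum>i\<in>(\<lambda>i. i + d) ` I. c i * A $$ (i, j)) = (\<Sum>i\<in>I. c (i + d) * lower_block d A $$ (i, j))"
    if "j < k" for c j
    using that I A by (subst sum.reindex) (auto simp: lower_block_def intro!: sum.cong)
  have dims: "dim_col (lower_block d A) = k" "dim_col A = k" using A by (auto simp: lower_block_def)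
  show ?thesis
    unfolding rows_independent_def dims
  proof (intro iffI allI impI)
    fix c
    assume ind: "\<forall>c. (\<forall>j<k. (\<Sum>i\<in>I. c i * lower_block d A $$ (i, j)) = 0) \<longrightarrow> (\<forall>i\<in>I. c i = 0)"
      and c: "\<forall>j<k. (\<Sum>i\<in>(\<lambda>i. i + d) ` I. c i * A $$ (i, j)) = 0"
    have "(\<Sum>i\<in>I. c (i + d) * lower_block d A $$ (i, j)) = 0" if "j < k" for j
      using c that unfolding sum[OF that, symmetric] by blast
    then have "\<forall>i\<in>I. c (i + d) = 0" by (intro mp[OF spec[OF ind]] allI impI)
    then show "\<forall>i\<in>(\<lambda>i. i + d) ` I. c i = 0" by simp
  next
    fix c
    assume ind: "\<forall>c. (\<forall>j<k. (\<Sum>i\<in>(\<lambda>i. i + d) ` I. c i * A $$ (i, j)) = 0) \<longrightarrow> (\<forall>i\<in>(\<lambda>i. i + d) ` I. c i = 0)"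
      and c: "\<forall>j<k. (\<Sum>i\<in>I. c i * lower_block d A $$ (i, j)) = 0"
    have "(\<Sum>i\<in>(\<lambda>i. i + d) ` I. c (i - d) * A $$ (i, j)) = 0" if "j < k" for j
      using c that unfolding sum[OF that] by simp
    then have "\<forall>i\<in>(\<lambda>i. i + d) ` I. c (i - d) = 0" by (intro mp[OF spec[OF ind]] allI impI)
    then show "\<forall>i\<in>I. c i = 0" by simp
  qed
qed

locale schubert_rank =
  fixes d N t :: nat
  assumes td: "t < d" and tN: "t < N - d"
begin

definition word :: "nat list" where
  "word = [t + 1..<d + 1] @ [N - t + 1..<N + 1]"

text \<open>The position, counted from 0, of the unit vector that is the \<open>j\<close>-th basis vector of the coordinate
subspace.\<close>

definition pivot :: "nat \<Rightarrow> nat" where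
  "pivot j = (if j < d - t then t + j else N - d + j)"

definition pivot_mat :: "complex mat" where
  "pivot_mat = mat N d (\<lambda>(i, j). if i = pivot j then 1 else 0)"

definition rank_locus :: "complex vec set set" where
  "rank_locus = {vec_space.col_space N A |A. A \<in> carrier_mat N d \<and> vec_space.rank N A = d \<and>
     lower_block d A \<in> rank_variety (N - d) d t}"

lemma dN: "d < N" using tN by simp

lemma length_word: "length word = d"
  using td dN by (simp add: word_def) arith

lemma pivot_less: "j < d \<Longrightarrow> pivot j < N"
  using td dN by (auto simp: pivot_def)

lemma pivot_eq_iff: "i < d \<Longrightarrow> j < d \<Longrightarrow> pivot i = pivot j \<longleftrightarrow> i = j"
  using td tN by (auto simp: pivot_def)

lemma pivot_mat_carrier: "pivot_mat \<in> carrier_mat N d"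
  by (simp add: pivot_mat_def)

lemma coordinate_subspace_word: "coordinate_subspace N word = vec_space.col_space N pivot_mat"
proof -
  have "mat_of_cols N (map (\<lambda>l. unit_vec N (l - 1)) word) = pivot_mat"
  proof (rule eq_matI)
    fix i j assume "i < dim_row pivot_mat" "j < dim_col pivot_mat"
    then have ij: "i < N" "j < d" by (auto simp: pivot_mat_def)
    have "word ! j - 1 = pivot j"
      using ij td dN by (auto simp: word_def pivot_def nth_append)
    then show "mat_of_cols N (map (\<lambda>l. unit_vec N (l - 1)) word) $$ (i, j) = pivot_mat $$ (i, j)"
      using ij length_word pivot_less[OF ij(2)] by (simp add: mat_of_cols_index pivot_mat_def)
  qed (auto simp: pivot_mat_def length_word)
  then show ?thesis by (simp add: coordinate_subspace_def)
qed

lemma lower_block_pivot_mat: "lower_block d pivot_mat \<in> rank_variety (N - d) d t"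
  by (rule rank_variety_zero_columns)
    (use td tN in \<open>auto simp: lower_block_def pivot_mat_def pivot_def\<close>)

lemma col_space_mem_rank_locus:
  assumes A: "A \<in> carrier_mat N d"
  shows "vec_space.col_space N A \<in> rank_locus \<longleftrightarrow>
    vec_space.rank N A = d \<and> lower_block d A \<in> rank_variety (N - d) d t"
proof
  assume "vec_space.col_space N A \<in> rank_locus"
  then obtain B where B: "B \<in> carrier_mat N d" "vec_space.rank N B = d"
    "lower_block d B \<in> rank_variety (N - d) d t" "vec_space.col_space N A = vec_space.col_space N B"
    by (auto simp: rank_locus_def)
  then obtain C where C: "C \<in> carrier_mat d d" "A = B * C"
    using vec_space.factor_through_col_space[OF A B(1)] by auto
  have "lower_block d A = 1\<^sub>m (N - d) * lower_block d B * C"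
    unfolding C(2) left_mult_one_mat[OF lower_block_carrier[OF B(1)]] by (rule lower_block_mult_right[OF B(1) C(1)])
  also have "\<dots> \<in> rank_variety (N - d) d t" by (rule rank_variety_mult[OF B(3) one_carrier_mat C(1)])
  finally have "lower_block d A \<in> rank_variety (N - d) d t" .
  moreover have "vec_space.rank N A = d"
    using vec_space.dim_col_space[of N A] vec_space.dim_col_space[of N B] B(2,4) by simp
  ultimately show "vec_space.rank N A = d \<and> lower_block d A \<in> rank_variety (N - d) d t" by simp
qed (use A in \<open>auto simp: rank_locus_def\<close>)

lemma borelD:
  assumes "b \<in> borel N"
  shows "b \<in> carrier_mat N N" "det b \<noteq> 0" "block_upper d b"
  using assms by (auto simp: borel_def GL_iff block_upper_def upper_triangular_def)

text \<open>If the lower block has rank greater than \<open>t\<close>, then more than \<open>t\<close> independent lower rows extend to \<open>d\<close>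
independent rows, which give a nonzero Pluecker coordinate. This coordinate vanishes on the Borel
orbit, where the lower block has rank at most \<open>t\<close>.\<close>

lemma schubert_subset_rank_locus: "schubert_variety N word \<subseteq> rank_locus"
proof
  fix W assume W: "W \<in> schubert_variety N word"
  then have "W \<in> grassmannian d N" by (simp add: schubert_variety_def zariski_closure_def length_word)
  from iffD1[OF grassmannian_iff this]
  obtain A where A: "A \<in> carrier_mat N d" "vec_space.col_space N A = W" "vec_space.rank N A = d"
    by (elim bexE conjE)
  have "lower_block d A \<in> rank_variety (N - d) d t"
  proof (rule ccontr)
    assume low: "lower_block d A \<notin> rank_variety (N - d) d t"
    obtain I where I: "I \<subseteq> {..<N - d}" "rows_independent (lower_block d A) I"
      "lower_block d A \<in> rank_variety (N - d) d (card I)"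
      using rows_independent_extend[OF lower_block_carrier[OF A(1)], of "{}"]
      by (auto simp: rows_independent_def)
    have cI: "t < card I" using I(3) low rank_variety_mono[of "card I" t "N - d" d] by (meson not_le subsetD)
    let ?I = "(\<lambda>i. i + d) ` I"
    have sub: "?I \<subseteq> {..<N}" using I(1) by auto
    have ind: "rows_independent A ?I" using I(2) rows_independent_lower_block[OF A(1) I(1)] by simp
    obtain J where J: "?I \<subseteq> J" "J \<subseteq> {..<N}" "rows_independent A J" "A \<in> rank_variety N d (card J)"
      by (rule rows_independent_extend[OF A(1) sub ind])
    have "card J \<le> d"
      using rank_variety_card_rows[OF _ J(2,3), of d d] A by (simp add: rank_variety_def)
    moreover have "d \<le> card J" using J(4) A(3) by (simp add: rank_variety_def)
    ultimately have Jd: "J \<in> pluecker_indices d N" using J(2) by (simp add: pluecker_indices_def)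
    let ?F = "\<lambda>p :: nat set \<Rightarrow> complex. p J"
    have F: "?F \<in> homogeneous_polynomials d N"
      unfolding homogeneous_polynomials_def
    proof (intro CollectI conjI exI[of _ 1] allI)
      show "?F \<in> polynomial_functions ((\<lambda>I p. p I) ` pluecker_indices d N)"
        using Jd by (intro polynomial_functions.coord) (rule imageI)
    qed simp
    have "vanishes_at d N ?F (translate b (coordinate_subspace N word))" if b: "b \<in> borel N" for b
      unfolding vanishes_at_def coordinate_subspace_word translate_col_space[OF borelD(1)[OF b] pivot_mat_carrier]
    proof (intro ballI impI)
      fix B assume B: "B \<in> carrier_mat N d" "vec_space.col_space N B = vec_space.col_space N (b * pivot_mat)"
      obtain C where C: "C \<in> carrier_mat d d" "B = b * pivot_mat * C"
        using vec_space.factor_through_col_space[OF B(1) mult_carrier_mat[OF borelD(1)[OF b] pivot_mat_carrier]] B(2)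
        by auto
      have low: "lower_block d B \<in> rank_variety (N - d) d t"
        unfolding C(2) using dN
        by (intro lower_block_mult_rank_variety[OF borelD(1,3)[OF b] pivot_mat_carrier C(1) _ lower_block_pivot_mat]) simp
      show "pluecker B J = 0"
      proof (rule ccontr)
        assume "pluecker B J \<noteq> 0"
        then have "rows_independent B J" using rows_independent_iff_pluecker[OF B(1) Jd] by simp
        then have "rows_independent B ?I"
          by (rule rows_independent_subset[OF _ J(1) finite_subset[OF J(2) finite_lessThan]])
        then have "rows_independent (lower_block d B) I" using rows_independent_lower_block[OF B(1) I(1)] by simp
        then have "card I \<le> t" by (rule rank_variety_card_rows[OF low I(1)])
        then show False using cI by simp
      qed
    qed
    then have "vanishes_at d N ?F W"
      using W F unfolding schubert_variety_def zariski_closure_def length_word by auto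
    then have "pluecker A J = 0" using A by (simp add: vanishes_at_def)
    then show False using rows_independent_iff_pluecker[OF A(1) Jd] J(3) by simp
  qed
  then show "W \<in> rank_locus" unfolding A(2)[symmetric] col_space_mem_rank_locus[OF A(1)] using A(3) by simp
qed

text \<open>Multiplication from the right makes the pivot rows of \<open>A\<close> the identity matrix. The last \<open>t\<close> of them lie in
the lower block, which has rank at most \<open>t\<close>, so its rows are combinations of these last rows; hence
the first \<open>d - t\<close> columns of the lower block vanish. The columns of the resulting matrix, placed at
the pivot positions of an identity matrix, therefore form an upper unitriangular matrix.\<close>

lemma generic_point_in_borel_orbit:
  assumes A: "A \<in> carrier_mat N d" and low: "lower_block d A \<in> rank_variety (N - d) d t"
    and det: "det (mat d d (\<lambda>(i, j). A $$ (pivot i, j))) \<noteq> 0"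
  shows "\<exists>b\<in>borel N. vec_space.col_space N A = translate b (vec_space.col_space N pivot_mat)"
proof -
  let ?C = "mat d d (\<lambda>(i, j). A $$ (pivot i, j))" and ?m = "N - d"
  obtain C' where C': "C' \<in> carrier_mat d d" "?C * C' = 1\<^sub>m d" "C' * ?C = 1\<^sub>m d"
    using det_nonzero_inverse[of ?C d] det by (metis mat_carrier)
  define B where "B = A * C'"
  have B: "B \<in> carrier_mat N d" using A C' by (simp add: B_def)
  have piv: "B $$ (pivot i, j) = (if i = j then 1 else 0)" if "i < d" "j < d" for i j
  proof -
    have "B $$ (pivot i, j) = (?C * C') $$ (i, j)"
      using that A C'(1) pivot_less by (auto simp: B_def scalar_prod_def intro!: sum.cong)
    then show ?thesis using C'(2) that by simp
  qed
  have "lower_block d B = 1\<^sub>m ?m * lower_block d A * C'"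
    unfolding B_def left_mult_one_mat[OF lower_block_carrier[OF A]] by (rule lower_block_mult_right[OF A C'(1)])
  also have "\<dots> \<in> rank_variety ?m d t" by (rule rank_variety_mult[OF low one_carrier_mat C'(1)])
  finally obtain X Y where XY: "X \<in> carrier_mat ?m t" "Y \<in> carrier_mat t d" "lower_block d B = X * Y"
    by (auto simp: rank_variety_iff_factor)
  define \<xi> where "\<xi> = mat t t (\<lambda>(a, h). X $$ (?m - t + a, h))"
  have \<xi>: "\<xi> \<in> carrier_mat t t" by (simp add: \<xi>_def)
  \<comment> \<open>The last \<open>t\<close> rows of the lower block are pivot rows, so they read \<open>(0 1)\<close>.\<close>
  have \<xi>Y: "(\<xi> * Y) $$ (a, j) = (if j = d - t + a then 1 else 0)" if a: "a < t" "j < d" for a j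
  proof -
    have "(\<xi> * Y) $$ (a, j) = (X * Y) $$ (?m - t + a, j)"
      using a XY tN by (auto simp: \<xi>_def scalar_prod_def intro!: sum.cong)
    also have "\<dots> = B $$ (?m - t + a + d, j)"
      unfolding XY(3)[symmetric] using a B tN by (simp add: lower_block_def)
    also have "?m - t + a + d = pivot (d - t + a)" using a td tN by (simp add: pivot_def)
    also have "B $$ (pivot (d - t + a), j) = (if j = d - t + a then 1 else 0)"
      using piv[of "d - t + a" j] a td by auto
    finally show ?thesis .
  qed
  define Y' where "Y' = mat t t (\<lambda>(h, a). Y $$ (h, d - t + a))"
  have Y': "Y' \<in> carrier_mat t t" by (simp add: Y'_def)
  have "\<xi> * Y' = 1\<^sub>m t"
  proof (rule eq_matI)
    fix a b assume "a < dim_row (1\<^sub>m t :: complex mat)" "b < dim_col (1\<^sub>m t :: complex mat)"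
    then have ab: "a < t" "b < t" by auto
    have "(\<xi> * Y') $$ (a, b) = (\<xi> * Y) $$ (a, d - t + b)"
      using ab td XY(2) by (auto simp: Y'_def \<xi>_def scalar_prod_def intro!: sum.cong)
    moreover have "d - t + b < d" using ab td by simp
    note \<xi>Y[OF ab(1) this, unfolded add_left_cancel]
    ultimately show "(\<xi> * Y') $$ (a, b) = 1\<^sub>m t $$ (a, b)" using ab by auto
  qed (use \<xi> Y' in auto)
  then have "Y' * \<xi> = 1\<^sub>m t" by (rule mat_mult_left_right_inverse[OF \<xi> Y'])
  then have "Y = Y' * (\<xi> * Y)" using assoc_mult_mat[OF Y' \<xi> XY(2)] XY(2) by simp
  moreover have "(Y' * (\<xi> * Y)) $$ (h, j) = 0" if "h < t" "j < d - t" for h j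
  proof -
    have "(Y' * (\<xi> * Y)) $$ (h, j) = (\<Sum>a\<in>{0..<t}. Y' $$ (h, a) * (\<xi> * Y) $$ (a, j))"
      using that Y' \<xi> XY(2) by (simp add: scalar_prod_def)
    also have "\<dots> = 0" using that \<xi>Y by (intro sum.neutral) auto
    finally show ?thesis .
  qed
  ultimately have Y0: "Y $$ (h, j) = 0" if "h < t" "j < d - t" for h j using that by simp
  have low0: "B $$ (r, j) = 0" if r: "d \<le> r" "r < N" and j: "j < d - t" for r j
  proof -
    have "B $$ (r, j) = (X * Y) $$ (r - d, j)"
      unfolding XY(3)[symmetric] using r j B by (simp add: lower_block_def)
    also have "\<dots> = (\<Sum>h\<in>{0..<t}. X $$ (r - d, h) * Y $$ (h, j))"
      using r j XY(1,2) by (simp add: scalar_prod_def)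
    also have "\<dots> = 0" using Y0 j by (intro sum.neutral) auto
    finally show ?thesis .
  qed
  define b where "b = mat N N (\<lambda>(r, c). if t \<le> c \<and> c < d then B $$ (r, c - t)
    else if N - t \<le> c then B $$ (r, c - (N - d)) else if r = c then 1 else 0)"
  have b: "b \<in> carrier_mat N N" by (simp add: b_def)
  have col: "b $$ (r, pivot j) = B $$ (r, j)" if "r < N" "j < d" for r j
    using that td tN pivot_less[OF that(2)] by (auto simp: b_def pivot_def)
  have other: "b $$ (r, c) = (if r = c then 1 else 0)" if "r < N" "c < N" "c \<notin> pivot ` {..<d}" for r c
  proof -
    have "\<not> (t \<le> c \<and> c < d)"
    proof
      assume "t \<le> c \<and> c < d"
      then have "c = pivot (c - t)" "c - t < d" using td by (auto simp: pivot_def)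
      with that(3) show False by blast
    qed
    moreover have "\<not> N - t \<le> c"
    proof
      assume "N - t \<le> c"
      then have "c = pivot (c - (N - d))" "c - (N - d) < d" using td tN that(2) by (auto simp: pivot_def)
      with that(3) show False by blast
    qed
    ultimately show ?thesis using that by (auto simp: b_def)
  qed
  have upper: "b $$ (r, c) = (if r = c then 1 else 0)" if rc: "c \<le> r" "r < N" for r c
  proof (cases "c \<in> pivot ` {..<d}")
    case False
    then show ?thesis using other rc by simp
  next
    case True
    then obtain j where j: "j < d" "c = pivot j" by auto
    have e: "b $$ (r, c) = B $$ (r, j)" using col rc j by simp
    show ?thesis
    proof (cases "r \<in> pivot ` {..<d}")
      case True
      then obtain i where i: "i < d" "r = pivot i" by auto
      then show ?thesis using e piv[OF i(1) j(1)] pivot_eq_iff[OF i(1) j(1)] j by simp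
    next
      case False
      have "j < d - t"
      proof (rule ccontr)
        assume "\<not> j < d - t"
        then have "N - t \<le> r" using rc j td tN by (simp add: pivot_def)
        then have "r = pivot (r - (N - d))" "r - (N - d) < d" using td tN rc(2) by (auto simp: pivot_def)
        with False show False by blast
      qed
      have "d \<le> r"
      proof (rule ccontr)
        assume "\<not> d \<le> r"
        then have "r = pivot (r - t)" "r - t < d" using \<open>j < d - t\<close> rc j td by (auto simp: pivot_def)
        with False show False by blast
      qed
      then show ?thesis using e low0[OF _ rc(2) \<open>j < d - t\<close>] j False by auto
    qed
  qed
  have tri: "upper_triangular b" unfolding upper_triangular_def using upper b by auto
  have "diag_mat b = map (\<lambda>i. 1) [0..<N]" unfolding diag_mat_def using upper b by auto
  then have "det b = 1" using det_upper_triangular[OF tri b] by (simp add: map_replicate_const)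
  then have "b \<in> borel N" using tri b by (simp add: borel_def GL_iff)
  moreover have "b * pivot_mat = B"
  proof (rule eq_matI)
    fix r j assume "r < dim_row B" "j < dim_col B"
    then have rj: "r < N" "j < d" using B by auto
    have "(b * pivot_mat) $$ (r, j) = (\<Sum>c\<in>{0..<N}. b $$ (r, c) * pivot_mat $$ (c, j))"
      using rj b pivot_mat_carrier by (simp add: scalar_prod_def)
    also have "\<dots> = (\<Sum>c\<in>{0..<N}. if c = pivot j then b $$ (r, c) else 0)"
      using rj by (intro sum.cong) (auto simp: pivot_mat_def)
    also have "\<dots> = B $$ (r, j)" using col[OF rj] pivot_less[OF rj(2)] by simp
    finally show "(b * pivot_mat) $$ (r, j) = B $$ (r, j)" .
  qed (use B b pivot_mat_carrier in auto)
  ultimately show ?thesis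
    using translate_col_space[OF b pivot_mat_carrier] col_space_mult_invertible[OF A C'(1) _ C'(3)]
    by (intro bexI[of _ b]) (simp_all add: B_def)
qed

text \<open>The lower blocks of the base point and of \<open>A\<close> are products with inner dimension \<open>t\<close>. Interpolating the
factors, rather than the products, keeps the rank at most \<open>t\<close> along the path. The pivot rows of the base
point form the identity matrix, so \<open>generic_point_in_borel_orbit\<close> applies at the general point of the path.\<close>

lemma rank_locus_subset_schubert: "rank_locus \<subseteq> schubert_variety N word"
proof
  fix W assume W: "W \<in> rank_locus"
  then have "W \<in> grassmannian d N" unfolding rank_locus_def grassmannian_iff by auto
  moreover have "vanishes_at d N F W" if F: "F \<in> homogeneous_polynomials d N"
    and van: "\<And>b. b \<in> borel N \<Longrightarrow> vanishes_at d N F (translate b (coordinate_subspace N word))" for F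
    unfolding vanishes_at_def
  proof (intro ballI impI)
    fix A assume A: "A \<in> carrier_mat N d" "vec_space.col_space N A = W"
    then have "lower_block d A \<in> rank_variety (N - d) d t"
      using W col_space_mem_rank_locus[OF A(1)] by simp
    then obtain X Y where XY: "X \<in> carrier_mat (N - d) t" "Y \<in> carrier_mat t d" "lower_block d A = X * Y"
      by (auto simp: rank_variety_iff_factor)
    obtain X\<^sub>0 Y\<^sub>0 where XY0: "X\<^sub>0 \<in> carrier_mat (N - d) t" "Y\<^sub>0 \<in> carrier_mat t d"
      "lower_block d pivot_mat = X\<^sub>0 * Y\<^sub>0"
      using lower_block_pivot_mat by (auto simp: rank_variety_iff_factor)
    define line where "line k l P Q s = mat k l (\<lambda>ij. (1 - s) * P $$ ij + s * Q $$ ij)"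
      for k l and P Q :: "complex mat" and s
    define L where "L s = line (N - d) t X\<^sub>0 X s * line t d Y\<^sub>0 Y s" for s
    have pL: "polynomial_path (N - d) d L"
      unfolding L_def[abs_def] line_def using XY XY0
      by (intro polynomial_path_mult[where k = t] polynomial_path_line) auto
    define \<gamma> where "\<gamma> s = mat N d (\<lambda>(i, j). if i < d then line N d pivot_mat A s $$ (i, j) else L s $$ (i - d, j))" for s
    have \<gamma>: "\<gamma> s \<in> carrier_mat N d" for s by (simp add: \<gamma>_def)
    have p\<gamma>: "(\<lambda>s. \<gamma> s $$ (i, j)) \<in> polynomial_functions {\<lambda>s. s}" if "i < N" "j < d" for i j
    proof (cases "i < d")
      case True
      then show ?thesis
        using that polynomial_pathD(2)[OF polynomial_path_line[OF pivot_mat_carrier A(1)] that] by (simp add: \<gamma>_def line_def)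
    next
      case False
      then show ?thesis using that polynomial_pathD(2)[OF pL, of "i - d" j] by (simp add: \<gamma>_def)
    qed
    have low\<gamma>: "lower_block d (\<gamma> s) = L s" for s
      using polynomial_pathD(1)[OF pL, of s] by (intro eq_matI) (auto simp: lower_block_def \<gamma>_def)
    have at0: "\<gamma> 0 = pivot_mat"
    proof (rule eq_matI)
      fix i j assume "i < dim_row pivot_mat" "j < dim_col pivot_mat"
      then have ij: "i < N" "j < d" using pivot_mat_carrier by auto
      have "L 0 = lower_block d pivot_mat"
        unfolding L_def XY0(3) using XY0(1,2) by (intro arg_cong2[of _ _ _ _ "(*)"] eq_matI) (auto simp: line_def)
      then show "\<gamma> 0 $$ (i, j) = pivot_mat $$ (i, j)"
        using ij pivot_mat_carrier by (auto simp: \<gamma>_def line_def lower_block_def)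
    qed (use pivot_mat_carrier in \<open>auto simp: \<gamma>_def\<close>)
    have at1: "\<gamma> 1 = A"
    proof (rule eq_matI)
      fix i j assume "i < dim_row A" "j < dim_col A"
      then have ij: "i < N" "j < d" using A by auto
      have "L 1 = lower_block d A"
        unfolding L_def XY(3) using XY(1,2) by (intro arg_cong2[of _ _ _ _ "(*)"] eq_matI) (auto simp: line_def)
      then show "\<gamma> 1 $$ (i, j) = A $$ (i, j)"
        using ij A by (auto simp: \<gamma>_def line_def lower_block_def)
    qed (use A in \<open>auto simp: \<gamma>_def\<close>)
    let ?\<delta> = "\<lambda>s. det (mat d d (\<lambda>(i, j). \<gamma> s $$ (pivot i, j)))"
    have "F (pluecker (\<gamma> 1)) = 0"
    proof (rule polynomial_functions_line_eq_zero[where f = "\<lambda>s. F (pluecker (\<gamma> s))" and \<delta> = ?\<delta> and s\<^sub>0 = 0])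
      show "(\<lambda>s. F (pluecker (\<gamma> s))) \<in> polynomial_functions {\<lambda>s. s}"
      proof (rule polynomial_functions_compose[where h = "\<lambda>s. pluecker (\<gamma> s)"
            and X = "(\<lambda>I p. p I) ` pluecker_indices d N"])
        show "F \<in> polynomial_functions ((\<lambda>I p. p I) ` pluecker_indices d N)"
          using F by (simp add: homogeneous_polynomials_def)
        fix x :: "(nat set \<Rightarrow> complex) \<Rightarrow> complex" assume "x \<in> (\<lambda>I p. p I) ` pluecker_indices d N"
        then obtain I where I: "I \<in> pluecker_indices d N" "x = (\<lambda>p. p I)" by (elim imageE) simp
        have fin: "finite I" "card I = d" "I \<subseteq> {..<N}"
          using I(1) by (auto simp: pluecker_indices_def intro: finite_subset)
        have "pick I i < N" if "i < d" for i
          using bij_betw_apply[OF bij_betw_pick[OF fin(1)], of i] that fin by auto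
        then have "(\<lambda>s. det (mat d d (\<lambda>(i, j). \<gamma> s $$ (pick I i, j)))) \<in> polynomial_functions {\<lambda>s. s}"
          by (intro polynomial_functions_det[of _ d]) (auto intro: p\<gamma>)
        then show "(\<lambda>s. x (pluecker (\<gamma> s))) \<in> polynomial_functions {\<lambda>s. s}"
          using submatrix_pluecker_index[OF \<gamma> I(1)] by (simp add: I(2) pluecker_def)
      qed
      show "?\<delta> \<in> polynomial_functions {\<lambda>s. s}"
        by (intro polynomial_functions_det[of _ d]) (auto intro: p\<gamma> pivot_less)
      have "mat d d (\<lambda>(i, j). \<gamma> 0 $$ (pivot i, j)) = 1\<^sub>m d"
        unfolding at0 using pivot_less pivot_eq_iff by (intro eq_matI) (auto simp: pivot_mat_def)
      then show "?\<delta> 0 \<noteq> 0" by simp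
      fix s assume s: "?\<delta> s \<noteq> 0"
      have "lower_block d (\<gamma> s) \<in> rank_variety (N - d) d t"
        unfolding low\<gamma> L_def rank_variety_iff_factor
        by (intro bexI[of _ "line (N - d) t X\<^sub>0 X s"] bexI[of _ "line t d Y\<^sub>0 Y s"]) (auto simp: line_def)
      from generic_point_in_borel_orbit[OF \<gamma> this s]
      obtain b where b: "b \<in> borel N" "vec_space.col_space N (\<gamma> s) = translate b (vec_space.col_space N pivot_mat)"
        by (elim bexE)
      show "F (pluecker (\<gamma> s)) = 0"
        using van[OF b(1)] b(2) \<gamma> by (simp add: vanishes_at_def coordinate_subspace_word)
    qed
    then show "F (pluecker A) = 0" by (simp only: at1)
  qed
  ultimately show "W \<in> schubert_variety N word"
    unfolding schubert_variety_def zariski_closure_def length_word by auto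
qed

theorem schubert_variety_eq: "schubert_variety N word = rank_locus"
  using schubert_subset_rank_locus rank_locus_subset_schubert by (rule equalityI)

end

section \<open>The Levi subgroup\<close>

context schubert_rank
begin

lemma translate_rank_locus_subset:
  assumes g: "g \<in> carrier_mat N N" "det g \<noteq> 0" "block_upper d g"
  shows "translate g ` rank_locus \<subseteq> rank_locus"
proof
  fix W assume "W \<in> translate g ` rank_locus"
  then obtain A where A: "A \<in> carrier_mat N d" "vec_space.rank N A = d"
    "lower_block d A \<in> rank_variety (N - d) d t" "W = translate g (vec_space.col_space N A)"
    by (auto simp: rank_locus_def)
  obtain h where h: "h \<in> carrier_mat N N" "h * g = 1\<^sub>m N" by (rule det_nonzero_inverse[OF g(1,2)])
  have gA: "g * A \<in> carrier_mat N d" using g A by simp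
  have "lower_block d (g * A * 1\<^sub>m d) \<in> rank_variety (N - d) d t"
    using dN by (intro lower_block_mult_rank_variety[OF g(1,3) A(1) one_carrier_mat _ A(3)]) simp
  then have "lower_block d (g * A) \<in> rank_variety (N - d) d t"
    unfolding right_mult_one_mat[OF gA] .
  moreover have "vec_space.rank N (g * A) = d"
    using rank_mult_invertible[OF g(1) h A(1)] A(2) by simp
  ultimately show "W \<in> rank_locus"
    unfolding A(4) translate_col_space[OF g(1) A(1)] col_space_mem_rank_locus[OF gA] by simp
qed

lemma rank_locus_subset_carrier: "W \<in> rank_locus \<Longrightarrow> W \<subseteq> carrier_vec N"
  unfolding rank_locus_def using vec_space.col_space_carrier by auto

lemma translate_inverse:
  assumes "g \<in> carrier_mat N N" "h \<in> carrier_mat N N" "g * h = 1\<^sub>m N" "W \<subseteq> carrier_vec N"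
  shows "translate g (translate h W) = W"
proof -
  have "g *\<^sub>v (h *\<^sub>v v) = v" if "v \<in> W" for v
    using assoc_mult_mat_vec[OF assms(1,2), of v] assms(3,4) that by auto
  then show ?thesis unfolding translate_def by (force simp: image_image)
qed

lemma block_upper_in_stabilizer:
  assumes g: "g \<in> carrier (GL N)" "block_upper d g"
  shows "g \<in> schubert_stabilizer N word"
proof -
  have gN: "g \<in> carrier_mat N N" "det g \<noteq> 0" using g by (simp_all add: GL_iff)
  obtain h where h: "h \<in> carrier_mat N N" "g * h = 1\<^sub>m N" "h * g = 1\<^sub>m N" "det h \<noteq> 0"
    by (rule det_nonzero_inverse[OF gN])
  have bh: "block_upper d h" using dN by (intro block_upper_inverse[OF gN(1) g(2) h(1,2)]) simp
  have "rank_locus \<subseteq> translate g ` rank_locus"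
  proof
    fix W assume W: "W \<in> rank_locus"
    have "translate h W \<in> rank_locus" using translate_rank_locus_subset[OF h(1,4) bh] W by blast
    moreover have "W = translate g (translate h W)"
      using translate_inverse[OF gN(1) h(1,2) rank_locus_subset_carrier[OF W]] ..
    ultimately show "W \<in> translate g ` rank_locus" by (rule rev_image_eqI)
  qed
  then have "translate g ` rank_locus = rank_locus"
    using translate_rank_locus_subset[OF gN g(2)] by (intro equalityI)
  then show ?thesis using g(1) by (simp add: schubert_stabilizer_def schubert_variety_eq)
qed

text \<open>Suppose that the entry \<open>(k, l)\<close> of \<open>g\<close> with \<open>k \<ge> d > l\<close> is nonzero. Let \<open>E\<close> have the single entry \<open>s\<close>, in
row \<open>l\<close> and column 0. Then \<open>p = 1 + E * g\<close> is block upper triangular, since \<open>E * g\<close> is concentrated in row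
\<open>l\<close>. Therefore \<open>q = g * p * g\<^sup>-\<^sup>1 = 1 + g * E\<close> stabilizes the variety; it adds \<open>s\<close> times column \<open>l\<close> of \<open>g\<close> to the
zeroth unit vector. Applied to the coordinate subspace spanned by \<open>d - t\<close> upper unit vectors, including
the zeroth, and \<open>t\<close> lower unit vectors different from the \<open>k\<close>-th, it produces \<open>t + 1\<close> independent lower
rows.\<close>

lemma stabilizer_block_upper:
  assumes g: "g \<in> schubert_stabilizer N word"
  shows "block_upper d g"
proof (rule ccontr)
  assume "\<not> block_upper d g"
  have gN: "g \<in> carrier_mat N N" "det g \<noteq> 0" and inv: "translate g ` rank_locus = rank_locus"
    using g by (simp_all add: schubert_stabilizer_def GL_iff schubert_variety_eq)
  obtain k l where kl: "k < N" "d \<le> k" "l < d" "g $$ (k, l) \<noteq> 0"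
    using \<open>\<not> block_upper d g\<close> gN(1) by (auto simp: block_upper_def)
  obtain h where h: "h \<in> carrier_mat N N" "g * h = 1\<^sub>m N" "h * g = 1\<^sub>m N" "det h \<noteq> 0"
    by (rule det_nonzero_inverse[OF gN])
  \<comment> \<open>This choice makes \<open>det q = 1 + s * g $$ (0, l)\<close> nonzero.\<close>
  define s :: complex where "s = (if g $$ (0, l) = -1 then 2 else 1)"
  have s: "s \<noteq> 0" "1 + s * g $$ (0, l) \<noteq> 0" by (auto simp: s_def add_eq_0_iff)
  define q where "q = mat N N (\<lambda>(i, j). (if i = j then 1 else 0) + (if j = 0 then s * g $$ (i, l) else 0))"
  have q: "q \<in> carrier_mat N N" by (simp add: q_def)
  have "det q = prod_list (diag_mat q)"
    by (rule det_lower_triangular[OF _ q]) (auto simp: q_def)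
  also have "\<dots> \<noteq> 0" using s(2) by (auto simp: diag_mat_def prod_list_zero_iff q_def split: if_splits)
  finally have detq: "det q \<noteq> 0" .
  define E where "E = mat N N (\<lambda>(i, j). if i = l \<and> j = 0 then s else 0)"
  have E: "E \<in> carrier_mat N N" by (simp add: E_def)
  have gE: "(g * E) $$ (i, j) = (if j = 0 then s * g $$ (i, l) else 0)" if "i < N" "j < N" for i j
  proof -
    have "(g * E) $$ (i, j) = (\<Sum>c\<in>{0..<N}. g $$ (i, c) * E $$ (c, j))"
      using that gN(1) E by (simp add: scalar_prod_def)
    also have "\<dots> = (\<Sum>c\<in>{0..<N}. if c = l then (if j = 0 then s * g $$ (i, c) else 0) else 0)"
      using that by (intro sum.cong) (auto simp: E_def)
    also have "\<dots> = (if j = 0 then s * g $$ (i, l) else 0)" using kl dN by simp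
    finally show ?thesis .
  qed
  have qE: "q = 1\<^sub>m N + g * E"
    using gN E by (intro eq_matI) (auto simp: q_def gE simp del: index_mult_mat(1))
  define p where "p = h * q * g"
  have p: "p \<in> carrier_mat N N" using h q gN by (simp add: p_def)
  have "p = 1\<^sub>m N + E * g"
  proof -
    have "h * q = h + E"
      unfolding qE using h E gN mult_add_distrib_mat[OF h(1) one_carrier_mat mult_carrier_mat[OF gN(1) E]]
        assoc_mult_mat[OF h(1) gN(1) E] by simp
    then show ?thesis unfolding p_def using add_mult_distrib_mat[OF h(1) E gN(1)] h(3) by simp
  qed
  moreover have "(E * g) $$ (i, j) = 0" if "i < N" "j < N" "i \<noteq> l" for i j
    using that gN(1) E by (auto simp: scalar_prod_def E_def intro!: sum.neutral)
  ultimately have "block_upper d p"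
    using p kl E gN unfolding block_upper_def by (auto simp del: index_mult_mat(1))
  have "det p = det h * det q * det g"
    unfolding p_def using det_mult[OF mult_carrier_mat[OF h(1) q] gN(1)] det_mult[OF h(1) q] by simp
  then have "det p \<noteq> 0" using detq h(4) gN(2) by simp
  note p_inv = translate_rank_locus_subset[OF p this \<open>block_upper d p\<close>]
  \<comment> \<open>The indices \<open>d, d + 1, \<dots>\<close> with \<open>k\<close> left out.\<close>
  define \<kappa> where "\<kappa> j = (let c = d + (j - (d - t)) in if c < k then c else c + 1)" for j
  have \<kappa>: "\<kappa> j < N" "d \<le> \<kappa> j" "\<kappa> j \<noteq> k" if "j < d" "d - t \<le> j" for j
    using that td tN by (auto simp: \<kappa>_def Let_def)
  have \<kappa>_inj: "\<kappa> i = \<kappa> j \<longleftrightarrow> i = j" if "d - t \<le> i" "d - t \<le> j" for i j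
    using that by (auto simp: \<kappa>_def Let_def split: if_splits)
  define u where "u j = (if j < d - t then j else \<kappa> j)" for j
  have u: "u j < N" if "j < d" for j using that \<kappa>(1) dN by (auto simp: u_def)
  have u_inj: "u i = u j \<longleftrightarrow> i = j" if "i < d" "j < d" for i j
    using that \<kappa>(2)[of i] \<kappa>(2)[of j] \<kappa>_inj[of i j] by (auto simp: u_def)
  define A where "A = mat N d (\<lambda>(i, j). if i = u j then 1 else 0 :: complex)"
  have A: "A \<in> carrier_mat N d" by (simp add: A_def)
  have AA: "transpose_mat A * A = 1\<^sub>m d"
  proof (rule eq_matI)
    fix i j assume "i < dim_row (1\<^sub>m d :: complex mat)" "j < dim_col (1\<^sub>m d :: complex mat)"
    then have ij: "i < d" "j < d" by auto
    then have "(transpose_mat A * A) $$ (i, j) = (\<Sum>c\<in>{0..<N}. A $$ (c, i) * A $$ (c, j))"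
      using A by (simp add: scalar_prod_def)
    also have "\<dots> = (\<Sum>c\<in>{0..<N}. if c = u i then (if i = j then 1 else 0) else 0)"
      using ij u_inj[OF ij] by (intro sum.cong) (auto simp: A_def)
    also have "\<dots> = 1\<^sub>m d $$ (i, j)" using ij u[OF ij(1)] by simp
    finally show "(transpose_mat A * A) $$ (i, j) = 1\<^sub>m d $$ (i, j)" .
  qed (use A in auto)
  have rankA: "vec_space.rank N A = d"
  proof (rule antisym[OF vec_space.rank_le_nc[OF A]])
    have At: "transpose_mat A \<in> carrier_mat d N" using A by simp
    obtain X Y where XY: "X \<in> carrier_mat N (vec_space.rank N A)" "Y \<in> carrier_mat (vec_space.rank N A) d" "A = X * Y"
      using vec_space.rank_le_iff_factor[OF A, of "vec_space.rank N A"] by auto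
    have "1\<^sub>m d = (transpose_mat A * X) * Y"
      using AA assoc_mult_mat[OF At XY(1,2)] XY(3) by simp
    moreover have "transpose_mat A * X \<in> carrier_mat d (vec_space.rank N A)" using At XY(1) by simp
    ultimately have "1\<^sub>m d \<in> rank_variety d d (vec_space.rank N A)"
      unfolding rank_variety_iff_factor by (intro bexI[of _ "transpose_mat A * X"] bexI[of _ Y] XY(2))
    moreover have "rows_independent (1\<^sub>m d) {..<d}"
    proof -
      have "mat d d (\<lambda>(i, j). (1\<^sub>m d :: complex mat) $$ (i, j)) = 1\<^sub>m d" by (intro eq_matI) auto
      then show ?thesis using rows_independent_iff_det[OF one_carrier_mat, of id d "{..<d}"] by simp
    qed
    ultimately have "card {..<d} \<le> vec_space.rank N A" by (intro rank_variety_card_rows[of _ d d]) auto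
    then show "d \<le> vec_space.rank N A" by simp
  qed
  have "lower_block d A \<in> rank_variety (N - d) d t"
    by (rule rank_variety_zero_columns) (use td in \<open>auto simp: lower_block_def A_def u_def\<close>)
  then have "vec_space.col_space N A \<in> rank_locus" using col_space_mem_rank_locus[OF A] rankA by simp
  then have "vec_space.col_space N A \<in> translate g ` rank_locus" by (simp only: inv)
  then obtain W where W: "W \<in> rank_locus" "vec_space.col_space N A = translate g W" by (elim imageE)
  have hg: "translate h (vec_space.col_space N A) = W"
    unfolding W(2) by (rule translate_inverse[OF h(1) gN(1) h(3) rank_locus_subset_carrier[OF W(1)]])
  have hA: "h * A \<in> carrier_mat N d" and phA: "p * (h * A) \<in> carrier_mat N d" using h p A by auto
  have "translate g (translate p (translate h (vec_space.col_space N A))) \<in> rank_locus"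
    unfolding hg using p_inv inv W(1) by blast
  also have "translate g (translate p (translate h (vec_space.col_space N A)))
      = vec_space.col_space N (g * (p * (h * A)))"
    unfolding translate_col_space[OF h(1) A] translate_col_space[OF p hA] translate_col_space[OF gN(1) phA] ..
  also have "g * (p * (h * A)) = q * A"
  proof -
    have "g * p = q * g"
      unfolding p_def using assoc_mult_mat[OF gN(1) mult_carrier_mat[OF h(1) q] gN(1)]
        assoc_mult_mat[OF gN(1) h(1) q] h(2) q by simp
    then have "g * (p * (h * A)) = q * g * (h * A)" using assoc_mult_mat[OF gN(1) p hA] by simp
    also have "\<dots> = q * (g * (h * A))" by (rule assoc_mult_mat[OF q gN(1) hA])
    also have "g * (h * A) = A" using assoc_mult_mat[OF gN(1) h(1) A] h(2) A by simp
    finally show ?thesis .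
  qed
  finally have low: "lower_block d (q * A) \<in> rank_variety (N - d) d t"
    using col_space_mem_rank_locus[OF mult_carrier_mat[OF q A]] by simp
  have qA: "(q * A) $$ (i, j) = (if i = u j then 1 else 0) + (if j = 0 then s * g $$ (i, l) else 0)"
    if ij: "i < N" "j < d" for i j
  proof -
    have "(q * A) $$ (i, j) = (\<Sum>c\<in>{0..<N}. q $$ (i, c) * A $$ (c, j))"
      using ij q A by (simp add: scalar_prod_def)
    also have "\<dots> = (\<Sum>c\<in>{0..<N}. if c = u j then q $$ (i, c) else 0)"
      using ij by (intro sum.cong) (auto simp: A_def)
    also have "\<dots> = q $$ (i, u j)" using u[OF ij(2)] by simp
    also have "\<dots> = (if i = u j then 1 else 0) + (if j = 0 then s * g $$ (i, l) else 0)"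
      using ij u[OF ij(2)] u[of 0] u_inj[of j 0] td by (auto simp: q_def u_def)
    finally show ?thesis .
  qed
  define K where "K = insert k (\<kappa> ` {d - t..<d})"
  have K: "K \<subseteq> {..<N}" "\<And>i. i \<in> K \<Longrightarrow> d \<le> i" using kl \<kappa> by (auto simp: K_def)
  have inj\<kappa>: "inj_on \<kappa> {d - t..<d}" using \<kappa>_inj by (auto simp: inj_on_def)
  have kK: "k \<notin> \<kappa> ` {d - t..<d}"
  proof
    assume "k \<in> \<kappa> ` {d - t..<d}"
    then obtain j where "k = \<kappa> j" "d - t \<le> j" "j < d" by auto
    then show False using \<kappa>(3)[of j] by simp
  qed
  have cardK: "card K = t + 1"
    unfolding K_def using kK inj\<kappa> td by (simp add: card_image)
  have "rows_independent (q * A) K"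
    unfolding rows_independent_def
  proof (intro allI impI)
    fix c assume "\<forall>j<dim_col (q * A). (\<Sum>i\<in>K. c i * (q * A) $$ (i, j)) = 0"
    then have c: "(\<Sum>i\<in>K. c i * (q * A) $$ (i, j)) = 0" if "j < d" for j using that A by simp
    have finK: "finite K" by (simp add: K_def)
    have c\<kappa>: "c (\<kappa> j) = 0" if j: "j \<in> {d - t..<d}" for j
    proof -
      have v: "(q * A) $$ (i, j) = (if i = \<kappa> j then 1 else 0)" if "i \<in> K" for i
      proof -
        have ij: "i < N" "j < d" "j \<noteq> 0" "u j = \<kappa> j" using that K(1) j td by (auto simp: u_def)
        show ?thesis unfolding qA[OF ij(1,2)] using ij by simp
      qed
      have "(\<Sum>i\<in>K. c i * (q * A) $$ (i, j)) = (\<Sum>i\<in>K. if i = \<kappa> j then c i else 0)"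
        by (rule sum.cong[OF refl]) (simp only: v, simp)
      also have "\<dots> = c (\<kappa> j)" using finK j by (simp add: K_def)
      finally show ?thesis using c[of j] j by simp
    qed
    have "c k = 0"
    proof -
      have "(\<Sum>i\<in>K. c i * (q * A) $$ (i, 0)) = (\<Sum>i\<in>K. if i = k then c i * (q * A) $$ (i, 0) else 0)"
        by (rule sum.cong[OF refl]) (use c\<kappa> in \<open>auto simp: K_def\<close>)
      also have "\<dots> = c k * (q * A) $$ (k, 0)" using finK by (simp add: K_def)
      also have "(q * A) $$ (k, 0) = s * g $$ (k, l)"
        using qA[of k 0] kl td by (simp add: u_def del: index_mult_mat(1))
      finally show ?thesis using c[of 0] td s(1) kl(4) by simp
    qed
    then show "\<forall>i\<in>K. c i = 0" using c\<kappa> by (auto simp: K_def)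
  qed
  moreover have "K = (\<lambda>i. i + d) ` ((\<lambda>i. i - d) ` K)" 
  proof -
    have "(\<lambda>i. i + d) ` ((\<lambda>i. i - d) ` K) = (\<lambda>i. i) ` K"
      unfolding image_image using K(2) by (intro image_cong) auto
    then show ?thesis by simp
  qed
  moreover have K': "(\<lambda>i. i - d) ` K \<subseteq> {..<N - d}"
  proof (rule image_subsetI)
    fix i assume "i \<in> K"
    then have "i < N" "d \<le> i" using K by auto
    then show "i - d \<in> {..<N - d}" by simp
  qed
  ultimately have "rows_independent (lower_block d (q * A)) ((\<lambda>i. i - d) ` K)"
    using rows_independent_lower_block[OF mult_carrier_mat[OF q A] K'] by simp
  then have "card ((\<lambda>i. i - d) ` K) \<le> t" by (rule rank_variety_card_rows[OF low K'])
  moreover have "inj_on (\<lambda>i. i - d) K"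
    using K(2) by (intro inj_onI) (metis le_add_diff_inverse2)
  ultimately show False using cardK by (simp add: card_image)
qed

theorem levi_eq:
  "levi N word = {g \<in> carrier (GL N). block_upper d g \<and> block_upper d (transpose_mat g)}"
proof (intro equalityI subsetI)
  fix g assume "g \<in> levi N word"
  then have "g \<in> schubert_stabilizer N word" "transpose_mat g \<in> schubert_stabilizer N word"
    by (simp_all add: levi_def)
  then show "g \<in> {g \<in> carrier (GL N). block_upper d g \<and> block_upper d (transpose_mat g)}"
    using stabilizer_block_upper by (simp add: schubert_stabilizer_def)
next
  fix g assume g: "g \<in> {g \<in> carrier (GL N). block_upper d g \<and> block_upper d (transpose_mat g)}"
  then have "transpose_mat g \<in> carrier (GL N)" by (simp add: GL_iff det_transpose[of g N])
  then show "g \<in> levi N word" using g block_upper_in_stabilizer by (simp add: levi_def)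
qed

end

section \<open>The action on the opposite big cell\<close>

lemma mult_mat_entry:
  assumes "A \<in> carrier_mat k l" "B \<in> carrier_mat l r" "i < k" "j < r"
  shows "(A * B) $$ (i, j) = (\<Sum>c\<in>{0..<l}. A $$ (i, c) * B $$ (c, j))"
  using assms by (simp add: scalar_prod_def)

lemma mult_mat_lower_right_block:
  assumes g: "g \<in> carrier_mat N N" "block_upper d g" and h: "h \<in> carrier_mat N N" and d: "d \<le> N"
  shows "mat (N - d) (N - d) (\<lambda>(i, j). g $$ (i + d, j + d)) * mat (N - d) (N - d) (\<lambda>(i, j). h $$ (i + d, j + d))
    = mat (N - d) (N - d) (\<lambda>(i, j). (g * h) $$ (i + d, j + d))" (is "?G * ?H = ?GH")
proof (rule eq_matI)
  fix i j assume "i < dim_row ?GH" "j < dim_col ?GH"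
  then have ij: "i < N - d" "j < N - d" by auto
  have "(?G * ?H) $$ (i, j) = (?G * lower_block d h) $$ (i, j + d)"
    using ij h by (auto simp: scalar_prod_def lower_block_def intro!: sum.cong)
  also have "\<dots> = lower_block d (g * h) $$ (i, j + d)" by (simp only: lower_block_mult_left[OF g h d])
  also have "\<dots> = (g * h) $$ (i + d, j + d)" using ij g h by (simp add: lower_block_def del: index_mult_mat(1))
  finally show "(?G * ?H) $$ (i, j) = ?GH $$ (i, j)" using ij by (simp del: index_mult_mat(1))
qed auto

context schubert_rank
begin

abbreviation "m \<equiv> N - d"

definition upper_left :: "complex mat \<Rightarrow> complex mat" where
  "upper_left g = mat d d (\<lambda>ij. g $$ ij)"

definition lower_right :: "complex mat \<Rightarrow> complex mat" where
  "lower_right g = mat m m (\<lambda>(i, j). g $$ (i + d, j + d))"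

lemma upper_left_carrier: "upper_left g \<in> carrier_mat d d" by (simp add: upper_left_def)

lemma lower_right_carrier: "lower_right g \<in> carrier_mat m m" by (simp add: lower_right_def)

lemma lower_right_mult:
  assumes "g \<in> carrier_mat N N" "block_upper d g" "h \<in> carrier_mat N N"
  shows "lower_right g * lower_right h = lower_right (g * h)"
  unfolding lower_right_def using dN by (intro mult_mat_lower_right_block[OF assms]) simp

lemma mult_entry_upper:
  assumes h: "h \<in> carrier_mat N N" "block_upper d (transpose_mat h)" and X: "X \<in> carrier_mat N k"
    and ij: "i < d" "j < k"
  shows "(h * X) $$ (i, j) = (\<Sum>c\<in>{0..<d}. h $$ (i, c) * X $$ (c, j))"
proof -
  have iN: "i < N" using ij dN by simp
  have "(h * X) $$ (i, j) = (\<Sum>c\<in>{0..<N}. h $$ (i, c) * X $$ (c, j))"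
    using iN ij h X by (simp add: scalar_prod_def)
  also have "\<dots> = (\<Sum>c\<in>{0..<d}. h $$ (i, c) * X $$ (c, j))"
  proof (rule sum.mono_neutral_right)
    show "\<forall>c\<in>{0..<N} - {0..<d}. h $$ (i, c) * X $$ (c, j) = 0"
    proof
      fix c assume "c \<in> {0..<N} - {0..<d}"
      then have "transpose_mat h $$ (c, i) = 0" "c < N" using h ij by (auto simp: block_upper_def)
      then show "h $$ (i, c) * X $$ (c, j) = 0" using h iN by simp
    qed
  qed (use dN in auto)
  finally show ?thesis .
qed

lemma upper_left_mult:
  assumes h: "h \<in> carrier_mat N N" "block_upper d (transpose_mat h)" and g: "g \<in> carrier_mat N N"
  shows "upper_left h * upper_left g = upper_left (h * g)"
proof (rule eq_matI)
  fix i j assume "i < dim_row (upper_left (h * g))" "j < dim_col (upper_left (h * g))"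
  then have ij: "i < d" "j < d" by (auto simp: upper_left_def)
  have "(h * g) $$ (i, j) = (\<Sum>c\<in>{0..<d}. h $$ (i, c) * g $$ (c, j))"
    using ij dN by (intro mult_entry_upper[OF h g]) auto
  also have "\<dots> = (upper_left h * upper_left g) $$ (i, j)"
    using ij by (simp add: upper_left_def scalar_prod_def)
  finally show "(upper_left h * upper_left g) $$ (i, j) = upper_left (h * g) $$ (i, j)"
    using ij by (simp add: upper_left_def del: index_mult_mat(1))
qed (auto simp: upper_left_def)

lemma cell_matrix_carrier: "A \<in> carrier_mat m d \<Longrightarrow> 1\<^sub>m d @\<^sub>r A \<in> carrier_mat N d"
  using carrier_append_rows[of "1\<^sub>m d" d d A m] dN by simp

lemma cell_matrix_entry:
  assumes "A \<in> carrier_mat m d" "i < N" "j < d"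
  shows "(1\<^sub>m d @\<^sub>r A) $$ (i, j) = (if i < d then if i = j then 1 else 0 else A $$ (i - d, j))"
  using assms dN by (auto simp: append_rows_def)

lemma lower_block_cell_matrix: "A \<in> carrier_mat m d \<Longrightarrow> lower_block d (1\<^sub>m d @\<^sub>r A) = A"
  using cell_matrix_carrier[of A] by (intro eq_matI) (auto simp: lower_block_def cell_matrix_entry)

lemma eq_cell_matrixI:
  assumes X: "X \<in> carrier_mat N d" and up: "\<And>i j. i < d \<Longrightarrow> j < d \<Longrightarrow> X $$ (i, j) = (if i = j then 1 else 0)"
  shows "X = 1\<^sub>m d @\<^sub>r lower_block d X"
proof -
  have L: "lower_block d X \<in> carrier_mat m d" by (rule lower_block_carrier[OF X])
  show ?thesis
  proof (rule eq_matI)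
    fix i j assume "i < dim_row (1\<^sub>m d @\<^sub>r lower_block d X)" "j < dim_col (1\<^sub>m d @\<^sub>r lower_block d X)"
    then have ij: "i < N" "j < d" using cell_matrix_carrier[OF L] by auto
    then show "X $$ (i, j) = (1\<^sub>m d @\<^sub>r lower_block d X) $$ (i, j)"
      unfolding cell_matrix_entry[OF L ij] using up[of i j] X by (auto simp: lower_block_def)
  qed (use X cell_matrix_carrier[OF L] in auto)
qed

lemma cell_point_inj:
  assumes A: "A \<in> carrier_mat m d" and B: "B \<in> carrier_mat m d" and eq: "cell_point d N A = cell_point d N B"
  shows "A = B"
proof -
  note c = cell_matrix_carrier[OF A] cell_matrix_carrier[OF B]
  obtain K where K: "K \<in> carrier_mat d d" "1\<^sub>m d @\<^sub>r A = (1\<^sub>m d @\<^sub>r B) * K"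
    using vec_space.factor_through_col_space[OF c] eq by (auto simp: cell_point_def)
  have "K = 1\<^sub>m d"
  proof (rule eq_matI)
    fix i j assume "i < dim_row (1\<^sub>m d :: complex mat)" "j < dim_col (1\<^sub>m d :: complex mat)"
    then have ij: "i < d" "j < d" "i < N" using dN by auto
    have "1\<^sub>m d $$ (i, j) = ((1\<^sub>m d @\<^sub>r B) * K) $$ (i, j)"
      unfolding K(2)[symmetric] using cell_matrix_entry[OF A ij(3,2)] ij by simp
    also have "\<dots> = (\<Sum>c\<in>{0..<d}. (1\<^sub>m d @\<^sub>r B) $$ (i, c) * K $$ (c, j))"
      using ij K(1) c(2) by (simp add: scalar_prod_def)
    also have "\<dots> = (\<Sum>c\<in>{0..<d}. if c = i then K $$ (c, j) else 0)"
      using ij cell_matrix_entry[OF B ij(3)] by (intro sum.cong) auto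
    finally show "K $$ (i, j) = 1\<^sub>m d $$ (i, j)" using ij by simp
  qed (use K in auto)
  then have "1\<^sub>m d @\<^sub>r A = 1\<^sub>m d @\<^sub>r B" using K(2) c(2) by simp
  then have "lower_block d (1\<^sub>m d @\<^sub>r A) = lower_block d (1\<^sub>m d @\<^sub>r B)" by simp
  then show ?thesis by (simp only: lower_block_cell_matrix[OF A] lower_block_cell_matrix[OF B])
qed

text \<open>Multiplying \<open>h * (1\<^sub>m d @\<^sub>r A)\<close> from the right by \<open>C\<close>, the inverse of the upper left block of \<open>h\<close>, restores the
identity in the upper block without changing the column space.\<close>

lemma cell_action_eq:
  assumes h: "h \<in> carrier_mat N N" "block_upper d h" "block_upper d (transpose_mat h)"
    and C: "C \<in> carrier_mat d d" "upper_left h * C = 1\<^sub>m d" and A: "A \<in> carrier_mat m d"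
  shows "cell_action d N h A = lower_right h * A * C"
proof -
  let ?P = "1\<^sub>m d @\<^sub>r A" and ?A' = "lower_right h * A * C"
  have P: "?P \<in> carrier_mat N d" by (rule cell_matrix_carrier[OF A])
  have A': "?A' \<in> carrier_mat m d"
    by (rule mult_carrier_mat[OF mult_carrier_mat[OF lower_right_carrier A] C(1)])
  have hP: "h * ?P \<in> carrier_mat N d" by (rule mult_carrier_mat[OF h(1) P])
  have hPC: "h * ?P * C \<in> carrier_mat N d" by (rule mult_carrier_mat[OF hP C(1)])
  have low: "lower_block d (h * ?P * C) = ?A'"
    using lower_block_mult_right[OF hP C(1)] lower_block_mult_left[OF h(1,2) P] dN lower_block_cell_matrix[OF A]
    by (simp add: lower_right_def)
  have "(h * ?P) $$ (i, j) = h $$ (i, j)" if ij: "i < d" "j < d" for i j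
  proof -
    have "(h * ?P) $$ (i, j) = (\<Sum>c\<in>{0..<d}. h $$ (i, c) * ?P $$ (c, j))"
      by (rule mult_entry_upper[OF h(1,3) P ij])
    also have "\<dots> = (\<Sum>c\<in>{0..<d}. if c = j then h $$ (i, c) else 0)"
      using ij dN cell_matrix_entry[OF A _ ij(2)] by (intro sum.cong) auto
    finally show ?thesis using ij by simp
  qed
  note up = this
  have "h * ?P * C = 1\<^sub>m d @\<^sub>r lower_block d (h * ?P * C)"
  proof (rule eq_cell_matrixI[OF hPC])
    fix i j assume ij: "i < d" "j < d"
    have "(h * ?P * C) $$ (i, j) = (\<Sum>c\<in>{0..<d}. (h * ?P) $$ (i, c) * C $$ (c, j))"
      by (rule mult_mat_entry[OF hP C(1)]) (use ij dN in simp_all)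
    also have "\<dots> = (\<Sum>c\<in>{0..<d}. h $$ (i, c) * C $$ (c, j))" using up ij by (intro sum.cong) auto
    also have "\<dots> = (upper_left h * C) $$ (i, j)" using ij C(1) by (simp add: upper_left_def scalar_prod_def)
    finally show "(h * ?P * C) $$ (i, j) = (if i = j then 1 else 0)" using C(2) ij by simp
  qed
  then have eq: "h * ?P * C = 1\<^sub>m d @\<^sub>r ?A'" by (simp only: low)
  have "C * upper_left h = 1\<^sub>m d" by (rule mat_mult_left_right_inverse[OF upper_left_carrier C])
  then have "vec_space.col_space N (h * ?P * C) = vec_space.col_space N (h * ?P)"
    by (intro col_space_mult_invertible[OF hP C(1) upper_left_carrier])
  then have "cell_point d N ?A' = translate h (cell_point d N A)"
    unfolding cell_point_def translate_col_space[OF h(1) P] eq .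
  then show ?thesis unfolding cell_action_def
    by (intro the_equality) (use A' cell_point_inj in auto)
qed

lemma determinantal_variety_eq: "determinantal_variety d N t = rank_variety m d t"
  by (simp add: determinantal_variety_def rank_variety_def)

lemma function_action_eq:
  assumes g: "g \<in> levi N word" and h: "h \<in> carrier_mat N N" "h * g = 1\<^sub>m N"
  shows "function_action d N (rank_variety m d t) g = two_sided (rank_variety m d t) (lower_right h) (upper_left g)"
    and "(lower_right h, upper_left g) \<in> rank_ring.GL_pairs m d"
proof -
  have gG: "g \<in> carrier (GL N)" and gb: "block_upper d g" "block_upper d (transpose_mat g)"
    using g unfolding levi_eq by simp_all
  have gN: "g \<in> carrier_mat N N" using gG by (simp add: GL_iff)
  have gh: "g * h = 1\<^sub>m N" by (rule mat_mult_left_right_inverse[OF h(1) gN h(2)])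
  have hb: "block_upper d h" using dN by (intro block_upper_inverse[OF gN gb(1) h(1) gh]) simp
  have "transpose_mat g * transpose_mat h = 1\<^sub>m N"
    using transpose_mult[OF h(1) gN] h(2) by simp
  then have hbT: "block_upper d (transpose_mat h)"
    using dN gN h(1) by (intro block_upper_inverse[OF _ gb(2)]) auto
  have ul: "upper_left h * upper_left g = 1\<^sub>m d"
    unfolding upper_left_mult[OF h(1) hbT gN] h(2) using dN by (intro eq_matI) (auto simp: upper_left_def)
  have lr: "lower_right h * lower_right g = 1\<^sub>m m"
    unfolding lower_right_mult[OF h(1) hb gN] h(2) by (intro eq_matI) (auto simp: lower_right_def)
  have inv: "inv\<^bsub>GL N\<^esub> g = h" by (rule GL_inv_eq[OF gG h])
  show "function_action d N (rank_variety m d t) g = two_sided (rank_variety m d t) (lower_right h) (upper_left g)"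
  proof (intro ext)
    fix f A
    show "function_action d N (rank_variety m d t) g f A
        = two_sided (rank_variety m d t) (lower_right h) (upper_left g) f A"
      using cell_action_eq[OF h(1) hb hbT upper_left_carrier ul, of A] rank_variety_carrier[of A m d t]
      by (simp add: function_action_def two_sided_def inv)
  qed
  have "det (upper_left h) * det (upper_left g) = 1"
    using det_mult[OF upper_left_carrier upper_left_carrier, of h g] ul by simp
  moreover have "det (lower_right h) * det (lower_right g) = 1"
    using det_mult[OF lower_right_carrier lower_right_carrier, of h g] lr by simp
  ultimately show "(lower_right h, upper_left g) \<in> rank_ring.GL_pairs m d"
    using upper_left_carrier lower_right_carrier by (auto simp: rank_ring.GL_pairs_def)
qed

lemma levi_action_image:
  "function_action d N (rank_variety m d t) ` levi N word
    = (\<lambda>(E, F). two_sided (rank_variety m d t) E F) ` rank_ring.GL_pairs m d"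
proof (intro equalityI subsetI)
  fix a assume "a \<in> function_action d N (rank_variety m d t) ` levi N word"
  then obtain g where g: "g \<in> levi N word" "a = function_action d N (rank_variety m d t) g" by auto
  have "g \<in> carrier_mat N N" "det g \<noteq> 0" using g(1) by (auto simp: levi_eq GL_iff)
  then obtain h where h: "h \<in> carrier_mat N N" "h * g = 1\<^sub>m N" by (rule det_nonzero_inverse)
  show "a \<in> (\<lambda>(E, F). two_sided (rank_variety m d t) E F) ` rank_ring.GL_pairs m d"
    using function_action_eq[OF g(1) h] g(2) by (auto intro: rev_image_eqI)
next
  fix a assume "a \<in> (\<lambda>(E, F). two_sided (rank_variety m d t) E F) ` rank_ring.GL_pairs m d"
  then obtain E F where EF: "E \<in> carrier_mat m m" "F \<in> carrier_mat d d" "det E \<noteq> 0" "det F \<noteq> 0"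
    and a: "a = two_sided (rank_variety m d t) E F" by (auto simp: rank_ring.GL_pairs_def)
  obtain E' where E': "E' \<in> carrier_mat m m" "E * E' = 1\<^sub>m m" "E' * E = 1\<^sub>m m" "det E' \<noteq> 0"
    by (rule det_nonzero_inverse[OF EF(1,3)])
  define g where "g = four_block_mat F (0\<^sub>m d m) (0\<^sub>m m d) E'"
  have dm: "d + m = N" using dN by simp
  have gN: "g \<in> carrier_mat N N" using four_block_carrier_mat[OF EF(2) E'(1)] dm by (simp add: g_def)
  have "det g = det F * det E'" unfolding g_def
    by (rule det_four_block_mat_upper_right_zero[OF EF(2) refl zero_carrier_mat E'(1)])
  then have det: "det g \<noteq> 0" using EF(4) E'(4) by simp
  have entry: "g $$ (i, j) = (if i < d then if j < d then F $$ (i, j) else 0 else if j < d then 0 else E' $$ (i - d, j - d))"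
    if "i < N" "j < N" for i j
    using that EF(2) E'(1) dm by (auto simp: g_def)
  have "block_upper d g" "block_upper d (transpose_mat g)"
    using gN dN entry by (auto simp: block_upper_def)
  then have g: "g \<in> levi N word" using gN det by (simp add: levi_eq GL_iff)
  obtain h where h: "h \<in> carrier_mat N N" "g * h = 1\<^sub>m N" "h * g = 1\<^sub>m N"
    by (rule det_nonzero_inverse[OF gN det])
  have "upper_left g = F" using EF(2) dN entry by (intro eq_matI) (auto simp: upper_left_def)
  moreover have "lower_right h = E"
  proof -
    have "lower_right g = E'" using E'(1) entry by (intro eq_matI) (auto simp: lower_right_def)
    then have "E' * lower_right h = 1\<^sub>m m"
      using lower_right_mult[OF gN \<open>block_upper d g\<close> h(1)] h(2) by (auto simp: lower_right_def intro!: eq_matI)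
    then have "E * (E' * lower_right h) = E" using EF(1) by simp
    then show ?thesis using assoc_mult_mat[OF EF(1) E'(1) lower_right_carrier, of h] E'(2) lower_right_carrier[of h] by simp
  qed
  ultimately have "a = function_action d N (rank_variety m d t) g"
    using function_action_eq(1)[OF g h(1,3)] a by simp
  then show "a \<in> function_action d N (rank_variety m d t) ` levi N word" using g by (rule image_eqI)
qed

end

section \<open>Multiplicity freeness\<close>

text \<open>The notion depends only on the set of operators through which the group acts.\<close>

lemma multiplicity_free_cong:
  assumes "act ` G = act' ` G'"
  shows "multiplicity_free G act M \<longleftrightarrow> multiplicity_free G' act' M"
proof -
  have ball: "(\<forall>g\<in>G. P (act g)) \<longleftrightarrow> (\<forall>g\<in>G'. P (act' g))" for P
  proof -
    have "(\<forall>g\<in>G. P (act g)) \<longleftrightarrow> (\<forall>a\<in>act ` G. P a)" by simp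
    also have "\<dots> \<longleftrightarrow> (\<forall>g\<in>G'. P (act' g))" unfolding assms by simp
    finally show ?thesis .
  qed
  have sub: "submodule_of G act V W \<longleftrightarrow> submodule_of G' act' V W" for V W
    unfolding submodule_of_def using ball[of "\<lambda>a. \<forall>f\<in>V. a f \<in> V"] by simp
  have irr: "irreducible_module G act V \<longleftrightarrow> irreducible_module G' act' V" for V
    unfolding irreducible_module_def sub ..
  have "isomorphic_modules G act V W \<longleftrightarrow> isomorphic_modules G' act' V W" for V W
    unfolding isomorphic_modules_def ball[of "\<lambda>a. \<forall>f\<in>V. \<phi> (a f) = a (\<phi> f)" for \<phi>] ..
  then show ?thesis unfolding multiplicity_free_def irreducible_decomposition_def irr by simp
qed

theorem corollary4p1p7:
  fixes d N t :: nat and w :: "nat list"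
  assumes "0 < d" and "d < N"
    and "1 \<le> t" and "t < min d (N - d)"
    and "w = [t + 1..<d + 1] @ [N - t + 1..<N + 1]"
  shows "multiplicity_free (levi N w)
           (function_action d N (determinantal_variety d N t))
           (coordinate_ring (N - d) d (determinantal_variety d N t))"
proof -
  interpret schubert_rank d N t by unfold_locales (use assms(4) in simp_all)
  have w: "w = word" using assms(5) by (simp only: word_def)
  have "t \<le> N - d" "t \<le> d" using assms(4) by simp_all
  from rank_ring.form_ring_multiplicity_free[OF this]
  show ?thesis
    unfolding w determinantal_variety_eq rank_ring.coordinate_ring_eq
      multiplicity_free_cong[OF levi_action_image] .
qed

end
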